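(* Assume that $\mu$ is purifying and ergodic. Let $g:\mathrm{P}(\mathbb{C}^d)\to\mathbb{R}$ be Hölder continuous with $\mathbb{E}_{\nu_{inv}}(g)=0$, let $\tilde g$ be a continuous solution of the Poisson equation $\tilde g-\Pi\tilde g=g$, let $\gamma_g^2=\mathbb{E}_{\nu_{inv}}(\tilde g^2-(\Pi\tilde g)^2)$, and let $S_n(g)=\sum_{k=0}^{n-1}g(\hat x_k)$. Let $t\mapsto a(t)$, $t>0$, be a non-negative function such that $$\lim_{t\to\infty}\frac{t}{a(t)}=\lim_{t\to\infty}\frac{a(t)}{\sqrt t}=+\infty.$$ Then: (1) For all $z\in\mathbb{R}$, $$\lim_{n\to\infty}\sup_{\hat x\in \mathrm{P}(\mathbb{C}^d)}\left|\frac{n}{a^2(n)}\log\left(\mathbb{E}_{\hat x}\left[\exp\left(\frac{a(n)}{n}zS_n(g)\right)\right]\right)-\frac{z^2\gamma_g^2}{2}\right|=0.$$ (2) For any Borel subset $B$ of $\mathbb{R}$, with closure $\bar B$ and interior $B^\circ$, $$\limsup_{n\to\infty}\frac{n}{a^2(n)}\log\left(\sup_{\hat x\in \mathrm{P}(\mathbb{C}^d)}\mathbb{P}_{\hat x}\left(\tfrac1{a(n)}S_n(g)\in B\right)\right)\le-\inf_{y\in\bar B}J(y),$$ $$\liminf_{n\to\infty}\frac{n}{a^2(n)}\log\left(\inf_{\hat x\in \mathrm{P}(\mathbb{C}^d)}\mathbb{P}_{\hat x}\left(\tfrac1{a(n)}S_n(g)\in B\right)\right)\ge-\inf_{y\in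 B^\circ}J(y),$$ where $$J(y)=\sup_{v\in\mathbb{R}}\left(yv-\tfrac12\gamma_g^2v^2\right)=\begin{cases}\frac{y^2}{2\gamma_g^2}&\text{if }\gamma_g^2>0\\0&\text{if }\gamma_g^2=0\text{ and }y=0\\+\infty&\text{if }\gamma_g^2=0\text{ and }y\ne0.\end{cases}$$
   Context: Setting. Let $d\ge 1$ be an integer, $\mathrm{P}(\mathbb{C}^d)$ the complex projective space of $\mathbb{C}^d$ with Borel $\sigma$-algebra $\mathcal{B}$. For nonzero $x\in\mathbb{C}^d$, $\hat x$ is its class in $\mathrm{P}(\mathbb{C}^d)$; for $\hat x\in \mathrm{P}(\mathbb{C}^d)$, $x$ denotes an arbitrary norm-one representative. The metric on $\mathrm{P}(\mathbb{C}^d)$ is $d(\hat x,\hat y)=\sqrt{1-|\langle x,y\rangle|^2}$. Hölder continuous means $\alpha$-Hölder for this metric for some $\alpha\in(0,1]$. For $v\in M_d(\mathbb{C})$ with $vx\neq 0$, $v\cdot\hat x$ is the class of $vx$. $\mu$ is a measure on the Borel sets of $M_d(\mathbb{C})$ with $\int\|v\|^2\mathrm{d}\mu(v)<\infty$ and $\int v^*v\,\mathrm{d}\mu(v)=\mathrm{Id}_{\mathbb{C}^d}$. Kernel. $\Pi(\hat x,S)=\int \mathbf{1}_S(v\cdot\hat x)\|vx\|^2\mathrm{d}\mu(v)$ for $S\in\mathcal{B}$ (the integrand is $0$ when $vx=0$), and $\Pi f(\hat x)=\int f(v\cdot\hat x)\|vx\|^2\mathrm{d}\mu(v)$. Process.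 $\Omega=M_d(\mathbb{C})^{\mathbb{N}}$, elements written $\omega=(v_1,v_2,\dots)$; $\mathcal{O}_n$ is the $\sigma$-algebra generated by the first $n$ coordinates and $\mathcal{O}$ the one generated by all coordinates; $V_i(\omega)=v_i$, $W_n=V_n\cdots V_1$, $W_0=\mathrm{Id}$. For a probability measure $\nu$ on $\mathrm{P}(\mathbb{C}^d)$, $\mathbb{P}_\nu$ is the unique probability measure on $(\mathrm{P}(\mathbb{C}^d)\times\Omega,\mathcal{B}\otimes\mathcal{O})$ with $\mathbb{P}_\nu(S\times O_n)=\int_{S\times O_n}\|W_n(\omega)x\|^2\,\mathrm{d}\nu(\hat x)\,\mathrm{d}\mu^{\otimes n}(\omega)$ for $S\in\mathcal{B}$, $O_n\in\mathcal{O}_n$. On it, $\hat x_n(\hat x,\omega)=W_n(\omega)\cdot\hat x$ when $W_n(\omega)x\ne0$ (which holds $\mathbb{P}_\nu$-a.s.), extended arbitrarily otherwise; $(\hat x_n)$ is a Markov chain with kernel $\Pi$ and initial law $\nu$. $\mathbb{E}_\nu$ is expectation under $\mathbb{P}_\nu$; in particular $\mathbb{E}_{\nu}(g)=\int g\,\mathrm{d}\nu$ for $g$ a function on $\mathrm{P}(\mathbb{C}^d)$. $\mathbb{P}_{\hat x}=\mathbb{P}_{\delta_{\hat x}}$ and $\mathbb{E}_{\hat x}=\mathbb{E}_{\delta_{\hat x}}$. Conventions: $\log 0=-\infty$, $\inf\emptyset=+\infty$. Assumptions. $\mu$ is purifying (assumption (Pur)) if every nonzero orthogonal projector $\pi$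 such that for all $n\in\mathbb{N}$, $\pi v_1^*\cdots v_n^*v_n\cdots v_1\pi\propto\pi$ for $\mu^{\otimes n}$-almost all $(v_1,\dots,v_n)$, has rank one. $\mu$ is ergodic (assumption (Erg)) if there is a unique minimal subspace $E\ne\{0\}$ of $\mathbb{C}^d$ such that $vE\subset E$ for all $v\in\operatorname{supp}\mu$ (minimal among nonzero subspaces with this property). It is known that if $\mu$ is purifying and ergodic then $\Pi$ has a unique invariant probability measure $\nu_{inv}$. Under these assumptions, for Hölder continuous $g$ with $\mathbb{E}_{\nu_{inv}}(g)=0$, the Poisson equation $\tilde g-\Pi\tilde g=g$ has a continuous solution, unique up to an additive constant ($\gamma_g^2$ does not depend on the choice). *)

theory Defs
  imports "HOL-Probability.Probability"
begin

section \<open>Hermitian structure on \<open>\<complex>\<^sup>d\<close>\<close>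

text \<open>The ambient space is \<open>complex ^ 'd\<close> with \<open>'d\<close> a finite type. Its library norm is the Hermitian
  norm, but the library inner product is the real part of the Hermitian product below.\<close>

definition cinner :: "complex ^ 'd \<Rightarrow> complex ^ 'd \<Rightarrow> complex" where
  "cinner x y = (\<Sum>i\<in>UNIV. cnj (x $ i) * y $ i)"

definition cadjoint :: "complex ^ 'd ^ 'd \<Rightarrow> complex ^ 'd ^ 'd" where
  "cadjoint A = (\<chi> i j. cnj (A $ j $ i))"

definition op_norm :: "complex ^ 'd ^ 'd \<Rightarrow> real" where
  "op_norm A = onorm (\<lambda>x. A *v x)"

definition orth_projector :: "complex ^ 'd ^ 'd \<Rightarrow> bool" where
  "orth_projector p \<longleftrightarrow> p ** p = p \<and> cadjoint p = p"

section \<open>The projective space\<close>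

definition same_line :: "complex ^ 'd \<Rightarrow> complex ^ 'd \<Rightarrow> bool" where
  "same_line x y \<longleftrightarrow> x \<noteq> 0 \<and> y \<noteq> 0 \<and> (\<exists>c. y = c *s x)"

lemma same_line_part_equivp: "part_equivp (same_line :: complex ^ 'd \<Rightarrow> complex ^ 'd \<Rightarrow> bool)"
proof (rule part_equivpI)
  have "same_line (1 :: complex ^ 'd) 1"
    by (auto simp: same_line_def intro: exI[of _ 1])
  then show "\<exists>x :: complex ^ 'd. same_line x x" by blast
  show "symp (same_line :: complex ^ 'd \<Rightarrow> complex ^ 'd \<Rightarrow> bool)"
  proof (rule sympI)
    fix x y :: "complex ^ 'd" assume "same_line x y"
    then obtain c where c: "x \<noteq> 0" "y \<noteq> 0" "y = c *s x" by (auto simp: same_line_def)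
    then have "c \<noteq> 0" by auto
    then have "x = inverse c *s y" using c by (simp add: vec_eq_iff)
    with c show "same_line y x" unfolding same_line_def by blast
  qed
  show "transp (same_line :: complex ^ 'd \<Rightarrow> complex ^ 'd \<Rightarrow> bool)"
  proof (rule transpI)
    fix x y z :: "complex ^ 'd" assume a: "same_line x y" "same_line y z"
    then obtain c d where "y = c *s x" "z = d *s y" by (auto simp: same_line_def)
    then have "z = (d * c) *s x" by (simp add: vec_eq_iff)
    with a show "same_line x z" unfolding same_line_def by blast
  qed
qed

text \<open>\<open>abs_cproj x\<close> is the class of a nonzero vector \<open>x\<close>; \<open>abs_cproj 0\<close> is an unspecified point.\<close>

quotient_type (overloaded) 'd cproj = "complex ^ ('d :: finite)" / partial: same_line
  by (rule same_line_part_equivp)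

text \<open>A norm-one representative.\<close>

definition urep :: "'d :: finite cproj \<Rightarrow> complex ^ 'd" where
  "urep p = (SOME x. norm x = 1 \<and> abs_cproj x = p)"

lemma norm_cscale: "norm (c *s x) = cmod c * norm (x :: complex ^ 'd)"
proof -
  have "norm (c *s x) = L2_set (\<lambda>i. cmod c * norm (x $ i)) UNIV"
    by (simp add: norm_vec_def norm_mult)
  also have "\<dots> = cmod c * norm x"
    by (simp add: norm_vec_def L2_set_right_distrib)
  finally show ?thesis .
qed

lemma abs_cproj_eq_iff:
  assumes "x \<noteq> 0" "y \<noteq> 0"
  shows "abs_cproj x = abs_cproj y \<longleftrightarrow> (\<exists>c. y = c *s x)"
proof -
  have refl: "same_line x x" if "x \<noteq> 0" for x :: "complex ^ 'a"
    using that by (auto simp: same_line_def intro!: exI[of _ 1])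
  show ?thesis
    using Quotient3_rel[OF Quotient3_cproj, of x y] refl assms
    by (auto simp: same_line_def)
qed

lemma ex_urep: "\<exists>x. norm x = 1 \<and> abs_cproj x = (p :: 'd :: finite cproj)"
proof -
  obtain x where "same_line x x" "abs_cproj x = p"
    using Quotient3_abs_rep[OF Quotient3_cproj] Quotient3_rep_reflp[OF Quotient3_cproj] by metis
  then have x: "x \<noteq> 0" "abs_cproj x = p" by (auto simp: same_line_def)
  define y where "y = complex_of_real (inverse (norm x)) *s x"
  have n: "norm y = 1" using x by (simp add: y_def norm_cscale norm_inverse)
  then have "y \<noteq> 0" by auto
  then have "abs_cproj x = abs_cproj y"
    using x abs_cproj_eq_iff y_def by blast
  with n x show ?thesis by auto
qed

lemma norm_urep [simp]: "norm (urep p) = 1" and abs_urep [simp]: "abs_cproj (urep p) = p"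
  using someI_ex[OF ex_urep[of p]] by (auto simp: urep_def)

text \<open>Up to the factor \<open>sqrt 2\<close> the metric is the Hilbert-Schmidt distance of the rank-one projectors;
  this yields the triangle inequality.\<close>

definition rank_one :: "complex ^ 'd \<Rightarrow> complex ^ 'd ^ 'd" where
  "rank_one x = (\<chi> i j. x $ i * cnj (x $ j))"

lemma cinner_self: "cinner x x = complex_of_real ((norm x)\<^sup>2)"
proof -
  have "(norm x)\<^sup>2 = (\<Sum>i\<in>UNIV. (cmod (x $ i))\<^sup>2)"
    by (simp add: norm_vec_def L2_set_def sum_nonneg)
  then show ?thesis
    by (simp only: of_real_sum complex_norm_square cinner_def) (simp add: mult.commute)
qed

lemma cinner_commute: "cinner y x = cnj (cinner x y)"
  by (simp add: cinner_def mult.commute)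

lemma norm_rank_one_diff:
  assumes "norm x = 1" "norm y = 1"
  shows "(norm (rank_one x - rank_one y))\<^sup>2 = 2 * (1 - (cmod (cinner x y))\<^sup>2)"
proof -
  have prod: "(\<Sum>i\<in>UNIV. \<Sum>j\<in>UNIV. (cnj (u $ i) * v $ i) * (cnj (w $ j) * z $ j)) = cinner u v * cinner w z"
    for u v w z :: "complex ^ 'a"
    by (simp add: cinner_def sum_product)
  have "complex_of_real ((norm (rank_one x - rank_one y))\<^sup>2)
      = (\<Sum>i\<in>UNIV. \<Sum>j\<in>UNIV. complex_of_real ((cmod (x $ i * cnj (x $ j) - y $ i * cnj (y $ j)))\<^sup>2))"
    by (simp add: norm_vec_def L2_set_def sum_nonneg rank_one_def)
  also have "\<dots> = (\<Sum>i\<in>UNIV. \<Sum>j\<in>UNIV.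
       (cnj (x $ i) * x $ i) * (cnj (x $ j) * x $ j) - (cnj (y $ i) * x $ i) * (cnj (x $ j) * y $ j)
     - (cnj (x $ i) * y $ i) * (cnj (y $ j) * x $ j) + (cnj (y $ i) * y $ i) * (cnj (y $ j) * y $ j))"
    by (intro sum.cong refl) (simp only: complex_norm_square, simp add: algebra_simps)
  also have "\<dots> = cinner x x * cinner x x - cinner y x * cinner x y
      - cinner x y * cinner y x + cinner y y * cinner y y"
    by (simp add: sum.distrib sum_subtractf prod)
  also have "\<dots> = complex_of_real (2 * (1 - (cmod (cinner x y))\<^sup>2))"
    using assms complex_norm_square[of "cinner x y"]
    by (simp add: cinner_self cinner_commute[of y x] algebra_simps)
  finally show ?thesis using of_real_eq_iff by blast
qed

instantiation cproj :: (finite) metric_space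
begin

definition dist_cproj :: "'a cproj \<Rightarrow> 'a cproj \<Rightarrow> real" where
  "dist_cproj p q = sqrt (1 - (cmod (cinner (urep p) (urep q)))\<^sup>2)"

definition uniformity_cproj :: "('a cproj \<times> 'a cproj) filter" where
  "uniformity_cproj = (INF e\<in>{0<..}. principal {(x, y). dist x y < e})"

definition open_cproj :: "'a cproj set \<Rightarrow> bool" where
  "open_cproj U \<longleftrightarrow> (\<forall>x\<in>U. eventually (\<lambda>(x', y). x' = x \<longrightarrow> y \<in> U) uniformity)"

instance
proof
  have d: "dist p q = norm (rank_one (urep p) - rank_one (urep q)) / sqrt 2" for p q :: "'a cproj"
  proof -
    have "(norm (rank_one (urep p) - rank_one (urep q)))\<^sup>2 / 2 = 1 - (cmod (cinner (urep p) (urep q)))\<^sup>2"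
      by (simp add: norm_rank_one_diff)
    then have "dist p q = sqrt ((norm (rank_one (urep p) - rank_one (urep q)))\<^sup>2 / 2)"
      by (simp add: dist_cproj_def)
    then show ?thesis by (simp add: real_sqrt_divide)
  qed
  fix p q r :: "'a cproj"
  show "dist p q = 0 \<longleftrightarrow> p = q"
  proof
    assume "dist p q = 0"
    then have "rank_one (urep p) = rank_one (urep q)" by (simp add: d)
    then have e: "urep p $ i * cnj (urep p $ j) = urep q $ i * cnj (urep q $ j)" for i j
      by (simp add: rank_one_def vec_eq_iff)
    have nz: "urep p \<noteq> 0" "urep q \<noteq> 0" by (metis norm_urep norm_zero zero_neq_one)+
    then obtain j where j: "urep q $ j \<noteq> 0" by (auto simp: vec_eq_iff)
    have "urep q = (cnj (urep p $ j) / cnj (urep q $ j)) *s urep p"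
      using e[of _ j] j by (simp add: vec_eq_iff field_simps)
    then have "abs_cproj (urep p) = abs_cproj (urep q)"
      using abs_cproj_eq_iff nz by blast
    then show "p = q" by simp
  qed (simp add: d)
  have "norm (rank_one (urep p) - rank_one (urep q))
     \<le> norm (rank_one (urep p) - rank_one (urep r)) + norm (rank_one (urep q) - rank_one (urep r))"
    by (metis norm_minus_commute norm_triangle_ineq diff_add_cancel add_diff_eq)
  then show "dist p q \<le> dist p r + dist q r"
    by (simp add: d divide_right_mono flip: add_divide_distrib)
qed (simp_all add: uniformity_cproj_def open_cproj_def)

end

text \<open>\<open>act v p\<close> is the class of \<open>v x\<close>, unspecified when \<open>v x = 0\<close>.\<close>

definition act :: "complex ^ 'd ^ 'd \<Rightarrow> 'd :: finite cproj \<Rightarrow> 'd cproj" where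
  "act v p = abs_cproj (v *v urep p)"

definition holder_continuous :: "('a :: metric_space \<Rightarrow> real) \<Rightarrow> bool" where
  "holder_continuous g \<longleftrightarrow>
     (\<exists>\<alpha> C. 0 < \<alpha> \<and> \<alpha> \<le> 1 \<and> (\<forall>x y. \<bar>g x - g y\<bar> \<le> C * dist x y powr \<alpha>))"

section \<open>The Markov kernel\<close>

definition kernel :: "(complex ^ 'd ^ 'd) measure \<Rightarrow> 'd :: finite cproj \<Rightarrow> 'd cproj set \<Rightarrow> ennreal" where
  "kernel \<mu> p S = (\<integral>\<^sup>+ v. indicator S (act v p) * ennreal ((norm (v *v urep p))\<^sup>2) \<partial>\<mu>)"

definition kernel_op :: "(complex ^ 'd ^ 'd) measure \<Rightarrow> ('d :: finite cproj \<Rightarrow> real) \<Rightarrow> 'd cproj \<Rightarrow> real" where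
  "kernel_op \<mu> f p = (\<integral> v. f (act v p) * (norm (v *v urep p))\<^sup>2 \<partial>\<mu>)"

definition invariant_prob :: "(complex ^ 'd ^ 'd) measure \<Rightarrow> 'd :: finite cproj measure \<Rightarrow> bool" where
  "invariant_prob \<mu> \<nu> \<longleftrightarrow> prob_space \<nu> \<and> sets \<nu> = sets borel \<and>
     (\<forall>S\<in>sets borel. emeasure \<nu> S = (\<integral>\<^sup>+ p. kernel \<mu> p S \<partial>\<nu>))"

section \<open>Trajectories\<close>

text \<open>A trajectory is a sequence \<open>\<omega> :: nat \<Rightarrow> complex ^ 'd ^ 'd\<close> whose entry \<open>\<omega> i\<close> is the matrix \<open>v\<close> with
  index \<open>i + 1\<close>. Hence \<open>W n \<omega> = \<omega> (n - 1) ** \<dots> ** \<omega> 0\<close>, which depends on the coordinates below \<open>n\<close> only,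
  so that \<open>W n\<close> also applies to elements of the product indexed by \<open>{..<n}\<close>.\<close>

primrec W :: "nat \<Rightarrow> (nat \<Rightarrow> complex ^ 'd ^ 'd) \<Rightarrow> complex ^ 'd ^ 'd" where
  "W 0 \<omega> = mat 1"
| "W (Suc n) \<omega> = \<omega> n ** W n \<omega>"

text \<open>A finite second moment makes \<open>\<mu>\<close> sigma-finite away from the zero matrix. The zero matrix may have
  infinite mass, but it does not contribute below: there \<open>W n \<omega> = 0\<close> as soon as one factor is \<open>0\<close>.\<close>

definition tensor_power :: "(complex ^ 'd ^ 'd) measure \<Rightarrow> nat \<Rightarrow> (nat \<Rightarrow> complex ^ 'd ^ 'd) measure" where
  "tensor_power \<mu> n = PiM {..<n} (\<lambda>_. \<mu>)"

text \<open>The sets \<open>{\<omega>. restrict \<omega> {..<n} \<in> A}\<close> below are exactly the events generated by the first \<open>n\<close>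
  coordinates.\<close>

definition is_path_measure ::
  "(complex ^ 'd ^ 'd) measure \<Rightarrow> 'd :: finite cproj measure \<Rightarrow>
   ('d cproj \<times> (nat \<Rightarrow> complex ^ 'd ^ 'd)) measure \<Rightarrow> bool" where
  "is_path_measure \<mu> \<nu> P \<longleftrightarrow>
     prob_space P \<and> sets P = sets (borel \<Otimes>\<^sub>M PiM UNIV (\<lambda>_. borel)) \<and>
     (\<forall>n. \<forall>S\<in>sets borel. \<forall>A\<in>sets (PiM {..<n} (\<lambda>_. borel)).
        emeasure P (S \<times> {\<omega>. restrict \<omega> {..<n} \<in> A}) =
        (\<integral>\<^sup>+ p. indicator S p *
           (\<integral>\<^sup>+ \<omega>. indicator A \<omega> * ennreal ((norm (W n \<omega> *v urep p))\<^sup>2) \<partial>tensor_power \<mu> n) \<partial>\<nu>))"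

definition path_measure ::
  "(complex ^ 'd ^ 'd) measure \<Rightarrow> 'd :: finite cproj measure \<Rightarrow>
   ('d cproj \<times> (nat \<Rightarrow> complex ^ 'd ^ 'd)) measure" where
  "path_measure \<mu> \<nu> = (THE P. is_path_measure \<mu> \<nu> P)"

definition path_measure_at ::
  "(complex ^ 'd ^ 'd) measure \<Rightarrow> 'd :: finite cproj \<Rightarrow>
   ('d cproj \<times> (nat \<Rightarrow> complex ^ 'd ^ 'd)) measure" where
  "path_measure_at \<mu> p = path_measure \<mu> (return borel p)"

definition chain :: "nat \<Rightarrow> 'd :: finite cproj \<times> (nat \<Rightarrow> complex ^ 'd ^ 'd) \<Rightarrow> 'd cproj" where
  "chain n \<xi> = act (W n (snd \<xi>)) (fst \<xi>)"

definition birkhoff_sum ::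
  "('d :: finite cproj \<Rightarrow> real) \<Rightarrow> nat \<Rightarrow> 'd cproj \<times> (nat \<Rightarrow> complex ^ 'd ^ 'd) \<Rightarrow> real" where
  "birkhoff_sum g n \<xi> = (\<Sum>k<n. g (chain k \<xi>))"

section \<open>Assumptions on the measure\<close>

definition purifying :: "(complex ^ 'd ^ 'd) measure \<Rightarrow> bool" where
  "purifying \<mu> \<longleftrightarrow>
     (\<forall>p. orth_projector p \<and> p \<noteq> 0 \<and>
        (\<forall>n. AE \<omega> in tensor_power \<mu> n.
           \<exists>c. p ** cadjoint (W n \<omega>) ** W n \<omega> ** p = mat c ** p)
      \<longrightarrow> rank p = 1)"

definition msupport :: "'a :: topological_space measure \<Rightarrow> 'a set" where
  "msupport \<mu> = {x. \<forall>U. open U \<and> x \<in> U \<longrightarrow> emeasure \<mu> U > 0}"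

text \<open>Plain \<open>subspace\<close> is real-linear; \<open>vec.subspace\<close> is the complex-linear notion on \<open>complex ^ 'd\<close>.\<close>

definition invariant_subspace :: "(complex ^ 'd ^ 'd) measure \<Rightarrow> (complex ^ 'd) set \<Rightarrow> bool" where
  "invariant_subspace \<mu> E \<longleftrightarrow> vec.subspace E \<and> E \<noteq> {0} \<and>
     (\<forall>v\<in>msupport \<mu>. (\<lambda>x. v *v x) ` E \<subseteq> E)"

definition ergodic :: "(complex ^ 'd ^ 'd) measure \<Rightarrow> bool" where
  "ergodic \<mu> \<longleftrightarrow>
     (\<exists>!E. invariant_subspace \<mu> E \<and> (\<forall>F. invariant_subspace \<mu> F \<and> F \<subseteq> E \<longrightarrow> F = E))"

section \<open>Variance, rate function, logarithm\<close>

definition asymp_var ::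
  "(complex ^ 'd ^ 'd) measure \<Rightarrow> 'd :: finite cproj measure \<Rightarrow> ('d cproj \<Rightarrow> real) \<Rightarrow> real" where
  "asymp_var \<mu> \<nu> gt = (\<integral> p. (gt p)\<^sup>2 - (kernel_op \<mu> gt p)\<^sup>2 \<partial>\<nu>)"

text \<open>The first argument is the variance, i.e. the square of \<open>\<gamma>\<close>.\<close>

definition rate_fun :: "real \<Rightarrow> real \<Rightarrow> ereal" where
  "rate_fun \<gamma>2 y = (SUP v::real. ereal (y * v - \<gamma>2 * v\<^sup>2 / 2))"

definition elog :: "real \<Rightarrow> ereal" where
  "elog x = (if x \<le> 0 then -\<infinity> else ereal (ln x))"

end

theory Submission
  imports Defs "HOL-Complex_Analysis.Great_Picard"
begin

text \<open>
  Since the exponential moments of \<open>S\<^sub>n = \<Sum>k<n. g (x\<^sub>k)\<close> are iterates of the weighted Markov operator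
  \<open>f \<mapsto> exp (c * g) * \<Pi> f\<close> (\<open>exp_moment\<close>), everything reduces to finding approximate positive
  eigenfunctions of this operator for small \<open>c\<close>. The ansatz \<open>\<psi> = exp (c * gt + c\<^sup>2 * \<eta>)\<close> gives, by a
  second order expansion,
  \<open>exp (c * g) * \<Pi> \<psi> = \<psi> * exp (c * (g + \<Pi> gt - gt) + c\<^sup>2 * (\<Pi> \<eta> - \<eta> + h / 2) + O(c\<^sup>3))\<close>,
  where \<open>h = \<Pi> (gt\<^sup>2) - (\<Pi> gt)\<^sup>2\<close>. The first order term is zero by the Poisson equation of \<open>g\<close>. If
  \<open>\<eta>\<close> solves \<open>\<eta> - \<Pi> \<eta> = (h - \<gamma>\<^sup>2) / 2\<close> up to a small error, then the factor is nearly
  \<open>exp (c\<^sup>2 * \<gamma>\<^sup>2 / 2)\<close>, uniformly in the initial point (\<open>log_moment_bound\<close>). With \<open>c = z * a n / n\<close>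
  this is the first claim: the error \<open>O(c)\<close> from the comparison of \<open>1\<close> with \<open>\<psi>\<close> is negligible because
  \<open>a n\<close> tends to infinity, the relative error in the factor because \<open>a n / n\<close> tends to zero. The
  second claim follows from the first by Chernoff bounds and exponential tilting
  (\<open>upper_bound\<close>, \<open>lower_bound\<close>).

  Such an \<open>\<eta>\<close> exists as soon as the ergodic means of the continuous function \<open>h\<close> converge uniformly to a
  constant (\<open>approximate_poisson\<close>, \<open>ergodic_mean_converges\<close>). This is where purification and
  ergodicity enter. Functions on the projective space are lifted to functions on vectors that are
  homogeneous of degree two. On lifts \<open>\<Pi>\<close> is the operator \<open>T \<Phi> z = \<integral> \<Phi> (v z) \<partial>\<mu>\<close>, which fixes the
  squared norm. Hence all \<open>T\<^sup>n \<Phi>\<close> have the same modulus of continuity, if this modulus is expressed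
  through squared norms (\<open>transfer_modulus\<close>), and the theorem of Arzela and Ascoli reduces the
  convergence to the fact that continuous harmonic functions are constant.

  For this fact, consider \<open>T\<close> on functions of pairs of vectors. The defect in the parallelogram law of
  a lift vanishes on dependent pairs, so it is at most \<open>\<epsilon> * norm\<^sup>2 + C * area\<close>
  (\<open>quad_homog_dominated\<close>). For a harmonic function the defect is invariant under \<open>T\<close>, whereas the
  area decays under its iterates: the mean area spanned by the images of an orthonormal pair is at
  most one, with equality only if almost every product of matrices is conformal on the plane of the
  pair, and purification excludes this for all lengths of the product. Compactness yields a strict
  contraction (\<open>area_contraction\<close>). So the lift of a harmonic function satisfies the parallelogram law, and
  the vectors at which it is maximal form a nonzero subspace that is invariant under the support of
  \<open>\<mu>\<close>; the same holds for the minimum. Two such subspaces contain the unique minimal one, hence the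
  maximum and the minimum agree (\<open>harmonic_constant\<close>).

  The measure \<open>\<mu>\<close> may give infinite mass to the zero matrix. Its powers are compared with those of
  its sigma-finite restriction to nonzero matrices (\<open>nn_integral_tensor_power\<close>), and from these the
  measure on trajectories is obtained by Kolmogorov's extension theorem.
\<close>

section \<open>The projective space as a set of rank-one matrices\<close>

lemma cscale_real: "complex_of_real r *s x = r *\<^sub>R x"
  unfolding vec_eq_iff by (simp add: scaleR_conv_of_real[where 'a=complex])

lemma abs_cproj_cscale:
  assumes "c \<noteq> 0" "x \<noteq> 0"
  shows "abs_cproj (c *s x) = abs_cproj x"
proof -
  have "c *s x \<noteq> 0" using assms by (auto simp: vec_eq_iff)
  then show ?thesis using abs_cproj_eq_iff[of x "c *s x"] assms by auto
qed

lemma urep_nonzero [simp]: "urep p \<noteq> 0"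
  by (metis norm_urep norm_zero zero_neq_one)

lemma urep_abs_cproj:
  assumes "x \<noteq> 0"
  obtains c where "cmod c = norm x" "x = c *s urep (abs_cproj x)"
proof -
  have "abs_cproj (urep (abs_cproj x)) = abs_cproj x" by simp
  then obtain c where c: "x = c *s urep (abs_cproj x)"
    using abs_cproj_eq_iff[of "urep (abs_cproj x)" x] assms by auto
  have "norm x = cmod c"
    using arg_cong[OF c, of norm] by (simp only: norm_cscale) simp
  with c that show ?thesis by metis
qed

text \<open>The extension of a function on the projective space to vectors that is homogeneous of degree
  two. The weight \<open>(norm (v x))\<^sup>2\<close> of the kernel is absorbed by the lift, so on lifts the Markov
  operator is the plain integral of the function \<open>v \<mapsto> lift f (v x)\<close>, without any normalisation.\<close>

definition lift :: "('d :: finite cproj \<Rightarrow> real) \<Rightarrow> complex ^ 'd \<Rightarrow> real" where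
  "lift f x = (norm x)\<^sup>2 * f (abs_cproj x)"

lemma lift_zero [simp]: "lift f 0 = 0"
  by (simp add: lift_def)

lemma lift_urep [simp]: "lift f (urep p) = f p"
  by (simp add: lift_def)

lemma lift_unit: "norm x = 1 \<Longrightarrow> lift f x = f (abs_cproj x)"
  by (simp add: lift_def)

lemma lift_cscale: "lift f (c *s x) = (cmod c)\<^sup>2 * lift f x"
  by (cases "c = 0 \<or> x = 0") (auto simp: lift_def norm_cscale abs_cproj_cscale power_mult_distrib)

lemma lift_scaleR: "lift f (r *\<^sub>R x) = r\<^sup>2 * lift f x"
  using lift_cscale[of f "complex_of_real r" x] by (simp add: cscale_real)

lemma rank_one_cscale: "rank_one (c *s x) = (cmod c)\<^sup>2 *\<^sub>R rank_one x"
  unfolding vec_eq_iff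
  by (simp add: rank_one_def scaleR_conv_of_real[where 'a=complex] complex_norm_square del: of_real_power)

lemma norm_rank_one: "norm (rank_one x) = (norm x)\<^sup>2"
proof -
  have "(norm (rank_one x))\<^sup>2 = (\<Sum>i\<in>UNIV. \<Sum>j\<in>UNIV. (cmod (x $ i))\<^sup>2 * (cmod (x $ j))\<^sup>2)"
    by (simp add: norm_vec_def L2_set_def sum_nonneg rank_one_def norm_mult power_mult_distrib)
  also have "\<dots> = ((norm x)\<^sup>2)\<^sup>2"
    by (simp add: norm_vec_def L2_set_def sum_nonneg power2_eq_square[of "sum _ _"] sum_product)
  finally show ?thesis by (rule power2_eq_imp_eq) auto
qed

text \<open>The metric is the one induced by this embedding, up to the factor \<open>sqrt 2\<close>. It trades the
  arbitrary choice made in \<^const>\<open>urep\<close> for an object that depends continuously on the point.\<close>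

definition line_proj :: "'d :: finite cproj \<Rightarrow> complex ^ 'd ^ 'd" where
  "line_proj p = rank_one (urep p)"

lemma dist_line_proj: "dist p q = norm (line_proj p - line_proj q) / sqrt 2"
proof -
  have "dist p q = sqrt ((norm (line_proj p - line_proj q))\<^sup>2 / 2)"
    by (simp add: dist_cproj_def line_proj_def norm_rank_one_diff)
  then show ?thesis by (simp add: real_sqrt_divide)
qed

lemma line_proj_abs_cproj:
  assumes "x \<noteq> 0"
  shows "line_proj (abs_cproj x) = rank_one x /\<^sub>R (norm x)\<^sup>2"
proof -
  obtain c where c: "cmod c = norm x" "x = c *s urep (abs_cproj x)"
    using urep_abs_cproj[OF assms] .
  have "rank_one x = (norm x)\<^sup>2 *\<^sub>R line_proj (abs_cproj x)"
    using rank_one_cscale[of c "urep (abs_cproj x)"] c by (simp add: line_proj_def)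
  then show ?thesis using assms by simp
qed

lemma continuous_line_proj: "continuous_on UNIV line_proj"
  unfolding continuous_on_iff
proof (intro ballI allI impI)
  fix p :: "'a cproj" and e :: real assume "0 < e"
  then show "\<exists>d>0. \<forall>q\<in>UNIV. dist q p < d \<longrightarrow> dist (line_proj q) (line_proj p) < e"
    by (intro exI[of _ "e / sqrt 2"]) (auto simp: dist_line_proj dist_norm divide_strict_right_mono field_simps)
qed

lemma continuous_rank_one: "continuous_on S rank_one"
  unfolding rank_one_def
  by (intro continuous_intros)

lemma continuous_abs_cproj: "continuous_on (- {0}) abs_cproj"
proof -
  have *: "continuous_on (- {0 :: complex ^ 'a}) (\<lambda>x. rank_one x /\<^sub>R (norm x)\<^sup>2)"
    by (intro continuous_intros continuous_rank_one) auto
  show ?thesis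
    unfolding continuous_on_iff
  proof (intro ballI allI impI)
    fix x :: "complex ^ 'a" and e :: real assume x: "x \<in> - {0}" and "0 < e"
    then have "0 < e * sqrt 2" by simp
    with * x obtain d where d: "d > 0" "\<And>y. y \<in> - {0} \<Longrightarrow> dist y x < d \<Longrightarrow>
       dist (rank_one y /\<^sub>R (norm y)\<^sup>2) (rank_one x /\<^sub>R (norm x)\<^sup>2) < e * sqrt 2"
      unfolding continuous_on_iff by meson
    have "dist (abs_cproj y) (abs_cproj x) < e" if y: "y \<in> - {0}" "dist y x < d" for y
      using d(2)[OF y] x y by (simp add: dist_line_proj line_proj_abs_cproj dist_norm field_simps)
    with d(1) show "\<exists>d>0. \<forall>y\<in>- {0}. dist y x < d \<longrightarrow> dist (abs_cproj y) (abs_cproj x) < e"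
      by blast
  qed
qed

lemma abs_cproj_sphere: "abs_cproj ` sphere 0 1 = UNIV"
  by (auto intro!: image_eqI[of _ _ "urep _"])

lemma continuous_abs_cproj_sphere: "continuous_on (sphere 0 1) abs_cproj"
  by (rule continuous_on_subset[OF continuous_abs_cproj]) auto

lemma compact_cproj: "compact (UNIV :: 'd :: finite cproj set)"
  by (metis abs_cproj_sphere compact_continuous_image compact_sphere continuous_abs_cproj_sphere)

text \<open>The projective space carries the quotient topology of the unit sphere, since the
  projection maps compact sets to closed ones.\<close>

lemma continuous_on_cprojI:
  fixes f :: "'d :: finite cproj \<Rightarrow> 'b :: topological_space"
  assumes "continuous_on (sphere 0 1) (\<lambda>x. f (abs_cproj x))"
  shows "continuous_on UNIV f"
  unfolding continuous_on_closed_vimage[OF closed_UNIV]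
proof (intro allI impI)
  fix B :: "'b set" assume "closed B"
  let ?K = "(\<lambda>x. f (abs_cproj x)) -` B \<inter> sphere 0 1"
  have "closed ?K"
    using assms \<open>closed B\<close> by (simp add: continuous_on_closed_vimage)
  then have "compact ?K"
    by (metis compact_Int_closed compact_sphere inf.idem inf_assoc inf_commute)
  then have "compact (abs_cproj ` ?K)"
    by (intro compact_continuous_image continuous_on_subset[OF continuous_abs_cproj_sphere]) auto
  moreover have "f -` B \<inter> UNIV = abs_cproj ` ?K"
    by (auto intro!: image_eqI[of _ _ "urep _"])
  ultimately show "closed (f -` B \<inter> UNIV)"
    by (simp add: compact_imp_closed)
qed

lemma cproj_bounded:
  fixes f :: "'d :: finite cproj \<Rightarrow> real"
  assumes "continuous_on UNIV f"
  obtains M where "M > 0" "\<And>p. \<bar>f p\<bar> \<le> M"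
proof -
  have "bounded (range f)"
    using compact_continuous_image[OF assms compact_cproj] by (rule compact_imp_bounded)
  then obtain M where "M > 0" "\<And>p. \<bar>f p\<bar> \<le> M"
    by (metis bounded_pos rangeI real_norm_def)
  then show ?thesis by (rule that)
qed

section \<open>Homogeneous functions of degree two\<close>

definition quad_homog :: "('a :: real_normed_vector \<Rightarrow> real) \<Rightarrow> bool" where
  "quad_homog \<Phi> \<longleftrightarrow> continuous_on UNIV \<Phi> \<and> (\<forall>r z. \<Phi> (r *\<^sub>R z) = r\<^sup>2 * \<Phi> z)"

lemma quad_homog_cont: "quad_homog \<Phi> \<Longrightarrow> continuous_on UNIV \<Phi>"
  and quad_homog_scaleR: "quad_homog \<Phi> \<Longrightarrow> \<Phi> (r *\<^sub>R z) = r\<^sup>2 * \<Phi> z"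
  by (simp_all add: quad_homog_def)

lemma quad_homog_zero: "quad_homog \<Phi> \<Longrightarrow> \<Phi> 0 = 0"
  using quad_homog_scaleR[of \<Phi> 0 0] by simp

lemma quad_homog_add: "quad_homog \<Phi> \<Longrightarrow> quad_homog \<Psi> \<Longrightarrow> quad_homog (\<lambda>z. \<Phi> z + \<Psi> z)"
  by (auto simp: quad_homog_def algebra_simps intro!: continuous_intros)

lemma quad_homog_cmult: "quad_homog \<Phi> \<Longrightarrow> quad_homog (\<lambda>z. c * \<Phi> z)"
  by (auto simp: quad_homog_def algebra_simps intro!: continuous_intros)

lemma quad_homog_diff: "quad_homog \<Phi> \<Longrightarrow> quad_homog \<Psi> \<Longrightarrow> quad_homog (\<lambda>z. \<Phi> z - \<Psi> z)"
  by (auto simp: quad_homog_def algebra_simps intro!: continuous_intros)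

lemma quad_homog_norm: "quad_homog (\<lambda>z. (norm z)\<^sup>2)"
  by (auto simp: quad_homog_def power_mult_distrib intro!: continuous_intros)

lemma quad_homog_linear:
  assumes "quad_homog \<Phi>" "bounded_linear L"
  shows "quad_homog (\<lambda>z. \<Phi> (L z))"
proof -
  have "continuous_on UNIV (\<lambda>z. \<Phi> (L z))"
    using continuous_on_compose2[OF quad_homog_cont[OF assms(1)] linear_continuous_on[OF assms(2)]] by auto
  then show ?thesis
    using assms by (simp add: quad_homog_def linear_simps)
qed

text \<open>By homogeneity, the comparison below is one on the unit sphere, where \<open>\<Psi>\<close> is bounded away
  from zero on the compact set of points at which \<open>\<Phi>\<close> exceeds \<open>\<epsilon>\<close> in absolute value.\<close>

lemma quad_homog_dominated:
  fixes \<Phi> \<Psi> :: "'a :: euclidean_space \<Rightarrow> real"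
  assumes \<Phi>: "quad_homog \<Phi>" and \<Psi>: "quad_homog \<Psi>" and nonneg: "\<And>z. \<Psi> z \<ge> 0"
    and zero: "\<And>z. \<Psi> z = 0 \<Longrightarrow> \<Phi> z = 0" and "\<epsilon> > 0"
  obtains C where "C \<ge> 0" "\<And>z. \<bar>\<Phi> z\<bar> \<le> \<epsilon> * (norm z)\<^sup>2 + C * \<Psi> z"
proof -
  have c: "continuous_on (sphere 0 1) \<Phi>" "continuous_on A \<Psi>" for A
    using \<Phi> \<Psi> by (auto dest: quad_homog_cont intro: continuous_on_subset)
  define K where "K = {z \<in> sphere 0 1. \<epsilon> \<le> \<bar>\<Phi> z\<bar>}"
  have "K = sphere 0 1 \<inter> {z. \<epsilon> \<le> \<bar>\<Phi> z\<bar>}"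
    by (auto simp: K_def)
  moreover have "closed {z. \<epsilon> \<le> \<bar>\<Phi> z\<bar>}"
    by (intro closed_Collect_le continuous_intros quad_homog_cont[OF \<Phi>])
  ultimately have K: "compact K"
    by (simp add: compact_Int_closed)
  have "bounded (\<Phi> ` sphere 0 1)"
    by (intro compact_imp_bounded compact_continuous_image c) simp
  then obtain M where M: "M > 0" "\<And>z. norm z = 1 \<Longrightarrow> \<bar>\<Phi> z\<bar> \<le> M"
    by (auto simp: bounded_pos)
  have "\<exists>m>0. \<forall>z\<in>K. m \<le> \<Psi> z"
  proof (cases "K = {}")
    case False
    then obtain z0 where z0: "z0 \<in> K" "\<And>z. z \<in> K \<Longrightarrow> \<Psi> z0 \<le> \<Psi> z"
      using continuous_attains_inf[OF K _ c(2)] by blast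
    have "\<Psi> z0 \<noteq> 0" using zero[of z0] z0(1) \<open>\<epsilon> > 0\<close> by (auto simp: K_def)
    then show ?thesis using z0 nonneg[of z0] by (intro exI[of _ "\<Psi> z0"]) auto
  qed (auto intro: exI[of _ 1])
  then obtain m where m: "m > 0" "\<And>z. z \<in> K \<Longrightarrow> m \<le> \<Psi> z" by blast
  have unit: "\<bar>\<Phi> z\<bar> \<le> \<epsilon> + M / m * \<Psi> z" if "norm z = 1" for z
  proof (cases "z \<in> K")
    case True
    have "M / m * m \<le> M / m * \<Psi> z" using m True M by (intro mult_left_mono) auto
    then show ?thesis using M(2)[OF that] m(1) \<open>\<epsilon> > 0\<close> by simp
  next
    case False
    then show ?thesis using that nonneg[of z] m(1) M(1) by (auto simp: K_def intro: add_increasing2)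
  qed
  show ?thesis
  proof (rule that[of "M / m"])
    fix z :: 'a
    show "\<bar>\<Phi> z\<bar> \<le> \<epsilon> * (norm z)\<^sup>2 + M / m * \<Psi> z"
    proof (cases "z = 0")
      case False
      define u where "u = z /\<^sub>R norm z"
      have u: "norm u = 1" "z = norm z *\<^sub>R u" using False by (auto simp: u_def)
      have "\<bar>\<Phi> z\<bar> = (norm z)\<^sup>2 * \<bar>\<Phi> u\<bar>"
        by (subst u(2), subst quad_homog_scaleR[OF \<Phi>]) (simp add: abs_mult)
      also have "\<dots> \<le> (norm z)\<^sup>2 * (\<epsilon> + M / m * \<Psi> u)"
        by (intro mult_left_mono unit u) auto
      also have "\<dots> = \<epsilon> * (norm z)\<^sup>2 + M / m * ((norm z)\<^sup>2 * \<Psi> u)"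
        by (simp add: algebra_simps)
      also have "(norm z)\<^sup>2 * \<Psi> u = \<Psi> z"
        by (subst (2) u(2), subst quad_homog_scaleR[OF \<Psi>]) simp
      finally show ?thesis .
    qed (use \<Phi> \<Psi> in \<open>simp add: quad_homog_zero\<close>)
  qed (use m M in auto)
qed

lemma quad_homog_bounded:
  fixes \<Phi> :: "'a :: euclidean_space \<Rightarrow> real"
  assumes "quad_homog \<Phi>"
  obtains M where "M \<ge> 0" "\<And>z. \<bar>\<Phi> z\<bar> \<le> M * (norm z)\<^sup>2"
proof -
  obtain C where "C \<ge> 0" "\<And>z. \<bar>\<Phi> z\<bar> \<le> 1 * (norm z)\<^sup>2 + C * (norm z)\<^sup>2"
    using quad_homog_dominated[OF assms quad_homog_norm, of 1]
    by (metis norm_eq_zero power_zero_numeral quad_homog_zero[OF assms] zero_eq_power2 zero_le_power2 zero_less_one)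
  then show ?thesis by (intro that[of "1 + C"]) (auto simp: algebra_simps)
qed

text \<open>A modulus of continuity whose right-hand side only involves squared norms. Any integral of the
  type \<open>\<integral> \<Phi> (v z)\<close> over matrices with \<open>\<integral> v\<^sup>* v = 1\<close> inherits it with the same constants.\<close>

definition quad_modulus :: "real \<Rightarrow> real \<Rightarrow> ('a :: real_normed_vector \<Rightarrow> real) \<Rightarrow> bool" where
  "quad_modulus \<epsilon> C \<Phi> \<longleftrightarrow>
     (\<forall>z w. \<bar>\<Phi> z - \<Phi> w\<bar> \<le> \<epsilon> * ((norm z)\<^sup>2 + (norm w)\<^sup>2) + C * (norm (z - w))\<^sup>2)"

text \<open>On pairs \<open>(z, w)\<close>, the difference \<open>\<Phi> z - \<Phi> w\<close> vanishes wherever \<open>(norm (z - w))\<^sup>2\<close> does, so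
  this is an instance of the domination above.\<close>

lemma quad_homog_modulus:
  fixes \<Phi> :: "'a :: euclidean_space \<Rightarrow> real"
  assumes \<Phi>: "quad_homog \<Phi>" and "\<epsilon> > 0"
  obtains C where "C \<ge> 0" "quad_modulus \<epsilon> C \<Phi>"
proof -
  have 1: "quad_homog (\<lambda>z :: 'a \<times> 'a. \<Phi> (fst z) - \<Phi> (snd z))"
    by (intro quad_homog_diff quad_homog_linear[OF \<Phi>] bounded_linear_fst bounded_linear_snd)
  have 2: "quad_homog (\<lambda>z :: 'a \<times> 'a. (norm (fst z - snd z))\<^sup>2)"
    by (intro quad_homog_linear[OF quad_homog_norm] bounded_linear_sub bounded_linear_fst bounded_linear_snd)
  obtain C where "C \<ge> 0"
    "\<And>z :: 'a \<times> 'a. \<bar>\<Phi> (fst z) - \<Phi> (snd z)\<bar> \<le> \<epsilon> * (norm z)\<^sup>2 + C * (norm (fst z - snd z))\<^sup>2"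
    using quad_homog_dominated[OF 1 2 _ _ \<open>\<epsilon> > 0\<close>] by auto
  then show ?thesis
    by (intro that[of C]) (auto simp: quad_modulus_def norm_prod_def split: prod.splits)
qed

lemma continuous_if_quad_modulus:
  assumes "\<And>\<epsilon>. \<epsilon> > 0 \<Longrightarrow> \<exists>C\<ge>0. quad_modulus \<epsilon> C \<Phi>"
  shows "continuous_on UNIV \<Phi>"
proof (rule continuous_at_imp_continuous_on, rule ballI)
  fix z :: 'a
  have "(\<Phi> \<longlongrightarrow> \<Phi> z) (at z)"
  proof (rule tendstoI)
    fix e :: real assume "e > 0"
    define \<epsilon> where "\<epsilon> = e / (4 * (norm z)\<^sup>2 + 4)"
    have pos: "4 * (norm z)\<^sup>2 + 4 > 0" by (smt (verit) zero_le_power2)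
    then have "\<epsilon> > 0" using \<open>e > 0\<close> by (simp add: \<epsilon>_def)
    then obtain C where C: "quad_modulus \<epsilon> C \<Phi>" using assms by blast
    have "((\<lambda>w. \<epsilon> * ((norm w)\<^sup>2 + (norm z)\<^sup>2) + C * (norm (w - z))\<^sup>2) \<longlongrightarrow>
        \<epsilon> * ((norm z)\<^sup>2 + (norm z)\<^sup>2) + C * (norm (z - z))\<^sup>2) (at z)"
      by (intro tendsto_intros)
    moreover have "\<epsilon> * ((norm z)\<^sup>2 + (norm z)\<^sup>2) + C * (norm (z - z))\<^sup>2 < e"
      using \<open>e > 0\<close> pos by (simp add: \<epsilon>_def field_simps) (smt (verit) zero_le_power2 mult_nonneg_nonneg)
    ultimately have "\<forall>\<^sub>F w in at z. \<epsilon> * ((norm w)\<^sup>2 + (norm z)\<^sup>2) + C * (norm (w - z))\<^sup>2 < e"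
      by (rule order_tendstoD)
    then show "\<forall>\<^sub>F w in at z. dist (\<Phi> w) (\<Phi> z) < e"
      by eventually_elim (use C in \<open>auto simp: quad_modulus_def dist_real_def intro: le_less_trans\<close>)
  qed
  then show "isCont \<Phi> z" by (simp add: isCont_def)
qed

lemma quad_homog_lift:
  assumes f: "continuous_on UNIV f"
  shows "quad_homog (lift f)"
proof -
  obtain M where M: "M > 0" "\<And>p. \<bar>f p\<bar> \<le> M" using cproj_bounded[OF f] by blast
  have "isCont (lift f) x" for x
  proof (cases "x = 0")
    case False
    have "continuous_on (- {0}) (lift f)"
      unfolding lift_def
      by (intro continuous_intros continuous_on_compose2[OF f continuous_abs_cproj]) auto
    then show ?thesis using False by (simp add: continuous_on_eq_continuous_at open_Compl)
  next
    case True
    have "(lift f \<longlongrightarrow> 0) (at 0)"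
    proof (rule Lim_null_comparison)
      show "\<forall>\<^sub>F x in at 0. norm (lift f x) \<le> (norm x)\<^sup>2 * M"
        by (intro always_eventually allI) (simp add: lift_def abs_mult mult_left_mono M(2))
      have "((\<lambda>x :: complex ^ 'a. (norm x)\<^sup>2 * M) \<longlongrightarrow> (norm (0 :: complex ^ 'a))\<^sup>2 * M) (at 0)"
        by (intro tendsto_intros)
      then show "((\<lambda>x :: complex ^ 'a. (norm x)\<^sup>2 * M) \<longlongrightarrow> 0) (at 0)" by simp
    qed
    then show ?thesis using True by (simp add: isCont_def)
  qed
  then show ?thesis
    by (auto simp: quad_homog_def lift_scaleR continuous_at_imp_continuous_on)
qed

section \<open>Measurability of the action\<close>

lemma rank_one_mult: "rank_one (v *v x) = v ** rank_one x ** cadjoint v"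
proof -
  have "(\<Sum>k\<in>UNIV. v $ i $ k * (x $ k * cnj (x $ l))) = (\<Sum>k\<in>UNIV. v $ i $ k * x $ k) * cnj (x $ l)" for i l
    by (simp add: sum_distrib_right mult.assoc)
  then show ?thesis
    unfolding vec_eq_iff
    by (simp add: rank_one_def cadjoint_def matrix_matrix_mult_def matrix_vector_mult_def
        sum_distrib_left mult_ac)
qed

lemma norm_mult_urep: "(norm (v *v urep p))\<^sup>2 = norm (v ** line_proj p ** cadjoint v)"
  by (simp add: norm_rank_one line_proj_def flip: rank_one_mult)

text \<open>The norm of a rank-one matrix \<open>x x\<^sup>*\<close> is \<open>(norm x)\<^sup>2\<close>, so conjugation by \<open>v\<close> followed by
  normalisation describes the action without a choice of representatives.\<close>

lemma line_proj_act:
  "line_proj (act v p) = (let Q = v ** line_proj p ** cadjoint v in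
     if Q = 0 then line_proj (abs_cproj 0) else Q /\<^sub>R norm Q)"
proof -
  have "v ** line_proj p ** cadjoint v = 0 \<longleftrightarrow> v *v urep p = 0"
    using norm_mult_urep[of v p] by (metis norm_eq_zero power2_eq_square mult_eq_0_iff)
  then show ?thesis
    by (auto simp: Let_def act_def line_proj_abs_cproj norm_mult_urep rank_one_mult line_proj_def[of p])
qed

lemma measurable_line_proj: "line_proj \<in> borel \<rightarrow>\<^sub>M borel"
  by (rule borel_measurable_continuous_onI[OF continuous_line_proj])

text \<open>The embedding is injective and maps compact sets to compact sets, so every open set of lines is
  the preimage of the complement of a compact set of matrices.\<close>

lemma measurable_cprojI:
  fixes f :: "'a \<Rightarrow> 'd :: finite cproj"
  assumes "(\<lambda>x. line_proj (f x)) \<in> M \<rightarrow>\<^sub>M borel"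
  shows "f \<in> M \<rightarrow>\<^sub>M borel"
proof (rule borel_measurableI)
  fix U :: "'d cproj set" assume "open U"
  have "compact (line_proj ` (- U))"
    using \<open>open U\<close> compact_Int_closed[OF compact_cproj, of "- U"]
    by (intro compact_continuous_image continuous_on_subset[OF continuous_line_proj]) auto
  then have *: "line_proj ` (- U) \<in> sets borel"
    by (simp add: borel_compact)
  have inj: "line_proj p = line_proj q \<Longrightarrow> p = q" for p q :: "'d cproj"
    using dist_line_proj[of p q] by simp
  have "f -` U \<inter> space M = space M - ((\<lambda>x. line_proj (f x)) -` (line_proj ` (- U)) \<inter> space M)"
    by (auto dest: inj)
  with measurable_sets[OF assms *] show "f -` U \<inter> space M \<in> sets M" by auto
qed

lemma measurable_conj:
  fixes f h :: "'a \<Rightarrow> complex ^ 'd :: finite ^ 'd"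
  assumes [measurable]: "f \<in> M \<rightarrow>\<^sub>M borel" "h \<in> M \<rightarrow>\<^sub>M borel"
  shows "(\<lambda>x. f x ** h x ** cadjoint (f x)) \<in> M \<rightarrow>\<^sub>M borel"
proof (rule borel_measurable_continuous_Pair[OF assms])
  show "continuous_on UNIV (\<lambda>z :: (complex ^ 'd ^ 'd) \<times> (complex ^ 'd ^ 'd). fst z ** snd z ** cadjoint (fst z))"
    unfolding matrix_matrix_mult_def cadjoint_def
    by (intro continuous_intros)
qed

lemma measurable_act:
  assumes [measurable]: "f \<in> M \<rightarrow>\<^sub>M borel" "h \<in> M \<rightarrow>\<^sub>M borel"
  shows "(\<lambda>x. act (f x) (h x)) \<in> M \<rightarrow>\<^sub>M borel"
proof (rule measurable_cprojI)
  have [measurable]: "(\<lambda>x. f x ** line_proj (h x) ** cadjoint (f x)) \<in> M \<rightarrow>\<^sub>M borel"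
    by (intro measurable_conj assms measurable_compose[OF assms(2) measurable_line_proj])
  show "(\<lambda>x. line_proj (act (f x) (h x))) \<in> M \<rightarrow>\<^sub>M borel"
    unfolding line_proj_act Let_def by measurable
qed

section \<open>The transfer operator on homogeneous functions\<close>

lemma cinner_add_right: "cinner x (y + z) = cinner x y + cinner x z"
  by (simp add: cinner_def distrib_left sum.distrib)

lemma cinner_cscale_right: "cinner x (c *s y) = c * cinner x y"
  by (simp add: cinner_def sum_distrib_left mult_ac)

lemma cinner_scaleR_right: "cinner x (r *\<^sub>R y) = r *\<^sub>R cinner x y"
  by (simp add: cinner_def scaleR_sum_right)

lemma cinner_cadjoint: "cinner x (cadjoint A *v y) = cinner (A *v x) y"
proof -
  have "cinner x (cadjoint A *v y) = (\<Sum>i\<in>UNIV. \<Sum>j\<in>UNIV. cnj (x $ i) * (cnj (A $ j $ i) * y $ j))"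
    by (simp add: cinner_def cadjoint_def matrix_vector_mult_def sum_distrib_left)
  also have "\<dots> = (\<Sum>j\<in>UNIV. \<Sum>i\<in>UNIV. cnj (x $ i) * (cnj (A $ j $ i) * y $ j))"
    by (rule sum.swap)
  also have "\<dots> = cinner (A *v x) y"
    by (simp add: cinner_def matrix_vector_mult_def sum_distrib_left sum_distrib_right mult_ac)
  finally show ?thesis .
qed

lemma mult_vec_scaleR: "v *v (r *\<^sub>R x) = r *\<^sub>R (v *v x)" for v :: "complex ^ 'n ^ 'm"
  using vector_scalar_commute[of v "complex_of_real r" x] by (simp add: cscale_real)

lemma scaleR_mult_vec: "(r *\<^sub>R v) *v x = r *\<^sub>R (v *v x)" for v :: "complex ^ 'n ^ 'm"
  by (simp add: vec_eq_iff matrix_vector_mult_def scaleR_sum_right)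

lemma continuous_mult_vec: "continuous_on S (\<lambda>v. v *v x)"
  for x :: "complex ^ 'n :: finite"
  unfolding matrix_vector_mult_def by (intro continuous_intros)

text \<open>Pairs of vectors are needed to speak of areas and of the parallelogram law; functions of one
  vector are functions of a pair that ignore the second component.\<close>

definition pair_apply :: "complex ^ 'd ^ 'd \<Rightarrow> (complex ^ 'd) \<times> (complex ^ 'd) \<Rightarrow> (complex ^ 'd) \<times> (complex ^ 'd :: finite)" where
  "pair_apply v z = (v *v fst z, v *v snd z)"

lemma norm_pair_apply: "(norm (pair_apply v z))\<^sup>2 = (norm (v *v fst z))\<^sup>2 + (norm (v *v snd z))\<^sup>2"
  by (simp add: pair_apply_def norm_prod_def)

lemma norm_pair: "(norm z)\<^sup>2 = (norm (fst z))\<^sup>2 + (norm (snd z))\<^sup>2"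
  by (simp add: norm_prod_def split: prod.split)

lemma pair_apply_diff: "pair_apply v (z - w) = pair_apply v z - pair_apply v w"
  by (simp add: pair_apply_def matrix_vector_mult_diff_distrib)

lemma pair_apply_scaleR: "pair_apply v (r *\<^sub>R z) = r *\<^sub>R pair_apply v z"
  by (simp add: pair_apply_def mult_vec_scaleR)

lemma pair_apply_mult: "pair_apply (v ** w) z = pair_apply v (pair_apply w z)"
  by (simp add: pair_apply_def matrix_vector_mul_assoc)

lemma continuous_pair_apply: "continuous_on S (\<lambda>v. pair_apply v z)"
  unfolding pair_apply_def by (intro continuous_intros continuous_mult_vec)

locale stochastic_matrices =
  fixes \<mu> :: "(complex ^ 'd :: finite ^ 'd) measure"
  assumes sets_mu: "sets \<mu> = sets borel"
    and stochastic: "(\<integral> v. cadjoint v ** v \<partial>\<mu>) = mat 1"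
begin

lemma borel_measurable_mu: "f \<in> borel_measurable borel \<Longrightarrow> f \<in> borel_measurable \<mu>"
  using measurable_cong_sets[OF sets_mu refl] by blast

lemma measurable_mu_cont: "continuous_on UNIV f \<Longrightarrow> f \<in> borel_measurable \<mu>"
  by (intro borel_measurable_mu borel_measurable_continuous_onI)

lemma has_integral_norm:
  "integrable \<mu> (\<lambda>v. (norm (v *v x))\<^sup>2)" (is ?I)
  "(\<integral> v. (norm (v *v x))\<^sup>2 \<partial>\<mu>) = (norm x)\<^sup>2" (is ?E)
proof -
  define L where "L A = Re (cinner x (A *v x))" for A :: "complex ^ 'd ^ 'd"
  have "linear L"
    by (rule linearI)
      (simp_all add: L_def matrix_vector_mult_add_rdistrib cinner_add_right cinner_scaleR_right
        scaleR_mult_vec)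
  then have L: "bounded_linear L" by (rule linear_conv_bounded_linear[THEN iffD1])
  \<comment> \<open>A Bochner integral that is not defined is \<open>0\<close>, which differs from the identity matrix.\<close>
  have int: "integrable \<mu> (\<lambda>v. cadjoint v ** v)"
  proof (rule ccontr)
    assume "\<not> ?thesis"
    then have "(mat 1 :: complex ^ 'd ^ 'd) = 0"
      using stochastic by (simp add: not_integrable_integral_eq)
    then show False by (auto simp: vec_eq_iff mat_def split: if_splits)
  qed
  have eq: "L (cadjoint v ** v) = (norm (v *v x))\<^sup>2" for v
    by (simp add: L_def matrix_vector_mul_assoc[symmetric] cinner_cadjoint cinner_self)
  show ?I
    using integrable_bounded_linear[OF L int] by (simp add: eq)
  show ?E
    using integral_bounded_linear[OF L int] stochastic
    by (simp add: eq) (simp add: L_def cinner_self)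
qed

lemma has_integral_norm_pair:
  "integrable \<mu> (\<lambda>v. (norm (pair_apply v z))\<^sup>2)"
  "(\<integral> v. (norm (pair_apply v z))\<^sup>2 \<partial>\<mu>) = (norm z)\<^sup>2"
  using has_integral_norm[of "fst z"] has_integral_norm[of "snd z"]
  by (simp_all add: norm_pair_apply norm_pair[of z])

definition transfer :: "((complex ^ 'd) \<times> (complex ^ 'd) \<Rightarrow> real) \<Rightarrow> (complex ^ 'd) \<times> (complex ^ 'd) \<Rightarrow> real" where
  "transfer \<Phi> z = (\<integral> v. \<Phi> (pair_apply v z) \<partial>\<mu>)"

lemma integrable_transfer:
  assumes "quad_homog \<Phi>"
  shows "integrable \<mu> (\<lambda>v. \<Phi> (pair_apply v z))"
proof -
  obtain M where M: "M \<ge> 0" "\<And>z. \<bar>\<Phi> z\<bar> \<le> M * (norm z)\<^sup>2" using quad_homog_bounded[OF assms] by blast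
  show ?thesis
  proof (rule Bochner_Integration.integrable_bound)
    show "integrable \<mu> (\<lambda>v. M * (norm (pair_apply v z))\<^sup>2)"
      using has_integral_norm_pair(1) by simp
    show "(\<lambda>v. \<Phi> (pair_apply v z)) \<in> borel_measurable \<mu>"
      by (intro measurable_mu_cont continuous_on_compose2[OF quad_homog_cont[OF assms] continuous_pair_apply]) auto
  qed (use M in \<open>auto intro: order_trans[OF M(2)]\<close>)
qed

lemma transfer_norm: "transfer (\<lambda>z. (norm z)\<^sup>2) z = (norm z)\<^sup>2"
  by (simp add: transfer_def has_integral_norm_pair)

lemma transfer_mono:
  assumes "quad_homog \<Phi>" "quad_homog \<Psi>" "\<And>z. \<Phi> z \<le> \<Psi> z"
  shows "transfer \<Phi> z \<le> transfer \<Psi> z"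
  unfolding transfer_def by (intro integral_mono integrable_transfer assms)

lemma transfer_cmult: "transfer (\<lambda>z. c * \<Phi> z) z = c * transfer \<Phi> z"
  by (simp add: transfer_def)

lemma transfer_diff:
  assumes "quad_homog \<Phi>" "quad_homog \<Psi>"
  shows "transfer (\<lambda>z. \<Phi> z - \<Psi> z) z = transfer \<Phi> z - transfer \<Psi> z"
  unfolding transfer_def by (intro Bochner_Integration.integral_diff integrable_transfer assms)

text \<open>The function \<open>z \<mapsto> (norm z)\<^sup>2\<close> is fixed by the operator, and \<open>z - w\<close> is mapped to the difference of
  the images. This is why the iterates share one modulus, without any contraction.\<close>

lemma transfer_modulus:
  assumes \<Phi>: "quad_homog \<Phi>" and mod: "quad_modulus \<epsilon> C \<Phi>"
  shows "quad_modulus \<epsilon> C (transfer \<Phi>)"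
  unfolding quad_modulus_def
proof (intro allI)
  fix z w
  have "\<bar>transfer \<Phi> z - transfer \<Phi> w\<bar> = \<bar>\<integral> v. \<Phi> (pair_apply v z) - \<Phi> (pair_apply v w) \<partial>\<mu>\<bar>"
    unfolding transfer_def by (simp add: integrable_transfer[OF \<Phi>])
  also have "\<dots> \<le> (\<integral> v. \<bar>\<Phi> (pair_apply v z) - \<Phi> (pair_apply v w)\<bar> \<partial>\<mu>)"
    by (rule integral_abs_bound)
  also have "\<dots> \<le> (\<integral> v. \<epsilon> * ((norm (pair_apply v z))\<^sup>2 + (norm (pair_apply v w))\<^sup>2)
      + C * (norm (pair_apply v (z - w)))\<^sup>2 \<partial>\<mu>)"
    using mod
    by (intro integral_mono Bochner_Integration.integrable_add integrable_mult_right integrable_abs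
        Bochner_Integration.integrable_diff integrable_transfer[OF \<Phi>] has_integral_norm_pair)
      (simp add: quad_modulus_def pair_apply_diff del: split_paired_All)
  also have "\<dots> = \<epsilon> * ((norm z)\<^sup>2 + (norm w)\<^sup>2) + C * (norm (z - w))\<^sup>2"
    by (simp add: has_integral_norm_pair)
  finally show "\<bar>transfer \<Phi> z - transfer \<Phi> w\<bar> \<le> \<epsilon> * ((norm z)\<^sup>2 + (norm w)\<^sup>2) + C * (norm (z - w))\<^sup>2" .
qed

lemma quad_homog_transfer:
  assumes "quad_homog \<Phi>"
  shows "quad_homog (transfer \<Phi>)"
  unfolding quad_homog_def
proof (intro conjI allI)
  show "continuous_on UNIV (transfer \<Phi>)"
  proof (rule continuous_if_quad_modulus)
    fix \<epsilon> :: real assume "\<epsilon> > 0"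
    then show "\<exists>C\<ge>0. quad_modulus \<epsilon> C (transfer \<Phi>)"
      by (rule quad_homog_modulus[OF assms]) (auto intro: transfer_modulus[OF assms])
  qed
qed (simp add: transfer_def pair_apply_scaleR quad_homog_scaleR[OF assms])

lemma quad_homog_transfer_pow: "quad_homog \<Phi> \<Longrightarrow> quad_homog ((transfer ^^ n) \<Phi>)"
  by (induction n) (auto intro: quad_homog_transfer)

lemma transfer_pow_modulus:
  "quad_homog \<Phi> \<Longrightarrow> quad_modulus \<epsilon> C \<Phi> \<Longrightarrow> quad_modulus \<epsilon> C ((transfer ^^ n) \<Phi>)"
  by (induction n) (auto intro: transfer_modulus quad_homog_transfer_pow)

lemma transfer_pow_mono:
  assumes "quad_homog \<Phi>" "quad_homog \<Psi>" "\<And>z. \<Phi> z \<le> \<Psi> z"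
  shows "(transfer ^^ n) \<Phi> z \<le> (transfer ^^ n) \<Psi> z"
proof (induction n arbitrary: z)
  case (Suc n)
  then show ?case by (auto intro!: transfer_mono quad_homog_transfer_pow assms simp del: split_paired_All)
qed (simp add: assms del: split_paired_All)

lemma transfer_pow_cmult: "(transfer ^^ n) (\<lambda>z. c * \<Phi> z) z = c * (transfer ^^ n) \<Phi> z"
proof -
  have "(transfer ^^ n) (\<lambda>z. c * \<Phi> z) = (\<lambda>z. c * (transfer ^^ n) \<Phi> z)"
  proof (induction n)
    case (Suc n)
    show ?case by (simp add: Suc transfer_cmult)
  qed simp
  then show ?thesis by simp
qed

section \<open>The Markov operator on continuous functions\<close>

lemma kernel_op_lift: "kernel_op \<mu> f p = (\<integral> v. lift f (v *v urep p) \<partial>\<mu>)"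
  by (simp add: kernel_op_def lift_def act_def mult.commute)

text \<open>The lift intertwines the Markov operator with the transfer operator.\<close>

lemma lift_kernel_op: "lift (kernel_op \<mu> f) x = (\<integral> v. lift f (v *v x) \<partial>\<mu>)"
proof (cases "x = 0")
  case False
  obtain c where c: "cmod c = norm x" "x = c *s urep (abs_cproj x)" using urep_abs_cproj[OF False] .
  have "lift f (v *v x) = (norm x)\<^sup>2 * lift f (v *v urep (abs_cproj x))" for v
    by (subst (1) c(2)) (simp only: vector_scalar_commute lift_cscale c(1))
  then show ?thesis by (simp add: lift_def[of "kernel_op \<mu> f"] kernel_op_lift)
qed simp

lemma quad_homog_lift_fst: "continuous_on UNIV f \<Longrightarrow> quad_homog (\<lambda>z. lift f (fst z))"
  by (rule quad_homog_linear[OF quad_homog_lift bounded_linear_fst])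

lemma transfer_lift: "transfer (\<lambda>z. lift f (fst z)) = (\<lambda>z. lift (kernel_op \<mu> f) (fst z))"
  by (simp add: fun_eq_iff transfer_def lift_kernel_op pair_apply_def)

lemma transfer_pow_lift:
  "(transfer ^^ n) (\<lambda>z. lift f (fst z)) = (\<lambda>z. lift ((kernel_op \<mu> ^^ n) f) (fst z))"
  by (induction n) (auto simp: transfer_lift)

lemma integrable_kernel_op:
  assumes "continuous_on UNIV f"
  shows "integrable \<mu> (\<lambda>v. lift f (v *v x))"
  using integrable_transfer[OF quad_homog_lift_fst[OF assms], of "(x, 0)"] by (simp add: pair_apply_def)

text \<open>The Feller property: by the invariance of the modulus the image of a continuous lift is
  continuous.\<close>

lemma continuous_kernel_op:
  assumes "continuous_on UNIV f"
  shows "continuous_on UNIV (kernel_op \<mu> f)"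
proof (rule continuous_on_cprojI)
  have "continuous_on UNIV (transfer (\<lambda>z. lift f (fst z)))"
    by (intro quad_homog_cont quad_homog_transfer quad_homog_lift_fst assms)
  then have "continuous_on (sphere 0 1) (\<lambda>x. transfer (\<lambda>z. lift f (fst z)) (x, 0 :: complex ^ 'd))"
    by (rule continuous_on_compose2) (auto intro!: continuous_intros)
  then have "continuous_on (sphere 0 1) (lift (kernel_op \<mu> f))"
    by (simp add: transfer_lift)
  then show "continuous_on (sphere 0 1) (\<lambda>x. kernel_op \<mu> f (abs_cproj x))"
    by (rule continuous_on_eq) (simp add: lift_unit)
qed

lemma continuous_kernel_op_pow:
  "continuous_on UNIV f \<Longrightarrow> continuous_on UNIV ((kernel_op \<mu> ^^ n) f)"
  by (induction n) (auto intro: continuous_kernel_op)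

lemma kernel_op_const: "kernel_op \<mu> (\<lambda>_. c) p = c"
  using has_integral_norm(2)[of "urep p"] by (simp add: kernel_op_def)

lemma kernel_op_add:
  assumes "continuous_on UNIV f" "continuous_on UNIV h"
  shows "kernel_op \<mu> (\<lambda>q. f q + h q) p = kernel_op \<mu> f p + kernel_op \<mu> h p"
proof -
  have "lift (\<lambda>q. f q + h q) x = lift f x + lift h x" for x by (simp add: lift_def algebra_simps)
  then show ?thesis by (simp add: kernel_op_lift integrable_kernel_op assms)
qed

lemma kernel_op_cmult: "kernel_op \<mu> (\<lambda>q. c * f q) p = c * kernel_op \<mu> f p"
  by (simp add: kernel_op_def mult.assoc)

lemma kernel_op_diff:
  assumes "continuous_on UNIV f" "continuous_on UNIV h"
  shows "kernel_op \<mu> (\<lambda>q. f q - h q) p = kernel_op \<mu> f p - kernel_op \<mu> h p"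
  using kernel_op_add[OF assms(1), of "\<lambda>q. - 1 * h q"] assms kernel_op_cmult[of "- 1" h p]
  by (simp add: continuous_intros)

lemma kernel_op_sum:
  assumes "\<And>i. i \<in> I \<Longrightarrow> continuous_on UNIV (f i)"
  shows "kernel_op \<mu> (\<lambda>q. \<Sum>i\<in>I. f i q) p = (\<Sum>i\<in>I. kernel_op \<mu> (f i) p)"
  using assms
proof (induction I rule: infinite_finite_induct)
  case (insert i I)
  then have "kernel_op \<mu> (\<lambda>q. f i q + (\<Sum>i\<in>I. f i q)) p = kernel_op \<mu> (f i) p + kernel_op \<mu> (\<lambda>q. \<Sum>i\<in>I. f i q) p"
    by (intro kernel_op_add continuous_intros) auto
  with insert show ?case by simp
qed (simp_all add: kernel_op_const)

lemma kernel_op_mono: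
  assumes "continuous_on UNIV f" "continuous_on UNIV h" "\<And>q. f q \<le> h q"
  shows "kernel_op \<mu> f p \<le> kernel_op \<mu> h p"
  unfolding kernel_op_lift
  by (intro integral_mono integrable_kernel_op assms) (simp add: lift_def mult_left_mono assms)

lemma kernel_op_bound:
  assumes "continuous_on UNIV f" "\<And>q. \<bar>f q\<bar> \<le> M"
  shows "\<bar>kernel_op \<mu> f p\<bar> \<le> M"
proof -
  have "- M \<le> f q" "f q \<le> M" for q using assms(2)[of q] by auto
  then show ?thesis
    using kernel_op_mono[of f "\<lambda>_. M" p] kernel_op_mono[of "\<lambda>_. - M" f p] assms(1)
    by (auto simp: kernel_op_const abs_le_iff)
qed

lemma kernel_op_pow_bound:
  assumes "continuous_on UNIV f" "\<And>q. \<bar>f q\<bar> \<le> M"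
  shows "\<bar>(kernel_op \<mu> ^^ n) f p\<bar> \<le> M"
  using assms by (induction n arbitrary: p) (auto intro: kernel_op_bound continuous_kernel_op_pow)

end

section \<open>Powers of a measure with an infinite atom at zero\<close>

lemma W_cong: "(\<And>i. i < n \<Longrightarrow> \<omega> i = \<omega>' i) \<Longrightarrow> W n \<omega> = W n \<omega>'"
  by (induction n) auto

lemma W_fun_upd: "W (Suc n) (fun_upd \<omega> n v) = v ** W n \<omega>"
  using W_cong[of n "fun_upd \<omega> n v" \<omega>] by simp

lemma zero_matrix_mult [simp]: "0 ** A = 0" "A ** 0 = 0" for A :: "complex ^ 'd :: finite ^ 'd"
  by (simp_all add: vec_eq_iff matrix_matrix_mult_def)

lemma zero_mult_vec [simp]: "0 *v x = 0" for x :: "complex ^ 'd :: finite"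
  by (simp add: vec_eq_iff matrix_vector_mult_def)

lemma W_eq_zero:
  fixes \<omega> :: "nat \<Rightarrow> complex ^ 'd :: finite ^ 'd"
  shows "i < n \<Longrightarrow> \<omega> i = 0 \<Longrightarrow> W n \<omega> = 0"
  by (induction n) (auto simp: less_Suc_eq)

lemma measurable_mult_matrix:
  fixes f h :: "'a \<Rightarrow> complex ^ 'd :: finite ^ 'd"
  assumes "f \<in> M \<rightarrow>\<^sub>M borel" "h \<in> M \<rightarrow>\<^sub>M borel"
  shows "(\<lambda>x. f x ** h x) \<in> M \<rightarrow>\<^sub>M borel"
proof (rule borel_measurable_continuous_Pair[OF assms])
  show "continuous_on UNIV (\<lambda>z :: (complex ^ 'd ^ 'd) \<times> (complex ^ 'd ^ 'd). fst z ** snd z)"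
    unfolding matrix_matrix_mult_def by (intro continuous_intros)
qed

lemma measurable_W:
  fixes M :: "(complex ^ 'd :: finite ^ 'd) measure"
  assumes "sets M = sets borel" "{..<n} \<subseteq> I"
  shows "W n \<in> PiM I (\<lambda>_. M) \<rightarrow>\<^sub>M borel"
  using assms(2)
proof (induction n)
  case 0
  have "W 0 = (\<lambda>_ :: nat \<Rightarrow> complex ^ 'd ^ 'd. mat 1)" by (simp add: fun_eq_iff)
  then show ?case by simp
next
  case (Suc n)
  have "(\<lambda>\<omega>. \<omega> n) \<in> PiM I (\<lambda>_. M) \<rightarrow>\<^sub>M M"
    using Suc.prems by (intro measurable_component_singleton) auto
  then have "(\<lambda>\<omega>. \<omega> n) \<in> PiM I (\<lambda>_. M) \<rightarrow>\<^sub>M borel"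
    using measurable_cong_sets[OF refl assms(1)] by blast
  then have "(\<lambda>\<omega>. \<omega> n ** W n \<omega>) \<in> PiM I (\<lambda>_. M) \<rightarrow>\<^sub>M borel"
    using Suc by (intro measurable_mult_matrix) (auto simp: subset_eq)
  then show ?case by (simp add: fun_eq_iff cong: measurable_cong)
qed

context stochastic_matrices
begin

declare sets_mu [measurable_cong]

definition nonzero_part :: "(complex ^ 'd ^ 'd) measure" where
  "nonzero_part = density \<mu> (indicator (- {0}))"

lemma sets_nonzero_part [measurable_cong, simp]: "sets nonzero_part = sets borel"
  by (simp add: nonzero_part_def sets_mu)

lemma space_mu [simp]: "space \<mu> = UNIV"
  using sets_eq_imp_space_eq[OF sets_mu] by simp

lemma emeasure_nonzero_part:
  assumes [measurable]: "A \<in> sets borel"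
  shows "emeasure nonzero_part A = emeasure \<mu> (A - {0})"
proof -
  have [measurable]: "A \<in> sets \<mu>" by (simp add: sets_mu)
  have "emeasure nonzero_part A = (\<integral>\<^sup>+ v. indicator (- {0}) v * indicator A v \<partial>\<mu>)"
    unfolding nonzero_part_def by (rule emeasure_density) auto
  also have "\<dots> = (\<integral>\<^sup>+ v. indicator (A - {0}) v \<partial>\<mu>)"
    by (intro nn_integral_cong) (auto simp: indicator_def)
  also have "\<dots> = emeasure \<mu> (A - {0})"
    by (rule nn_integral_indicator) auto
  finally show ?thesis .
qed

lemma nn_integral_nonzero_part:
  assumes "f \<in> borel_measurable borel" "f 0 = 0"
  shows "(\<integral>\<^sup>+ v. f v \<partial>nonzero_part) = (\<integral>\<^sup>+ v. f v \<partial>\<mu>)"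
proof -
  have "(\<integral>\<^sup>+ v. f v \<partial>nonzero_part) = (\<integral>\<^sup>+ v. indicator (- {0}) v * f v \<partial>\<mu>)"
    unfolding nonzero_part_def
    by (rule nn_integral_density) (auto intro!: borel_measurable_mu assms)
  also have "\<dots> = (\<integral>\<^sup>+ v. f v \<partial>\<mu>)"
    by (intro nn_integral_cong) (auto simp: indicator_def assms)
  finally show ?thesis .
qed

text \<open>The squared norm has a finite integral and vanishes only at the zero matrix, hence the
  measure off zero is the density of a finite measure.\<close>

lemma sigma_finite_nonzero_part: "sigma_finite_measure nonzero_part"
proof -
  define s where "s v = (\<Sum>i\<in>UNIV. (norm (v *v axis i 1))\<^sup>2)" for v :: "complex ^ 'd ^ 'd"
  have [measurable]: "s \<in> borel_measurable borel"
    unfolding s_def by (intro borel_measurable_continuous_onI continuous_intros continuous_mult_vec)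
  have s_zero: "s v = 0 \<longleftrightarrow> v = 0" for v
  proof
    assume "s v = 0"
    then have "v *v axis i 1 = 0" for i
      by (simp add: s_def sum_nonneg_eq_0_iff)
    moreover have "(v *v axis i 1) $ j = v $ j $ i" for i j
      by (simp add: matrix_vector_mult_def axis_def if_distrib cong: if_cong)
    ultimately have "v $ j $ i = 0" for i j
      by (metis zero_index)
    then show "v = 0" by (simp add: vec_eq_iff)
  qed (simp add: s_def)
  have s_nonneg: "s v \<ge> 0" for v by (simp add: s_def sum_nonneg)
  define \<rho> where "\<rho> = density \<mu> (\<lambda>v. ennreal (s v))"
  have meas [measurable]: "s \<in> borel_measurable \<mu>" "(\<lambda>v. ennreal (s v)) \<in> borel_measurable \<mu>"
    by (auto intro!: borel_measurable_mu)
  have "finite_measure \<rho>"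
  proof
    have "emeasure \<rho> (space \<rho>) = (\<integral>\<^sup>+ v. ennreal (s v) * indicator (space \<mu>) v \<partial>\<mu>)"
      unfolding \<rho>_def space_density by (rule emeasure_density) (auto simp del: space_mu)
    also have "\<dots> = (\<integral>\<^sup>+ v. ennreal (s v) \<partial>\<mu>)" by simp
    also have "\<dots> = ennreal (\<integral> v. s v \<partial>\<mu>)"
    proof (rule nn_integral_eq_integral)
      show "integrable \<mu> s"
        unfolding s_def by (intro Bochner_Integration.integrable_sum has_integral_norm)
    qed (simp add: s_nonneg)
    finally show "emeasure \<rho> (space \<rho>) \<noteq> \<infinity>" by simp
  qed
  then interpret \<rho>: finite_measure \<rho> .
  have "density \<rho> (\<lambda>v. 1 / ennreal (s v)) = density \<mu> (\<lambda>v. ennreal (s v) * (1 / ennreal (s v)))"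
    unfolding \<rho>_def by (rule density_density_eq) auto
  also have "\<dots> = nonzero_part"
    unfolding nonzero_part_def
  proof (rule arg_cong[where f = "density \<mu>"], rule ext)
    fix v show "ennreal (s v) * (1 / ennreal (s v)) = indicator (- {0}) v"
    proof (cases "v = 0")
      case False
      then have "s v > 0" using s_zero[of v] s_nonneg[of v] by linarith
      then have "1 / ennreal (s v) = ennreal (1 / s v)"
        by (metis divide_ennreal ennreal_1 zero_le_one)
      then show ?thesis
        using False \<open>s v > 0\<close> by (simp add: ennreal_mult[symmetric])
    qed (simp add: s_def)
  qed
  finally have eq: "density \<rho> (\<lambda>v. 1 / ennreal (s v)) = nonzero_part" .
  have "1 / ennreal (s v) \<noteq> \<infinity>" if "0 < ennreal (s v)" for v
    using that by (simp add: ennreal_divide_eq_top_iff)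
  then have "AE v in \<rho>. 1 / ennreal (s v) \<noteq> \<infinity>"
    unfolding \<rho>_def by (subst AE_density) (auto intro!: AE_I2)
  then have "sigma_finite_measure (density \<rho> (\<lambda>v. 1 / ennreal (s v)))"
    by (subst \<rho>.sigma_finite_iff_density_finite) (auto simp: \<rho>_def)
  then show ?thesis by (simp add: eq)
qed

sublocale nz: product_sigma_finite "\<lambda>_ :: nat. nonzero_part"
  by (simp add: product_sigma_finite_def sigma_finite_nonzero_part)

text \<open>An auxiliary sigma-finite measure that keeps an atom at zero: \<^term>\<open>\<mu>\<close> has a density with
  respect to it that is \<open>1\<close> off zero and possibly infinite at zero.\<close>

definition unit_atom :: "(complex ^ 'd ^ 'd) measure" where
  "unit_atom = measure_of UNIV (sets borel) (\<lambda>A. emeasure nonzero_part A + indicator A 0)"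

lemma sets_unit_atom [measurable_cong, simp]: "sets unit_atom = sets borel"
proof -
  have "sigma_sets (UNIV :: (complex ^ 'd ^ 'd) set) (sets borel) = sets borel"
    using sets.sigma_sets_eq[of "borel :: (complex ^ 'd ^ 'd) measure"] by simp
  then show ?thesis by (simp add: unit_atom_def)
qed

lemma emeasure_unit_atom:
  assumes "A \<in> sets borel"
  shows "emeasure unit_atom A = emeasure nonzero_part A + indicator A 0"
proof (rule emeasure_measure_of[OF unit_atom_def])
  show "positive (sets unit_atom) (\<lambda>A. emeasure nonzero_part A + indicator A 0)"
    by (simp add: positive_def)
  show "countably_additive (sets unit_atom) (\<lambda>A. emeasure nonzero_part A + indicator A 0)"
  proof (rule countably_additiveI)
    fix A :: "nat \<Rightarrow> (complex ^ 'd ^ 'd) set"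
    assume A: "range A \<subseteq> sets unit_atom" "disjoint_family A" "(\<Union>i. A i) \<in> sets unit_atom"
    have "(\<Sum>i. emeasure nonzero_part (A i)) = emeasure nonzero_part (\<Union>i. A i)"
      using A by (intro suminf_emeasure) auto
    moreover have "(\<Sum>i. indicator (A i) 0) = (indicator (\<Union>i. A i) 0 :: ennreal)"
      using A(2) by (rule suminf_indicator)
    ultimately show "(\<Sum>i. emeasure nonzero_part (A i) + indicator (A i) 0) =
        emeasure nonzero_part (\<Union>i. A i) + indicator (\<Union>i. A i) 0"
      by (simp add: suminf_add[symmetric])
  qed
qed (use assms in auto)

lemma sigma_finite_unit_atom: "sigma_finite_measure unit_atom"
proof -
  obtain \<A> where A: "countable \<A>" "\<A> \<subseteq> sets nonzero_part" "\<Union> \<A> = space nonzero_part"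
    "\<And>A. A \<in> \<A> \<Longrightarrow> emeasure nonzero_part A \<noteq> \<infinity>"
    using sigma_finite_measure.sigma_finite_countable[OF sigma_finite_nonzero_part] by blast
  have sp: "space nonzero_part = UNIV" "space unit_atom = UNIV"
    using sets_eq_imp_space_eq[OF sets_nonzero_part] sets_eq_imp_space_eq[OF sets_unit_atom] by auto
  show ?thesis
  proof
    show "\<exists>\<A>. countable \<A> \<and> \<A> \<subseteq> sets unit_atom \<and> \<Union> \<A> = space unit_atom \<and> (\<forall>a\<in>\<A>. emeasure unit_atom a \<noteq> \<infinity>)"
      using A by (intro exI[of _ \<A>]) (auto simp: emeasure_unit_atom sp subset_eq indicator_def)
  qed
qed

definition atom_density :: "complex ^ 'd ^ 'd \<Rightarrow> ennreal" where
  "atom_density v = (if v = 0 then emeasure \<mu> {0} else 1)"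

lemma measurable_atom_density [measurable]: "atom_density \<in> borel_measurable borel"
  unfolding atom_density_def by measurable

lemma nn_integral_atom_density:
  assumes "A \<in> sets borel"
  shows "(\<integral>\<^sup>+ v. atom_density v * indicator A v \<partial>unit_atom) = emeasure \<mu> A"
proof -
  have "(\<integral>\<^sup>+ v. atom_density v * indicator A v \<partial>unit_atom) =
     (\<integral>\<^sup>+ v. emeasure \<mu> {0} * indicator (A \<inter> {0}) v + indicator (A - {0}) v \<partial>unit_atom)"
    by (intro nn_integral_cong) (auto simp: atom_density_def indicator_def)
  also have "\<dots> = emeasure \<mu> {0} * emeasure unit_atom (A \<inter> {0}) + emeasure unit_atom (A - {0})"
    using assms by (subst nn_integral_add) (auto simp: nn_integral_cmult)
  also have "\<dots> = emeasure \<mu> {0} * indicator A 0 + emeasure \<mu> (A - {0})"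
    using assms by (simp add: emeasure_unit_atom emeasure_nonzero_part indicator_def)
  also have "\<dots> = emeasure \<mu> (A \<inter> {0}) + emeasure \<mu> (A - {0})"
    by (simp add: indicator_def)
  also have "\<dots> = emeasure \<mu> ((A \<inter> {0}) \<union> (A - {0}))"
    using assms by (intro plus_emeasure) (auto simp: sets_mu)
  also have "(A \<inter> {0}) \<union> (A - {0}) = A" by auto
  finally show ?thesis .
qed

lemma sets_PiM_mu: "sets (PiM I (\<lambda>_. \<mu>)) = sets (PiM I (\<lambda>_. borel))"
  by (intro sets_PiM_cong) (auto simp: sets_mu)

lemma sets_tensor_power [measurable_cong]: "sets (tensor_power \<mu> n) = sets (PiM {..<n} (\<lambda>_. borel))"
  by (simp add: tensor_power_def sets_PiM_mu)

lemma sets_PiM_nonzero [measurable_cong]: "sets (PiM I (\<lambda>_. nonzero_part)) = sets (PiM I (\<lambda>_. borel))"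
  by (intro sets_PiM_cong) auto

abbreviation nz_power :: "nat \<Rightarrow> (nat \<Rightarrow> complex ^ 'd ^ 'd) measure" where
  "nz_power n \<equiv> PiM {..<n} (\<lambda>_. nonzero_part)"

text \<open>A product of measures is defined as a choice among the measures with the prescribed values on
  rectangles, so it has these values as soon as one such measure exists. Here one is the product of
  the auxiliary measures with the product of the densities.\<close>

lemma emeasure_tensor_power:
  assumes A: "\<And>i. i < n \<Longrightarrow> A i \<in> sets borel"
  shows "emeasure (tensor_power \<mu> n) (\<Pi>\<^sub>E i\<in>{..<n}. A i) = (\<Prod>i<n. emeasure \<mu> (A i))"
proof -
  interpret product_sigma_finite "\<lambda>_ :: nat. unit_atom"
    by (simp add: product_sigma_finite_def sigma_finite_unit_atom)
  have setsU: "sets (PiM {..<n} (\<lambda>_. unit_atom)) = sets (PiM {..<n} (\<lambda>_. borel))"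
    by (intro sets_PiM_cong) auto
  define D where "D = density (PiM {..<n} (\<lambda>_. unit_atom)) (\<lambda>\<omega>. \<Prod>i<n. atom_density (\<omega> i))"
  have rect: "emeasure D (\<Pi>\<^sub>E i\<in>{..<n}. X i) = (\<Prod>i<n. emeasure \<mu> (X i))"
    if X: "\<And>i. i < n \<Longrightarrow> X i \<in> sets borel" for X
  proof -
    have "emeasure D (\<Pi>\<^sub>E i\<in>{..<n}. X i) =
      (\<integral>\<^sup>+ \<omega>. (\<Prod>i<n. atom_density (\<omega> i)) * indicator (\<Pi>\<^sub>E i\<in>{..<n}. X i) \<omega> \<partial>PiM {..<n} (\<lambda>_. unit_atom))"
      unfolding D_def
    proof (rule emeasure_density)
      show "Pi\<^sub>E {..<n} X \<in> sets (PiM {..<n} (\<lambda>_. unit_atom))"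
        using X by (intro sets_PiM_I_finite) auto
    qed measurable
    also have "\<dots> = (\<integral>\<^sup>+ \<omega>. (\<Prod>i<n. atom_density (\<omega> i) * indicator (X i) (\<omega> i)) \<partial>PiM {..<n} (\<lambda>_. unit_atom))"
    proof (rule nn_integral_cong)
      fix \<omega> assume "\<omega> \<in> space (PiM {..<n} (\<lambda>_. unit_atom))"
      then have "indicator (\<Pi>\<^sub>E i\<in>{..<n}. X i) \<omega> = (\<Prod>i<n. indicator (X i) (\<omega> i) :: ennreal)"
        by (auto simp: indicator_def space_PiM PiE_iff)
      then show "(\<Prod>i<n. atom_density (\<omega> i)) * indicator (\<Pi>\<^sub>E i\<in>{..<n}. X i) \<omega> =
          (\<Prod>i<n. atom_density (\<omega> i) * indicator (X i) (\<omega> i))"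
        by (simp add: prod.distrib)
    qed
    also have "\<dots> = (\<Prod>i<n. \<integral>\<^sup>+ v. atom_density v * indicator (X i) v \<partial>unit_atom)"
      using X by (intro product_nn_integral_prod) auto
    also have "\<dots> = (\<Prod>i<n. emeasure \<mu> (X i))"
      by (intro prod.cong refl nn_integral_atom_density X) auto
    finally show ?thesis .
  qed
  have sp: "space D = space (PiM {..<n} (\<lambda>_. \<mu>))"
    using sets_eq_imp_space_eq[OF setsU] sets_eq_imp_space_eq[OF sets_PiM_mu, of "{..<n}"] by (simp add: D_def)
  have setsD: "sets D = sets (PiM {..<n} (\<lambda>_. \<mu>))"
    by (simp add: D_def setsU sets_PiM_mu)
  let ?J = "{..<n} :: nat set"
  have "emeasure (PiM ?J (\<lambda>_. \<mu>)) (prod_emb ?J (\<lambda>_. \<mu>) ?J (\<Pi>\<^sub>E i\<in>?J. A i)) =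
      (\<Prod>j\<in>?J \<union> {i \<in> ?J. emeasure \<mu> (space \<mu>) \<noteq> 1}. if j \<in> ?J then emeasure \<mu> (A j) else emeasure \<mu> (space \<mu>))"
  proof (rule emeasure_extend_measure_Pair[OF PiM_def, where \<mu>' = "emeasure D"])
    fix J X assume J: "(J \<noteq> {} \<or> ?J = {}) \<and> finite J \<and> J \<subseteq> ?J \<and> X \<in> (\<Pi> j\<in>J. sets \<mu>)"
    define Y where "Y i = (if i \<in> J then X i else UNIV)" for i
    have Y: "Y i \<in> sets borel" for i using J by (auto simp: Y_def sets_mu)
    have "prod_emb ?J (\<lambda>_. \<mu>) J (Pi\<^sub>E J X) = (\<Pi>\<^sub>E i\<in>?J. if i \<in> J then X i else space \<mu>)"
      using J by (intro prod_emb_PiE) (auto simp: sets_mu)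
    also have "\<dots> = Pi\<^sub>E ?J Y"
      unfolding space_mu by (rule arg_cong[where f = "Pi\<^sub>E ?J"]) (simp add: Y_def fun_eq_iff)
    finally have "prod_emb ?J (\<lambda>_. \<mu>) J (Pi\<^sub>E J X) = Pi\<^sub>E ?J Y" .
    then have "emeasure D (prod_emb ?J (\<lambda>_. \<mu>) J (Pi\<^sub>E J X)) = (\<Prod>i<n. emeasure \<mu> (Y i))"
      using rect[OF Y] by simp
    also have "\<dots> = (\<Prod>j\<in>J \<union> {i \<in> ?J. emeasure \<mu> (space \<mu>) \<noteq> 1}. if j \<in> J then emeasure \<mu> (X j) else emeasure \<mu> (space \<mu>))"
      using J by (intro prod.mono_neutral_cong_right) (auto simp: Y_def)
    finally show "emeasure D (prod_emb ?J (\<lambda>_. \<mu>) J (Pi\<^sub>E J X)) =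
      (\<Prod>j\<in>J \<union> {i \<in> ?J. emeasure \<mu> (space \<mu>) \<noteq> 1}. if j \<in> J then emeasure \<mu> (X j) else emeasure \<mu> (space \<mu>))" .
  next
    show "positive (sets (PiM ?J (\<lambda>_. \<mu>))) (emeasure D)"
      "countably_additive (sets (PiM ?J (\<lambda>_. \<mu>))) (emeasure D)"
      unfolding setsD[symmetric] by (rule emeasure_positive emeasure_countably_additive)+
  qed (use A in \<open>auto simp: prod_emb_def PiE_iff sets_mu\<close>)
  also have "?J \<union> {i \<in> ?J. emeasure \<mu> (space \<mu>) \<noteq> 1} = ?J" by auto
  also have "prod_emb ?J (\<lambda>_. \<mu>) ?J (\<Pi>\<^sub>E i\<in>?J. A i) = (\<Pi>\<^sub>E i\<in>?J. A i)"
    by (rule prod_emb_id) auto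
  finally show ?thesis by (simp add: tensor_power_def)
qed

text \<open>Off the trajectories with a vanishing factor both measures have the product values on
  rectangles, and there the product of sigma-finite measures is unique. All integrands of interest
  contain a product of the matrices and vanish at the other trajectories.\<close>

lemma nn_integral_tensor_power:
  assumes f: "f \<in> borel_measurable (PiM {..<n} (\<lambda>_. borel))"
    and zero: "\<And>\<omega> i. i < n \<Longrightarrow> \<omega> i = 0 \<Longrightarrow> f \<omega> = 0"
  shows "(\<integral>\<^sup>+ \<omega>. f \<omega> \<partial>tensor_power \<mu> n) = (\<integral>\<^sup>+ \<omega>. f \<omega> \<partial>nz_power n)"
proof -
  let ?B = "\<Pi>\<^sub>E i\<in>{..<n}. - {0 :: complex ^ 'd ^ 'd}"
  have B: "?B \<in> sets (PiM {..<n} (\<lambda>_. borel))" by (intro sets_PiM_I_finite) auto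
  have ind: "(indicator ?B :: _ \<Rightarrow> ennreal) \<in> borel_measurable (tensor_power \<mu> n)"
    using B by (intro borel_measurable_indicator) (simp add: sets_tensor_power)
  have "density (tensor_power \<mu> n) (indicator ?B) = nz_power n"
  proof (rule nz.PiM_eqI)
    fix A :: "nat \<Rightarrow> (complex ^ 'd ^ 'd) set" assume A: "\<And>i. i \<in> {..<n} \<Longrightarrow> A i \<in> sets nonzero_part"
    then have A': "Pi\<^sub>E {..<n} A \<in> sets (PiM {..<n} (\<lambda>_. borel))" by (intro sets_PiM_I_finite) auto
    have "emeasure (density (tensor_power \<mu> n) (indicator ?B)) (Pi\<^sub>E {..<n} A) =
        (\<integral>\<^sup>+ \<omega>. indicator ?B \<omega> * indicator (Pi\<^sub>E {..<n} A) \<omega> \<partial>tensor_power \<mu> n)"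
      using ind A' by (intro emeasure_density) (auto simp: sets_tensor_power)
    also have "\<dots> = (\<integral>\<^sup>+ \<omega>. indicator (\<Pi>\<^sub>E i\<in>{..<n}. A i - {0}) \<omega> \<partial>tensor_power \<mu> n)"
      by (intro nn_integral_cong) (auto simp: indicator_def PiE_iff)
    also have "\<dots> = emeasure (tensor_power \<mu> n) (\<Pi>\<^sub>E i\<in>{..<n}. A i - {0})"
      using A by (intro nn_integral_indicator) (auto simp: sets_tensor_power intro!: sets_PiM_I_finite)
    also have "\<dots> = (\<Prod>i<n. emeasure \<mu> (A i - {0}))"
      using A by (intro emeasure_tensor_power) auto
    also have "\<dots> = (\<Prod>i<n. emeasure nonzero_part (A i))"
      using A by (intro prod.cong refl) (simp add: emeasure_nonzero_part)
    finally show "emeasure (density (tensor_power \<mu> n) (indicator ?B)) (Pi\<^sub>E {..<n} A) =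
      (\<Prod>i<n. emeasure nonzero_part (A i))" .
  qed (auto simp: sets_tensor_power sets_PiM_nonzero)
  then have "(\<integral>\<^sup>+ \<omega>. f \<omega> \<partial>nz_power n) = (\<integral>\<^sup>+ \<omega>. f \<omega> \<partial>density (tensor_power \<mu> n) (indicator ?B))"
    by simp
  also have "\<dots> = (\<integral>\<^sup>+ \<omega>. indicator ?B \<omega> * f \<omega> \<partial>tensor_power \<mu> n)"
    using ind f by (intro nn_integral_density) (auto simp: measurable_cong_sets[OF sets_tensor_power refl])
  also have "\<dots> = (\<integral>\<^sup>+ \<omega>. f \<omega> \<partial>tensor_power \<mu> n)"
  proof (intro nn_integral_cong)
    fix \<omega> assume "\<omega> \<in> space (tensor_power \<mu> n)"
    then have "\<omega> \<in> extensional {..<n}"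
      by (auto simp: tensor_power_def space_PiM PiE_def)
    then show "indicator ?B \<omega> * f \<omega> = f \<omega>"
      using zero by (auto simp: indicator_def PiE_iff)
  qed
  finally show ?thesis by simp
qed

lemma nn_integral_transfer:
  assumes "quad_homog \<Phi>" "\<And>z. \<Phi> z \<ge> 0"
  shows "(\<integral>\<^sup>+ v. ennreal (\<Phi> (pair_apply v z)) \<partial>nonzero_part) = ennreal (transfer \<Phi> z)"
proof -
  have "(\<lambda>v. \<Phi> (pair_apply v z)) \<in> borel_measurable borel"
    by (intro borel_measurable_continuous_onI
        continuous_on_compose2[OF quad_homog_cont[OF assms(1)] continuous_pair_apply]) auto
  moreover have "pair_apply 0 z = 0" by (simp add: pair_apply_def zero_prod_def)
  ultimately have "(\<integral>\<^sup>+ v. ennreal (\<Phi> (pair_apply v z)) \<partial>nonzero_part) = (\<integral>\<^sup>+ v. ennreal (\<Phi> (pair_apply v z)) \<partial>\<mu>)"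
    by (intro nn_integral_nonzero_part) (auto simp: quad_homog_zero[OF assms(1)])
  also have "\<dots> = ennreal (transfer \<Phi> z)"
    unfolding transfer_def
    by (intro nn_integral_eq_integral integrable_transfer assms) (simp add: assms)
  finally show ?thesis .
qed

lemma measurable_W_nonzero: "{..<n} \<subseteq> I \<Longrightarrow> W n \<in> PiM I (\<lambda>_. nonzero_part) \<rightarrow>\<^sub>M borel"
  by (rule measurable_W) auto

text \<open>The iterates of the transfer operator are the averages over products of matrices; the last
  matrix is integrated first.\<close>

lemma nn_integral_transfer_pow:
  assumes "quad_homog \<Phi>" "\<And>z. \<Phi> z \<ge> 0"
  shows "(\<integral>\<^sup>+ \<omega>. ennreal (\<Phi> (pair_apply (W n \<omega>) z)) \<partial>nz_power n) =
    ennreal ((transfer ^^ n) \<Phi> z)"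
  using assms
proof (induction n arbitrary: \<Phi>)
  case 0
  then show ?case by (simp add: PiM_empty nn_integral_count_space_finite pair_apply_def)
next
  case (Suc n)
  have [measurable]: "(\<lambda>v. \<Phi> (pair_apply v z)) \<in> borel_measurable borel"
    by (intro borel_measurable_continuous_onI
        continuous_on_compose2[OF quad_homog_cont[OF Suc.prems(1)] continuous_pair_apply]) auto
  have "(\<integral>\<^sup>+ \<omega>. ennreal (\<Phi> (pair_apply (W (Suc n) \<omega>) z)) \<partial>nz_power (Suc n)) =
    (\<integral>\<^sup>+ \<omega>. (\<integral>\<^sup>+ v. ennreal (\<Phi> (pair_apply (W (Suc n) (fun_upd \<omega> n v)) z)) \<partial>nonzero_part) \<partial>nz_power n)"
    unfolding lessThan_Suc
  proof (rule nz.product_nn_integral_insert)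
    have "W (Suc n) \<in> PiM (insert n {..<n}) (\<lambda>_. nonzero_part) \<rightarrow>\<^sub>M borel"
      by (rule measurable_W_nonzero) auto
    from measurable_compose[OF this, of "\<lambda>v. ennreal (\<Phi> (pair_apply v z))"]
    show "(\<lambda>\<omega>. ennreal (\<Phi> (pair_apply (W (Suc n) \<omega>) z)))
      \<in> borel_measurable (PiM (insert n {..<n}) (\<lambda>_. nonzero_part))"
      by simp
  qed auto
  also have "\<dots> = (\<integral>\<^sup>+ \<omega>. ennreal (transfer \<Phi> (pair_apply (W n \<omega>) z)) \<partial>nz_power n)"
    by (simp only: W_fun_upd pair_apply_mult nn_integral_transfer[OF Suc.prems])
  also have "\<dots> = ennreal ((transfer ^^ n) (transfer \<Phi>) z)"
  proof (rule Suc.IH[OF quad_homog_transfer[OF Suc.prems(1)]])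
    show "0 \<le> transfer \<Phi> z" for z
      unfolding transfer_def by (simp add: Suc.prems)
  qed
  finally show ?case by (simp only: funpow_Suc_right o_def)
qed

end

section \<open>Areas and purification\<close>

text \<open>The area of the parallelogram of two vectors is a norm of their exterior product, here the
  antisymmetric matrix of the two-by-two minors. In this form linearity is evident; the usual
  formula is Lagrange's identity.\<close>

definition wedge :: "complex ^ 'd \<Rightarrow> complex ^ 'd \<Rightarrow> complex ^ 'd ^ 'd" where
  "wedge x y = (\<chi> i j. x $ i * y $ j - x $ j * y $ i)"

definition area :: "(complex ^ 'd) \<times> (complex ^ 'd :: finite) \<Rightarrow> real" where
  "area z = norm (wedge (fst z) (snd z)) / sqrt 2"

lemma area_nonneg: "area z \<ge> 0"
  by (simp add: area_def)

lemma area_square: "(area z)\<^sup>2 = (norm (fst z))\<^sup>2 * (norm (snd z))\<^sup>2 - (cmod (cinner (fst z) (snd z)))\<^sup>2"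
proof -
  obtain x y where z: "z = (x, y)" by (cases z)
  have prod: "(\<Sum>i\<in>UNIV. \<Sum>j\<in>UNIV. (cnj (u $ i) * v $ i) * (cnj (w $ j) * z $ j)) = cinner u v * cinner w z"
    for u v w z :: "complex ^ 'a"
    by (simp add: cinner_def sum_product)
  have "complex_of_real ((norm (wedge x y))\<^sup>2)
      = (\<Sum>i\<in>UNIV. \<Sum>j\<in>UNIV. complex_of_real ((cmod (x $ i * y $ j - x $ j * y $ i))\<^sup>2))"
    by (simp add: norm_vec_def L2_set_def sum_nonneg wedge_def)
  also have "\<dots> = (\<Sum>i\<in>UNIV. \<Sum>j\<in>UNIV.
       (cnj (x $ i) * x $ i) * (cnj (y $ j) * y $ j) - (cnj (y $ i) * x $ i) * (cnj (x $ j) * y $ j)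
     - (cnj (x $ i) * y $ i) * (cnj (y $ j) * x $ j) + (cnj (y $ i) * y $ i) * (cnj (x $ j) * x $ j))"
    by (intro sum.cong refl) (simp only: complex_norm_square, simp add: algebra_simps)
  also have "\<dots> = cinner x x * cinner y y - cinner y x * cinner x y
      - cinner x y * cinner y x + cinner y y * cinner x x"
    by (simp add: sum.distrib sum_subtractf prod)
  also have "\<dots> = complex_of_real (2 * ((norm x)\<^sup>2 * (norm y)\<^sup>2 - (cmod (cinner x y))\<^sup>2))"
    using complex_norm_square[of "cinner x y"]
    by (simp add: cinner_self cinner_commute[of y x] algebra_simps)
  finally have "(norm (wedge x y))\<^sup>2 = 2 * ((norm x)\<^sup>2 * (norm y)\<^sup>2 - (cmod (cinner x y))\<^sup>2)"
    using of_real_eq_iff by blast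
  then show ?thesis by (simp add: area_def z power_divide)
qed

lemma quad_homog_area: "quad_homog area"
  unfolding quad_homog_def
proof (intro conjI allI)
  show "continuous_on UNIV (area :: (complex ^ 'd) \<times> (complex ^ 'd) \<Rightarrow> real)"
    unfolding area_def wedge_def by (intro continuous_intros) auto
  fix r and z :: "(complex ^ 'd) \<times> (complex ^ 'd)"
  have "wedge (r *\<^sub>R x) (r *\<^sub>R y) = r\<^sup>2 *\<^sub>R wedge x y" for x y :: "complex ^ 'd"
    unfolding vec_eq_iff
    by (simp add: wedge_def scaleR_conv_of_real[where 'a = complex] algebra_simps power2_eq_square)
  then show "area (r *\<^sub>R z) = r\<^sup>2 * area z"
    by (simp add: area_def)
qed

text \<open>The transformation rule of an area under triangular changes of basis. Up to a factor, such a
  function is determined by its values on orthonormal pairs.\<close>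

definition area_like :: "((complex ^ 'd) \<times> (complex ^ 'd) \<Rightarrow> real) \<Rightarrow> bool" where
  "area_like \<Phi> \<longleftrightarrow> (\<forall>a b c x y. \<Phi> (a *s x, b *s y + c *s x) = cmod a * cmod b * \<Phi> (x, y))"

lemma area_like_area: "area_like (area :: (complex ^ 'd :: finite) \<times> (complex ^ 'd) \<Rightarrow> real)"
proof -
  have "wedge (a *s x) (b *s y + c *s x) = (\<chi> i. (a * b) *s (wedge x y $ i))" for a b c and x y :: "complex ^ 'd"
    by (simp add: wedge_def vec_eq_iff algebra_simps)
  moreover have "norm (\<chi> i. c *s (A $ i)) = cmod c * norm A" for c and A :: "complex ^ 'd ^ 'd"
    by (simp add: norm_vec_def[of A] norm_vec_def[of "\<chi> i. c *s (A $ i)"] norm_cscale L2_set_right_distrib)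
  ultimately have "norm (wedge (a *s x) (b *s y + c *s x)) = cmod (a * b) * norm (wedge x y)"
    for a b c and x y :: "complex ^ 'd"
    by metis
  then show ?thesis
    unfolding area_like_def area_def by (simp add: norm_mult)
qed

definition orthonormal_pairs :: "((complex ^ 'd) \<times> (complex ^ 'd :: finite)) set" where
  "orthonormal_pairs = {z. norm (fst z) = 1 \<and> norm (snd z) = 1 \<and> cinner (fst z) (snd z) = 0}"

lemma compact_orthonormal_pairs: "compact orthonormal_pairs"
proof -
  have "closed (orthonormal_pairs :: ((complex ^ 'd) \<times> (complex ^ 'd)) set)"
    unfolding orthonormal_pairs_def cinner_def
    by (intro closed_Collect_conj closed_Collect_eq continuous_intros)
  moreover have "orthonormal_pairs \<subseteq> cball 0 1 \<times> cball 0 (1 :: real)"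
    by (auto simp: orthonormal_pairs_def)
  ultimately show ?thesis
    by (metis compact_Int_closed compact_Times compact_cball inf.absorb_iff2)
qed

lemma area_orthonormal: "z \<in> orthonormal_pairs \<Longrightarrow> area z = 1"
  using area_square[of z] area_nonneg[of z] by (simp add: orthonormal_pairs_def power2_eq_1_iff)

lemma area_le_norm: "area z \<le> (norm z)\<^sup>2 / 2"
proof -
  have "(area z)\<^sup>2 \<le> (norm (fst z) * norm (snd z))\<^sup>2"
    by (simp add: area_square power_mult_distrib)
  then have "area z \<le> norm (fst z) * norm (snd z)"
    by (rule power2_le_imp_le) simp
  also have "\<dots> \<le> (norm z)\<^sup>2 / 2"
    using sum_squares_bound[of "norm (fst z)" "norm (snd z)"] norm_pair[of z] by simp
  finally show ?thesis .
qed

text \<open>Equality in \<open>area \<le> norm * norm \<le> (norm\<^sup>2 + norm\<^sup>2) / 2\<close> forces equality in the Cauchy-Schwarz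
  estimate and in the inequality between the means.\<close>

lemma area_eq_norm:
  assumes "area z = (norm z)\<^sup>2 / 2"
  shows "norm (fst z) = norm (snd z)" "cinner (fst z) (snd z) = 0"
proof -
  have "((norm (fst z))\<^sup>2 + (norm (snd z))\<^sup>2)\<^sup>2 / 4 =
      (norm (fst z))\<^sup>2 * (norm (snd z))\<^sup>2 - (cmod (cinner (fst z) (snd z)))\<^sup>2"
    using area_square[of z] assms norm_pair[of z] by (simp add: power_divide)
  then have "((norm (fst z))\<^sup>2 - (norm (snd z))\<^sup>2)\<^sup>2 + 4 * (cmod (cinner (fst z) (snd z)))\<^sup>2 = 0"
    unfolding power2_sum power2_diff by (simp add: field_simps)
  then have "((norm (fst z))\<^sup>2 - (norm (snd z))\<^sup>2)\<^sup>2 = 0 \<and> (cmod (cinner (fst z) (snd z)))\<^sup>2 = 0"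
    by (smt (verit) zero_le_power2)
  then show "norm (fst z) = norm (snd z)" "cinner (fst z) (snd z) = 0"
    by (auto simp: power2_eq_iff_nonneg)
qed

lemma area_eq_zeroD:
  assumes "area (x, y) = 0" "x \<noteq> 0"
  obtains c where "y = c *s x"
proof -
  obtain i where i: "x $ i \<noteq> 0" using assms(2) by (auto simp: vec_eq_iff)
  have "wedge x y = 0" using assms(1) by (simp add: area_def)
  then have "x $ i * y $ j - x $ j * y $ i = 0" for j
    by (auto simp: wedge_def vec_eq_iff)
  then have "y = (y $ i / x $ i) *s x"
    using i by (simp add: vec_eq_iff field_simps)
  then show ?thesis by (rule that)
qed

text \<open>Gram-Schmidt orthogonalisation reduces any independent pair to an orthonormal one.\<close>

lemma area_like_le:
  fixes \<Phi> :: "(complex ^ 'd) \<times> (complex ^ 'd :: finite) \<Rightarrow> real"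
  assumes like: "area_like \<Phi>" and le: "\<And>z. z \<in> orthonormal_pairs \<Longrightarrow> \<Phi> z \<le> \<theta>"
  shows "\<Phi> z \<le> \<theta> * area z"
proof -
  obtain x y where z: "z = (x, y)" by (cases z)
  have tr: "\<Phi> (a *s x, b *s y + c *s x) = cmod a * cmod b * \<Phi> (x, y)" for a b c x y
    using like by (simp add: area_like_def)
  show ?thesis
  proof (cases "area z = 0")
    case True
    have "\<Phi> z = 0"
    proof (cases "x = 0")
      case True
      then show ?thesis using tr[of 0 0 1 y 0] by (simp add: z)
    next
      case False
      then obtain c where "y = c *s x" using area_eq_zeroD True z by blast
      then show ?thesis using tr[of 1 x 0 0 c] by (simp add: z)
    qed
    with True show ?thesis by simp
  next
    case False
    define e where "e = complex_of_real (inverse (norm x)) *s x"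
    define y' where "y' = y - cinner e y *s e"
    define f where "f = complex_of_real (inverse (norm y')) *s y'"
    have ar: "area (a *s x, b *s y + c *s x) = cmod a * cmod b * area (x, y)" for a b c and x y :: "complex ^ 'd"
      using area_like_area unfolding area_like_def by blast
    have "x \<noteq> 0" using False ar[of 0 0 1 y 0] by (auto simp: z)
    then have e: "norm e = 1" "x = complex_of_real (norm x) *s e"
      by (simp_all add: e_def norm_cscale norm_inverse vec_eq_iff)
    have "y' \<noteq> 0"
    proof
      assume "y' = 0"
      then have "(x, y) = (complex_of_real (norm x) *s e, 0 *s 0 + cinner e y *s e)"
        using e by (simp add: y'_def)
      then have "area z = cmod (norm x) * cmod 0 * area (e, 0)"
        using ar[of "norm x" e 0 0 "cinner e y"] by (simp add: z)
      with False show False by simp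
    qed
    then have f: "norm f = 1" "y' = complex_of_real (norm y') *s f"
      by (simp_all add: f_def norm_cscale norm_inverse vec_eq_iff)
    have "cinner e y' = 0"
    proof -
      have "cinner e y' = cinner e y - cinner e (cinner e y *s e)"
        by (simp add: y'_def cinner_def right_diff_distrib sum_subtractf)
      then show ?thesis using e(1) by (simp add: cinner_cscale_right cinner_self)
    qed
    then have "(e, f) \<in> orthonormal_pairs"
      using e f by (simp add: orthonormal_pairs_def f_def cinner_cscale_right)
    then have 1: "\<Phi> (e, f) \<le> \<theta>" "area (e, f) = 1"
      by (auto intro: le area_orthonormal)
    have z': "z = (complex_of_real (norm x) *s e, complex_of_real (norm y') *s f + cinner e y *s e)"
      using e(2) f(2) by (simp add: z y'_def)
    have "\<Phi> z = norm x * norm y' * \<Phi> (e, f)" "area z = norm x * norm y'"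
      using tr[of "norm x" e "norm y'" f "cinner e y"] ar[of "norm x" e "norm y'" f "cinner e y"] 1(2)
      by (simp_all add: z')
    then show ?thesis
      using mult_left_mono[OF 1(1), of "norm x * norm y'"] by (simp add: mult_ac)
  qed
qed

lemma rank_one_mult_vec: "rank_one x *v y = cinner x y *s x"
  by (simp add: rank_one_def cinner_def matrix_vector_mult_def vec_eq_iff sum_distrib_left mult_ac)

text \<open>The sum of two rank-one projectors with orthogonal ranges has rank two: were all its rows
  multiples of one vector, then the conjugates of \<open>e\<close> and \<open>f\<close> would be, too.\<close>

lemma rank_sum_rank_one:
  assumes "(e, f) \<in> orthonormal_pairs"
  shows "rank (rank_one e + rank_one f) \<noteq> 1"
proof
  let ?p = "rank_one e + rank_one f"
  assume "rank ?p = 1"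
  then have "vec.dim (rows ?p) = 1" by (simp add: row_rank_def_gen)
  then obtain B where B: "rows ?p \<subseteq> vec.span B" "card B = 1"
    using vec.basis_exists[of "rows ?p"] by metis
  then obtain b where b: "B = {b}" by (auto simp: card_1_singleton_iff)
  have o: "cinner e e = 1" "cinner f f = 1" "cinner e f = 0" "cinner f e = 0"
    using assms cinner_commute[of f e] by (auto simp: orthonormal_pairs_def cinner_self)
  have "\<exists>k. row i ?p = k *s b" for i
    using B(1) unfolding b vec.span_singleton by (auto simp: rows_def)
  then obtain k where "row i ?p = k i *s b" for i by metis
  then have k: "e $ i * cnj (e $ j) + f $ i * cnj (f $ j) = k i * b $ j" for i j
    by (auto simp: row_def rank_one_def vec_eq_iff)
  have comb: "cinner u e * cnj (e $ j) + cinner u f * cnj (f $ j) = (\<Sum>i\<in>UNIV. cnj (u $ i) * k i) * b $ j" for u j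
    by (simp add: cinner_def sum_distrib_right mult.assoc distrib_left flip: k sum.distrib)
  define \<alpha> \<beta> where "\<alpha> = (\<Sum>i\<in>UNIV. cnj (e $ i) * k i)" and "\<beta> = (\<Sum>i\<in>UNIV. cnj (f $ i) * k i)"
  have "cnj (e $ j) = \<alpha> * b $ j" "cnj (f $ j) = \<beta> * b $ j" for j
    using comb[of e j] comb[of f j] o by (simp_all add: \<alpha>_def \<beta>_def)
  then have ef: "e $ j = cnj \<alpha> * cnj (b $ j)" "f $ j = cnj \<beta> * cnj (b $ j)" for j
    by (metis complex_cnj_cnj complex_cnj_mult)+
  have "cinner e f = \<alpha> * cnj \<beta> * cinner b b"
    by (simp add: cinner_def ef sum_distrib_left mult_ac)
  then have "\<alpha> = 0 \<or> \<beta> = 0 \<or> norm b = 0"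
    using o by (auto simp: cinner_self)
  then have "e = 0 \<or> f = 0"
    using ef by (auto simp: vec_eq_iff)
  then show False using assms by (auto simp: orthonormal_pairs_def)
qed


context stochastic_matrices
begin

text \<open>Trajectories with a vanishing factor are harmless for the properties that occur in purification,
  so these may be checked against the sigma-finite product.\<close>

lemma AE_tensor_power:
  assumes meas: "Measurable.pred (PiM {..<n} (\<lambda>_. borel)) Q"
    and zero: "\<And>\<omega> i. i < n \<Longrightarrow> \<omega> i = 0 \<Longrightarrow> Q \<omega>"
    and AE: "AE \<omega> in nz_power n. Q \<omega>"
  shows "AE \<omega> in tensor_power \<mu> n. Q \<omega>"
proof -
  define f where "f \<omega> = (if Q \<omega> then 0 else 1 :: ennreal)" for \<omega>
  have f [measurable]: "f \<in> borel_measurable (PiM {..<n} (\<lambda>_. borel))"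
  proof -
    have "{\<omega> \<in> space (PiM {..<n} (\<lambda>_. borel)). Q \<omega>} \<in> sets (PiM {..<n} (\<lambda>_. borel))"
      using meas by (simp add: pred_def)
    then show ?thesis unfolding f_def by (intro measurable_If measurable_const) simp_all
  qed
  have "(\<integral>\<^sup>+ \<omega>. f \<omega> \<partial>tensor_power \<mu> n) = (\<integral>\<^sup>+ \<omega>. f \<omega> \<partial>nz_power n)"
    by (rule nn_integral_tensor_power[OF f]) (simp add: f_def zero)
  also have "\<dots> = (\<integral>\<^sup>+ \<omega>. 0 \<partial>nz_power n)"
    using AE by (intro nn_integral_cong_AE) (auto simp: f_def)
  finally have "(\<integral>\<^sup>+ \<omega>. f \<omega> \<partial>tensor_power \<mu> n) = 0" by simp
  moreover have "f \<in> borel_measurable (tensor_power \<mu> n)"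
    using f measurable_cong_sets[OF sets_tensor_power refl] by blast
  ultimately have "AE \<omega> in tensor_power \<mu> n. f \<omega> = 0"
    using nn_integral_0_iff_AE by blast
  then show ?thesis by eventually_elim (auto simp: f_def split: if_splits)
qed

text \<open>If almost all products were conformal on the span of an orthonormal pair, then the orthogonal
  projector onto this plane would satisfy the hypothesis of purification, but its rank is two.\<close>

lemma purifying_no_conformal_pair:
  assumes pur: "purifying \<mu>" and ef: "(e, f) \<in> orthonormal_pairs"
  shows "\<exists>n. \<not> (AE \<omega> in tensor_power \<mu> n. norm (W n \<omega> *v e) = norm (W n \<omega> *v f) \<and> cinner (W n \<omega> *v e) (W n \<omega> *v f) = 0)"
proof (rule ccontr)
  assume "\<not> ?thesis"
  then have conf: "AE \<omega> in tensor_power \<mu> n. norm (W n \<omega> *v e) = norm (W n \<omega> *v f) \<and> cinner (W n \<omega> *v e) (W n \<omega> *v f) = 0" for n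
    by blast
  let ?p = "rank_one e + rank_one f"
  have p: "?p *v y = cinner e y *s e + cinner f y *s f" for y
    by (simp add: matrix_vector_mult_add_rdistrib rank_one_mult_vec)
  have o: "cinner e e = 1" "cinner f f = 1" "cinner e f = 0" "cinner f e = 0"
    using ef cinner_commute[of f e] by (auto simp: orthonormal_pairs_def cinner_self)
  have "?p ** ?p = ?p"
    unfolding matrix_eq by (simp add: matrix_vector_mul_assoc[symmetric] p cinner_add_right cinner_cscale_right o)
  moreover have "cadjoint ?p = ?p"
    by (simp add: cadjoint_def rank_one_def vec_eq_iff mult.commute)
  ultimately have "orth_projector ?p" by (simp add: orth_projector_def)
  moreover have "?p \<noteq> 0"
  proof
    assume "?p = 0"
    then have "?p *v e = 0" by simp
    then show False using ef by (auto simp: p o orthonormal_pairs_def)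
  qed
  moreover have "AE \<omega> in tensor_power \<mu> n. \<exists>c. ?p ** cadjoint (W n \<omega>) ** W n \<omega> ** ?p = mat c ** ?p" for n
    using conf[of n]
  proof eventually_elim
    case (elim \<omega>)
    let ?W = "W n \<omega>"
    define s where "s = complex_of_real ((norm (?W *v e))\<^sup>2)"
    have s: "cinner (?W *v e) (?W *v e) = s" "cinner (?W *v f) (?W *v f) = s"
      "cinner (?W *v e) (?W *v f) = 0" "cinner (?W *v f) (?W *v e) = 0"
      using elim cinner_commute[of "?W *v f" "?W *v e"] by (auto simp: s_def cinner_self)
    have m: "mat c *v y = c *s y" for c and y :: "complex ^ 'd"
      by (simp add: mat_def matrix_vector_mult_def vec_eq_iff if_distrib if_distribR cong: if_cong)
    have "?p ** cadjoint ?W ** ?W ** ?p = mat s ** ?p"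
      unfolding matrix_eq
      by (simp add: matrix_vector_mul_assoc[symmetric] p m cinner_add_right cinner_cscale_right
          matrix_vector_right_distrib vector_scalar_commute cinner_cadjoint s)
    then show ?case by blast
  qed
  ultimately have "rank ?p = 1"
    using pur unfolding purifying_def by blast
  with rank_sum_rank_one[OF ef] show False by simp
qed

lemma quad_homog_conformal_defect: "quad_homog (\<lambda>z :: (complex ^ 'd) \<times> (complex ^ 'd). (norm z)\<^sup>2 / 2 - area z)"
  using quad_homog_diff[OF quad_homog_cmult[OF quad_homog_norm, of "1 / 2"] quad_homog_area] by simp

lemma transfer_pow_norm: "(transfer ^^ n) (\<lambda>z. (norm z)\<^sup>2 / 2) = (\<lambda>z. (norm z)\<^sup>2 / 2)"
proof (induction n)
  case (Suc n)
  show ?case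
    using transfer_cmult[of "1 / 2" "\<lambda>z. (norm z)\<^sup>2"]
    by (simp add: Suc fun_eq_iff transfer_norm del: split_paired_All)
qed simp

lemma quad_homog_half_norm: "quad_homog (\<lambda>z :: (complex ^ 'd) \<times> (complex ^ 'd). (norm z)\<^sup>2 / 2)"
  using quad_homog_cmult[OF quad_homog_norm, of "1 / 2"] by simp

lemma transfer_pow_defect:
  "(transfer ^^ n) (\<lambda>z. (norm z)\<^sup>2 / 2 - area z) = (\<lambda>z. (norm z)\<^sup>2 / 2 - (transfer ^^ n) area z)"
proof (induction n)
  case (Suc n)
  show ?case
    using transfer_diff[OF quad_homog_half_norm quad_homog_transfer_pow[OF quad_homog_area, of n]]
      transfer_pow_norm[of 1]
    by (simp add: Suc fun_eq_iff del: split_paired_All)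
qed simp

lemma area_like_transfer_pow: "area_like ((transfer ^^ n) area)"
proof (induction n)
  case (Suc n)
  have "pair_apply v (a *s x, b *s y + c *s x) = (a *s (v *v x), b *s (v *v y) + c *s (v *v x))" for v a b c and x y :: "complex ^ 'd"
    by (simp add: pair_apply_def matrix_vector_right_distrib vector_scalar_commute)
  moreover have "pair_apply v (x, y) = (v *v x, v *v y)" for v and x y :: "complex ^ 'd"
    by (simp add: pair_apply_def)
  ultimately show ?case
    using Suc by (simp add: area_like_def transfer_def[of "(transfer ^^ n) area"])
qed (simp add: area_like_area)

lemma transfer_pow_area_le: "(transfer ^^ n) area z \<le> (norm z)\<^sup>2 / 2"
  using transfer_pow_mono[OF quad_homog_area quad_homog_half_norm area_le_norm, of n z]
  by (simp add: transfer_pow_norm)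

lemma transfer_pow_area_nonneg: "(transfer ^^ n) area z \<ge> 0"
  by (induction n arbitrary: z) (auto simp: area_nonneg transfer_def intro!: integral_nonneg)

lemma norm_orthonormal: "z \<in> orthonormal_pairs \<Longrightarrow> (norm z)\<^sup>2 = 2"
  by (simp add: orthonormal_pairs_def norm_pair)

lemma transfer_area_le: "transfer area z \<le> area z"
proof -
  have "transfer area w \<le> 1" if "w \<in> orthonormal_pairs" for w
    using transfer_pow_area_le[of 1 w] norm_orthonormal[OF that] by simp
  then show ?thesis
    using area_like_le[of "transfer area" 1 z] area_like_transfer_pow[of 1] by simp
qed

lemma transfer_pow_area_Suc_le: "(transfer ^^ Suc n) area z \<le> (transfer ^^ n) area z"
proof -
  have "(transfer ^^ n) (transfer area) z \<le> (transfer ^^ n) area z"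
    by (intro transfer_pow_mono quad_homog_transfer quad_homog_area transfer_area_le)
  then show ?thesis by (simp only: funpow_Suc_right o_def)
qed

text \<open>The mean area spanned by the images of an orthonormal pair can only fail to decrease strictly
  when almost every product of matrices is conformal on the plane of the pair, which purification
  excludes. Compactness of the set of orthonormal pairs makes the number of steps uniform.\<close>

lemma area_contraction:
  assumes pur: "purifying \<mu>"
  obtains N \<theta> where "0 \<le> \<theta>" "\<theta> < 1" "\<And>z. (transfer ^^ N) area z \<le> \<theta> * area z"
proof -
  define K where "K n = {z \<in> orthonormal_pairs. 1 \<le> (transfer ^^ n) area z}" for n
  have cont: "continuous_on A ((transfer ^^ n) area)" for A n
    using quad_homog_cont[OF quad_homog_transfer_pow[OF quad_homog_area]] continuous_on_subset by blast
  have compact: "compact (K n)" for n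
  proof -
    have "closed {z. 1 \<le> (transfer ^^ n) area z}"
      by (intro closed_Collect_le continuous_intros cont)
    then have "compact (orthonormal_pairs \<inter> {z. 1 \<le> (transfer ^^ n) area z})"
      by (rule compact_Int_closed[OF compact_orthonormal_pairs])
    then show ?thesis by (simp add: K_def Int_def)
  qed
  have anti: "K n \<subseteq> K m" if "m \<le> n" for m n
    using that
    by (rule lift_Suc_antimono_le[of K, rotated])
      (auto simp: K_def simp del: funpow.simps intro: order_trans[OF _ transfer_pow_area_Suc_le])
  have "\<exists>N. K N = {}"
  proof (rule ccontr)
    assume "\<nexists>N. K N = {}"
    then have "\<Inter> (range K) \<noteq> {}"
      by (intro compact_nest compact anti) auto
    then obtain e f where z: "\<And>n. (e, f) \<in> K n" by auto
    have on: "(e, f) \<in> orthonormal_pairs" using z[of 0] by (simp add: K_def)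
    have "AE \<omega> in tensor_power \<mu> n. norm (W n \<omega> *v e) = norm (W n \<omega> *v f) \<and> cinner (W n \<omega> *v e) (W n \<omega> *v f) = 0" for n
    proof -
      define \<Psi> :: "(complex ^ 'd) \<times> (complex ^ 'd) \<Rightarrow> real" where "\<Psi> z = (norm z)\<^sup>2 / 2 - area z" for z
      have \<Psi>: "quad_homog \<Psi>" "\<And>z. 0 \<le> \<Psi> z"
        using quad_homog_conformal_defect area_le_norm
        by (simp_all add: \<Psi>_def[abs_def] del: split_paired_All)
      have meas: "(\<lambda>\<omega>. \<Psi> (pair_apply (W n \<omega>) (e, f))) \<in> borel_measurable (PiM {..<n} (\<lambda>_. borel))"
        by (rule measurable_compose[OF measurable_W[OF refl order_refl]])
          (intro borel_measurable_continuous_onI continuous_on_compose2[OF quad_homog_cont[OF \<Psi>(1)] continuous_pair_apply], auto)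
      have "(transfer ^^ n) \<Psi> (e, f) \<le> 0"
        using z[of n] norm_orthonormal[OF on] unfolding \<Psi>_def
        by (subst transfer_pow_defect) (simp add: K_def)
      then have "(\<integral>\<^sup>+ \<omega>. ennreal (\<Psi> (pair_apply (W n \<omega>) (e, f))) \<partial>nz_power n) = 0"
        unfolding nn_integral_transfer_pow[OF \<Psi>] by (simp add: ennreal_neg)
      then have "AE \<omega> in nz_power n. ennreal (\<Psi> (pair_apply (W n \<omega>) (e, f))) = 0"
        by (subst (asm) nn_integral_0_iff_AE)
          (use meas in \<open>auto simp: measurable_cong_sets[OF sets_PiM_nonzero refl]\<close>)
      then have "AE \<omega> in nz_power n. \<Psi> (pair_apply (W n \<omega>) (e, f)) = 0"
        by eventually_elim (use \<Psi>(2) in \<open>simp add: ennreal_eq_0_iff order_antisym\<close>)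
      then have "AE \<omega> in tensor_power \<mu> n. \<Psi> (pair_apply (W n \<omega>) (e, f)) = 0"
      proof (rule AE_tensor_power[rotated 2])
        show "Measurable.pred (PiM {..<n} (\<lambda>_. borel)) (\<lambda>\<omega>. \<Psi> (pair_apply (W n \<omega>) (e, f)) = 0)"
          using meas by measurable
        show "\<Psi> (pair_apply (W n \<omega>) (e, f)) = 0" if "i < n" "\<omega> i = 0" for \<omega> i
          using quad_homog_zero[OF \<Psi>(1)] using W_eq_zero[of i n \<omega>, OF that] by (simp add: pair_apply_def zero_prod_def)
      qed
      then show ?thesis
      proof eventually_elim
        case (elim \<omega>)
        then show ?case
          using area_eq_norm[of "pair_apply (W n \<omega>) (e, f)"] by (simp add: \<Psi>_def pair_apply_def)
      qed
    qed
    with purifying_no_conformal_pair[OF pur on] show False by blast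
  qed
  then obtain N where N: "K N = {}" by blast
  show ?thesis
  proof (cases "orthonormal_pairs = ({} :: ((complex ^ 'd) \<times> (complex ^ 'd)) set)")
    case True
    then show ?thesis
      using area_like_le[OF area_like_transfer_pow[of N], of 0] by (intro that[of 0 N]) auto
  next
    case False
    obtain z0 where z0: "z0 \<in> orthonormal_pairs"
      "\<And>z. z \<in> orthonormal_pairs \<Longrightarrow> (transfer ^^ N) area z \<le> (transfer ^^ N) area z0"
      using continuous_attains_sup[OF compact_orthonormal_pairs False cont] by blast
    show ?thesis
    proof (rule that[of "(transfer ^^ N) area z0" N])
      show "(transfer ^^ N) area z0 < 1" using z0(1) N by (cases z0) (auto simp: K_def not_le)
      show "(transfer ^^ N) area z \<le> (transfer ^^ N) area z0 * area z" for z
        by (rule area_like_le[OF area_like_transfer_pow z0(2)])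
    qed (rule transfer_pow_area_nonneg)
  qed
qed

text \<open>The contraction is submultiplicative along multiples of \<open>N\<close>, hence the decay is exponential.\<close>

lemma area_decay:
  assumes pur: "purifying \<mu>" and "\<epsilon> > 0"
  obtains n where "(transfer ^^ n) area z < \<epsilon>"
proof -
  obtain N \<theta> where \<theta>: "0 \<le> \<theta>" "\<theta> < 1" "\<And>z. (transfer ^^ N) area z \<le> \<theta> * area z"
    using area_contraction[OF pur] by metis
  have it: "(transfer ^^ (N * m)) area z \<le> \<theta> ^ m * area z" for m z
  proof (induction m arbitrary: z)
    case (Suc m)
    have "(transfer ^^ (N * Suc m)) area z = (transfer ^^ N) ((transfer ^^ (N * m)) area) z"
      by (simp add: funpow_add)
    also have "\<dots> \<le> (transfer ^^ N) (\<lambda>z. \<theta> ^ m * area z) z"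
      by (intro transfer_pow_mono quad_homog_transfer_pow quad_homog_cmult quad_homog_area Suc)
    also have "\<dots> = \<theta> ^ m * (transfer ^^ N) area z"
      by (rule transfer_pow_cmult)
    also have "\<dots> \<le> \<theta> ^ m * (\<theta> * area z)"
      by (intro mult_left_mono \<theta>) (simp add: \<theta>)
    finally show ?case by (simp add: mult_ac)
  qed simp
  have "(\<lambda>m. \<theta> ^ m * area z) \<longlonglongrightarrow> 0 * area z"
    using \<theta> by (intro tendsto_intros LIMSEQ_power_zero) auto
  then have "\<forall>\<^sub>F m in sequentially. \<theta> ^ m * area z < \<epsilon>"
    using \<open>\<epsilon> > 0\<close> by (intro order_tendstoD) auto
  then obtain m where "\<theta> ^ m * area z < \<epsilon>"
    by (auto simp: eventually_sequentially)
  with it[of m z] that show ?thesis by (meson le_less_trans)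
qed

end

section \<open>Harmonic functions are constant\<close>

lemma norm_parallelogram: "(norm (x + y))\<^sup>2 + (norm (x - y))\<^sup>2 = 2 * (norm x)\<^sup>2 + 2 * (norm y)\<^sup>2"
  for x y :: "'a :: real_inner"
  by (simp add: power2_norm_eq_inner inner_simps inner_commute)

lemma real_eq_zero_if_small: "(\<And>e. e > 0 \<Longrightarrow> \<bar>x\<bar> \<le> e) \<Longrightarrow> x = (0 :: real)"
  using field_le_epsilon[of "\<bar>x\<bar>" 0] by simp

context stochastic_matrices
begin

text \<open>The defect in the parallelogram law of a homogeneous lift vanishes on dependent pairs, hence
  it is controlled by the area. For a harmonic function it is a fixed point of the transfer
  operator, whose iterates annihilate the area.\<close>

lemma harmonic_parallelogram:
  assumes pur: "purifying \<mu>" and F: "continuous_on UNIV F" and harm: "\<And>p. kernel_op \<mu> F p = F p"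
  shows "lift F (x + y) + lift F (x - y) = 2 * lift F x + 2 * lift F y"
proof -
  define \<Delta> where "\<Delta> z = lift F (fst z + snd z) + lift F (fst z - snd z) - 2 * lift F (fst z) - 2 * lift F (snd z)"
    for z :: "(complex ^ 'd) \<times> (complex ^ 'd)"
  have qh: "quad_homog (\<lambda>z :: (complex ^ 'd) \<times> (complex ^ 'd). lift F (L z))" if "bounded_linear L" for L
    by (rule quad_homog_linear[OF quad_homog_lift[OF F] that])
  have q\<Delta>: "quad_homog \<Delta>"
    unfolding \<Delta>_def
    by (intro quad_homog_add quad_homog_diff quad_homog_cmult qh bounded_linear_add bounded_linear_sub
        bounded_linear_fst bounded_linear_snd)
  have fixed: "transfer \<Delta> z = \<Delta> z" for z
  proof -
    have "F = kernel_op \<mu> F" by (simp add: harm fun_eq_iff)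
    then have "(\<integral> v. lift F (v *v x) \<partial>\<mu>) = lift F x" for x
      using lift_kernel_op[of F x] by simp
    then show ?thesis
      unfolding transfer_def \<Delta>_def pair_apply_def
      by (simp add: integrable_kernel_op[OF F] matrix_vector_right_distrib[symmetric]
          matrix_vector_mult_diff_distrib[symmetric])
  qed
  have zero: "\<Delta> z = 0" if "area z = 0" for z
  proof -
    obtain x y where z: "z = (x, y)" by (cases z)
    show ?thesis
    proof (cases "x = 0")
      case True
      have "- y = (- 1) *s y" by (simp add: vec_eq_iff)
      then have "lift F (- y) = lift F y" using lift_cscale[of F "- 1" y] by simp
      then show ?thesis by (simp add: \<Delta>_def z True)
    next
      case False
      then obtain c where c: "y = c *s x" using area_eq_zeroD \<open>area z = 0\<close> z by blast
      have "x + y = (1 + c) *s x" "x - y = (1 - c) *s x"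
        by (simp_all add: c vec_eq_iff algebra_simps)
      then have "lift F (x + y) = (cmod (1 + c))\<^sup>2 * lift F x" "lift F (x - y) = (cmod (1 - c))\<^sup>2 * lift F x"
        "lift F y = (cmod c)\<^sup>2 * lift F x"
        by (simp_all only: lift_cscale c)
      then have "\<Delta> z = ((cmod (1 + c))\<^sup>2 + (cmod (1 - c))\<^sup>2 - 2 - 2 * (cmod c)\<^sup>2) * lift F x"
        by (simp add: \<Delta>_def z algebra_simps)
      also have "(cmod (1 + c))\<^sup>2 + (cmod (1 - c))\<^sup>2 - 2 - 2 * (cmod c)\<^sup>2 = 0"
        using norm_parallelogram[of 1 c] by simp
      finally show ?thesis by simp
    qed
  qed
  have "\<bar>\<Delta> z\<bar> \<le> e" if "e > 0" for z e
  proof -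
    define \<epsilon> where "\<epsilon> = e / (2 * ((norm z)\<^sup>2 + 1))"
    have n: "(norm z)\<^sup>2 + 1 > 0" by (smt (verit) zero_le_power2)
    then have \<epsilon>: "\<epsilon> > 0" using \<open>e > 0\<close> by (simp add: \<epsilon>_def)
    obtain C where C: "C \<ge> 0" "\<And>z. \<bar>\<Delta> z\<bar> \<le> \<epsilon> * (norm z)\<^sup>2 + C * area z"
      using quad_homog_dominated[OF q\<Delta> quad_homog_area area_nonneg zero \<epsilon>] by metis
    have it: "\<bar>\<Delta> z\<bar> \<le> \<epsilon> * (norm z)\<^sup>2 + C * (transfer ^^ n) area z" for n z
    proof (induction n arbitrary: z)
      case (Suc n)
      have int: "integrable \<mu> (\<lambda>v. (transfer ^^ n) area (pair_apply v z))"
        by (intro integrable_transfer quad_homog_transfer_pow quad_homog_area)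
      have "\<bar>\<Delta> z\<bar> = \<bar>\<integral> v. \<Delta> (pair_apply v z) \<partial>\<mu>\<bar>"
        using fixed[of z] by (simp add: transfer_def)
      also have "\<dots> \<le> (\<integral> v. \<bar>\<Delta> (pair_apply v z)\<bar> \<partial>\<mu>)"
        by (rule integral_abs_bound)
      also have "\<dots> \<le> (\<integral> v. \<epsilon> * (norm (pair_apply v z))\<^sup>2 + C * (transfer ^^ n) area (pair_apply v z) \<partial>\<mu>)"
        by (intro integral_mono Bochner_Integration.integrable_add integrable_mult_right integrable_abs
            int integrable_transfer[OF q\<Delta>] has_integral_norm_pair Suc)
      also have "\<dots> = \<epsilon> * (norm z)\<^sup>2 + C * (transfer ^^ Suc n) area z"
        using int by (simp add: has_integral_norm_pair transfer_def[of "(transfer ^^ n) area"])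
      finally show ?case .
    qed (simp add: C del: split_paired_All)
    have "e / (2 * (C + 1)) > 0" using C(1) \<open>e > 0\<close> by simp
    then obtain n where "(transfer ^^ n) area z < e / (2 * (C + 1))"
      using area_decay[OF pur] by blast
    then have "C * (transfer ^^ n) area z \<le> C * (e / (2 * (C + 1)))"
      using C(1) by (intro mult_left_mono) auto
    also have "\<dots> \<le> e / 2"
      using C(1) \<open>e > 0\<close> by (simp add: field_simps)
    finally have "C * (transfer ^^ n) area z \<le> e / 2" .
    moreover have "\<epsilon> * (norm z)\<^sup>2 \<le> e / 2"
      using \<open>e > 0\<close> n by (simp add: \<epsilon>_def field_simps)
    ultimately show ?thesis using it[of z n] by linarith
  qed
  then have "\<Delta> (x, y) = 0" by (rule real_eq_zero_if_small)
  then show ?thesis by (simp add: \<Delta>_def)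
qed

text \<open>The maximal vectors are those at which a nonnegative function that satisfies the parallelogram
  law vanishes, so they form a linear space; harmonicity makes it invariant.\<close>

lemma invariant_subspace_maximum:
  assumes pur: "purifying \<mu>" and F: "continuous_on UNIV F" and harm: "\<And>p. kernel_op \<mu> F p = F p"
    and le: "\<And>p. F p \<le> F p0"
  shows "invariant_subspace \<mu> {x. lift F x = F p0 * (norm x)\<^sup>2}"
proof -
  define H where "H x = F p0 * (norm x)\<^sup>2 - lift F x" for x
  have H_nonneg: "H x \<ge> 0" for x
    using mult_left_mono[OF le[of "abs_cproj x"], of "(norm x)\<^sup>2"] by (simp add: H_def lift_def mult.commute)
  have par: "H (x + y) + H (x - y) = 2 * H x + 2 * H y" for x y
    using harmonic_parallelogram[OF pur F harm, of x y]
      arg_cong[OF norm_parallelogram[of x y], of "\<lambda>t. F p0 * t"]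
    by (simp add: H_def right_diff_distrib distrib_left)
  have scale: "H (c *s x) = (cmod c)\<^sup>2 * H x" for c x
    by (simp add: H_def lift_cscale norm_cscale power_mult_distrib algebra_simps)
  have qH: "quad_homog H"
    unfolding H_def by (intro quad_homog_diff quad_homog_cmult quad_homog_norm quad_homog_lift F)
  have E: "{x. lift F x = F p0 * (norm x)\<^sup>2} = {x. H x = 0}" by (auto simp: H_def)
  have "vec.subspace {x. H x = 0}"
  proof (rule vec.subspaceI)
    fix x y assume "x \<in> {x. H x = 0}" "y \<in> {x. H x = 0}"
    then show "x + y \<in> {x. H x = 0}"
      using par[of x y] H_nonneg[of "x + y"] H_nonneg[of "x - y"] by simp
  next
    fix c x assume "x \<in> {x. H x = 0}"
    then show "c *s x \<in> {x. H x = 0}" by (simp add: scale)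
  qed (simp add: H_def)
  moreover have "{x. H x = 0} \<noteq> {0}"
  proof
    assume *: "{x. H x = 0} = {0}"
    have "urep p0 \<in> {x. H x = 0}" by (simp add: H_def)
    then show False unfolding * by simp
  qed
  moreover have "v *v x \<in> {x. H x = 0}" if v: "v \<in> msupport \<mu>" and x: "H x = 0" for v x
  proof -
    have cont: "continuous_on UNIV (\<lambda>v :: complex ^ 'd ^ 'd. H (v *v x))"
      by (rule continuous_on_compose2[OF quad_homog_cont[OF qH] continuous_mult_vec]) auto
    have int: "integrable \<mu> (\<lambda>v. H (v *v x))"
      unfolding H_def by (intro Bochner_Integration.integrable_diff integrable_mult_right has_integral_norm integrable_kernel_op F)
    have "F = kernel_op \<mu> F" by (simp add: harm fun_eq_iff)
    then have "(\<integral> v. lift F (v *v x) \<partial>\<mu>) = lift F x"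
      using lift_kernel_op[of F x] by simp
    then have "(\<integral> v. H (v *v x) \<partial>\<mu>) = H x"
      by (simp add: H_def has_integral_norm integrable_kernel_op F)
    then have "AE v in \<mu>. H (v *v x) = 0"
      using integral_nonneg_eq_0_iff_AE[OF int] H_nonneg x by auto
    moreover have op: "open {v. 0 < H (v *v x)}"
      by (intro open_Collect_less continuous_intros cont)
    ultimately have "AE v in \<mu>. \<not> 0 < H (v *v x)"
      by (auto elim: eventually_mono)
    then have "emeasure \<mu> {v. 0 < H (v *v x)} = 0"
      using emeasure_eq_0_AE[of "\<lambda>v. 0 < H (v *v x)" \<mu>] by simp
    then have "v \<notin> {v. 0 < H (v *v x)}"
      using v op unfolding msupport_def by force
    then show ?thesis using H_nonneg[of "v *v x"] by simp
  qed
  ultimately show ?thesis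
    unfolding E invariant_subspace_def by blast
qed

text \<open>Minimality is that of the dimension among the invariant subspaces of \<open>E\<close>.\<close>

lemma ex_minimal_invariant_subspace:
  assumes "invariant_subspace \<mu> E"
  obtains E' where "E' \<subseteq> E" "invariant_subspace \<mu> E'" "\<And>F. invariant_subspace \<mu> F \<Longrightarrow> F \<subseteq> E' \<Longrightarrow> F = E'"
proof -
  obtain E' where E': "invariant_subspace \<mu> E' \<and> E' \<subseteq> E"
    "\<And>F. invariant_subspace \<mu> F \<and> F \<subseteq> E \<Longrightarrow> vec.dim E' \<le> vec.dim F"
    using ex_has_least_nat[of "\<lambda>F. invariant_subspace \<mu> F \<and> F \<subseteq> E" E vec.dim] assms by auto
  show ?thesis
  proof (rule that[of E'])
    fix F assume "invariant_subspace \<mu> F" "F \<subseteq> E'"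
    moreover from this have "vec.dim E' \<le> vec.dim F" using E' by blast
    ultimately show "F = E'"
      using E'(1) vec.subspace_dim_equal[of F E'] by (auto simp: invariant_subspace_def)
  qed (use E' in auto)
qed

text \<open>The maximum and the minimum of a harmonic function each give an invariant subspace, and so
  contain the unique minimal one. At a nonzero vector of the latter both values are attained.\<close>

lemma harmonic_constant:
  assumes pur: "purifying \<mu>" and erg: "ergodic \<mu>"
    and F: "continuous_on UNIV F" and harm: "\<And>p. kernel_op \<mu> F p = F p"
  shows "F p = F q"
proof -
  obtain p1 where p1: "\<And>p. F p \<le> F p1"
    using continuous_attains_sup[OF compact_cproj _ F] by auto
  obtain p2 where p2: "\<And>p. F p2 \<le> F p"
    using continuous_attains_inf[OF compact_cproj _ F] by auto
  have "invariant_subspace \<mu> {x. lift F x = F p1 * (norm x)\<^sup>2}"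
    using invariant_subspace_maximum[OF pur F harm p1] .
  then obtain E1 where E1: "E1 \<subseteq> {x. lift F x = F p1 * (norm x)\<^sup>2}" "invariant_subspace \<mu> E1"
    "\<And>F. invariant_subspace \<mu> F \<Longrightarrow> F \<subseteq> E1 \<Longrightarrow> F = E1"
    using ex_minimal_invariant_subspace by blast
  have "invariant_subspace \<mu> {x. lift (\<lambda>p. - F p) x = - F p2 * (norm x)\<^sup>2}"
  proof (rule invariant_subspace_maximum[OF pur])
    show "kernel_op \<mu> (\<lambda>p. - F p) p = - F p" for p
      using kernel_op_cmult[of "- 1" F p] harm[of p] by simp
  qed (use F p2 in \<open>auto intro: continuous_intros\<close>)
  then obtain E2 where E2: "E2 \<subseteq> {x. lift (\<lambda>p. - F p) x = - F p2 * (norm x)\<^sup>2}" "invariant_subspace \<mu> E2"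
    "\<And>F. invariant_subspace \<mu> F \<Longrightarrow> F \<subseteq> E2 \<Longrightarrow> F = E2"
    using ex_minimal_invariant_subspace by blast
  have "E1 = E2"
    using erg E1(2,3) E2(2,3) unfolding ergodic_def by metis
  moreover obtain x where x: "x \<in> E1" "x \<noteq> 0"
    using E1(2) vec.subspace_0[of E1] by (auto simp: invariant_subspace_def)
  ultimately have "lift F x = F p1 * (norm x)\<^sup>2" "lift F x = F p2 * (norm x)\<^sup>2"
    using E1(1) E2(1) by (auto simp: lift_def)
  then have "F p1 = F p2" using x by simp
  then show ?thesis using p1[of p] p2[of p] p1[of q] p2[of q] by linarith
qed

section \<open>Uniform convergence of ergodic means\<close>

lemma measurable_norm_act:
  "(\<lambda>z. (norm (snd z *v urep (fst z)))\<^sup>2) \<in> borel_measurable (borel \<Otimes>\<^sub>M nonzero_part)"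
proof -
  have "snd \<in> borel \<Otimes>\<^sub>M nonzero_part \<rightarrow>\<^sub>M borel" by measurable
  moreover have "(\<lambda>z. line_proj (fst z)) \<in> borel \<Otimes>\<^sub>M nonzero_part \<rightarrow>\<^sub>M borel"
    by (rule measurable_compose[OF measurable_fst measurable_line_proj])
  ultimately have "(\<lambda>z. snd z ** line_proj (fst z) ** cadjoint (snd z)) \<in> borel \<Otimes>\<^sub>M nonzero_part \<rightarrow>\<^sub>M borel"
    by (rule measurable_conj)
  then show ?thesis unfolding norm_mult_urep by measurable
qed

text \<open>Invariance is a statement on sets. The image of the weighted product measure under the action
  has the same values on sets as the invariant measure, so both define the same integrals.\<close>

lemma invariant_nn_integral:
  assumes inv: "invariant_prob \<mu> \<nu>" and f: "f \<in> borel_measurable borel"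
  shows "(\<integral>\<^sup>+ p. f p \<partial>\<nu>) =
    (\<integral>\<^sup>+ p. (\<integral>\<^sup>+ v. f (act v p) * ennreal ((norm (v *v urep p))\<^sup>2) \<partial>nonzero_part) \<partial>\<nu>)"
proof -
  have sets_\<nu> [measurable_cong]: "sets \<nu> = sets borel" using inv by (simp add: invariant_prob_def)
  define P where "P = \<nu> \<Otimes>\<^sub>M nonzero_part"
  have sets_P [measurable_cong]: "sets P = sets (borel \<Otimes>\<^sub>M nonzero_part)"
    unfolding P_def by (intro sets_pair_measure_cong sets_\<nu> refl)
  define w where "w z = ennreal ((norm (snd z *v urep (fst z)))\<^sup>2)" for z :: "'d cproj \<times> (complex ^ 'd ^ 'd)"
  have w [measurable]: "w \<in> borel_measurable P"
    using measurable_norm_act unfolding w_def measurable_cong_sets[OF sets_P refl] by measurable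
  have act [measurable]: "(\<lambda>z. act (snd z) (fst z)) \<in> P \<rightarrow>\<^sub>M borel"
    unfolding measurable_cong_sets[OF sets_P refl] by (rule measurable_act) measurable
  define \<nu>' where "\<nu>' = distr (density P w) borel (\<lambda>z. act (snd z) (fst z))"
  have step: "(\<integral>\<^sup>+ p. f p \<partial>\<nu>') = (\<integral>\<^sup>+ p. (\<integral>\<^sup>+ v. f (act v p) * ennreal ((norm (v *v urep p))\<^sup>2) \<partial>nonzero_part) \<partial>\<nu>)"
    if [measurable]: "f \<in> borel_measurable borel" for f :: "'d cproj \<Rightarrow> ennreal"
  proof -
    have "(\<integral>\<^sup>+ p. f p \<partial>\<nu>') = (\<integral>\<^sup>+ z. f (act (snd z) (fst z)) \<partial>density P w)"
      unfolding \<nu>'_def by (rule nn_integral_distr) measurable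
    also have "\<dots> = (\<integral>\<^sup>+ z. w z * f (act (snd z) (fst z)) \<partial>P)"
      by (rule nn_integral_density) measurable
    also have "\<dots> = (\<integral>\<^sup>+ p. \<integral>\<^sup>+ v. w (p, v) * f (act v p) \<partial>nonzero_part \<partial>\<nu>)"
      using sigma_finite_measure.nn_integral_fst[OF sigma_finite_nonzero_part,
          of "\<lambda>z. w z * f (act (snd z) (fst z))" \<nu>] w act
      by (simp add: P_def)
    finally show ?thesis by (simp add: w_def mult.commute)
  qed
  have "\<nu>' = \<nu>"
  proof (rule measure_eqI)
    fix A assume "A \<in> sets \<nu>'"
    then have A [measurable]: "A \<in> sets borel" by (simp add: \<nu>'_def)
    have "(\<integral>\<^sup>+ v. indicator A (act v p) * ennreal ((norm (v *v urep p))\<^sup>2) \<partial>nonzero_part) = kernel \<mu> p A" for p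
    proof -
      have [measurable]: "(\<lambda>v. act v p) \<in> borel \<rightarrow>\<^sub>M borel"
        by (intro measurable_act) auto
      have [measurable]: "(\<lambda>v. (norm (v *v urep p))\<^sup>2) \<in> borel_measurable borel"
        by (intro borel_measurable_continuous_onI continuous_intros continuous_mult_vec)
      show ?thesis
        unfolding kernel_def
      proof (rule nn_integral_nonzero_part)
        have "(\<lambda>v. indicator A (act v p) :: ennreal) \<in> borel_measurable borel"
          by (rule measurable_compose[of "\<lambda>v. act v p" borel borel]) auto
        moreover have "(\<lambda>v. ennreal ((norm (v *v urep p))\<^sup>2)) \<in> borel_measurable borel"
          by (intro measurable_compose[OF _ measurable_ennreal]) fact
        ultimately show "(\<lambda>v. indicator A (act v p) * ennreal ((norm (v *v urep p))\<^sup>2)) \<in> borel_measurable borel"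
          by (rule borel_measurable_times_ennreal)
      qed (simp add: zero_mult_vec)
    qed
    then have "emeasure \<nu>' A = (\<integral>\<^sup>+ p. kernel \<mu> p A \<partial>\<nu>)"
      using step[of "indicator A"] by (simp add: \<nu>'_def)
    also have "\<dots> = emeasure \<nu> A"
      using inv A by (simp add: invariant_prob_def)
    finally show "emeasure \<nu>' A = emeasure \<nu> A" .
  qed (simp add: \<nu>'_def sets_\<nu>)
  then show ?thesis using step[OF f] by simp
qed

lemma integrable_invariant:
  fixes f :: "'d cproj \<Rightarrow> real"
  assumes inv: "invariant_prob \<mu> \<nu>" and f: "continuous_on UNIV f"
  shows "integrable \<nu> f"
proof -
  interpret prob_space \<nu> using inv by (simp add: invariant_prob_def)
  obtain M where "M > 0" "\<And>p. \<bar>f p\<bar> \<le> M" using cproj_bounded[OF f] by blast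
  moreover have "f \<in> borel_measurable \<nu>"
    using borel_measurable_continuous_onI[OF f] inv
    by (simp add: invariant_prob_def cong: measurable_cong_sets)
  ultimately show ?thesis by (intro integrable_const_bound[of _ M]) auto
qed

lemma integral_kernel_op:
  assumes inv: "invariant_prob \<mu> \<nu>" and f: "continuous_on UNIV f"
  shows "(\<integral> p. kernel_op \<mu> f p \<partial>\<nu>) = (\<integral> p. f p \<partial>\<nu>)"
proof -
  interpret prob_space \<nu> using inv by (simp add: invariant_prob_def)
  obtain M where M: "M > 0" "\<And>p. \<bar>f p\<bar> \<le> M" using cproj_bounded[OF f] by blast
  define h where "h p = f p + M" for p
  have h: "continuous_on UNIV h" unfolding h_def by (intro continuous_intros f)
  have h_nonneg: "h p \<ge> 0" for p using M(2)[of p] by (simp add: h_def abs_le_iff)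
  have Kh: "kernel_op \<mu> h p = kernel_op \<mu> f p + M" for p
    unfolding h_def using kernel_op_add[OF f, of "\<lambda>_. M" p] by (simp add: kernel_op_const)
  have Kh_nonneg: "kernel_op \<mu> h p \<ge> 0" for p
    unfolding kernel_op_def by (intro Bochner_Integration.integral_nonneg) (simp add: h_nonneg)
  have inner: "(\<integral>\<^sup>+ v. ennreal (h (act v p)) * ennreal ((norm (v *v urep p))\<^sup>2) \<partial>nonzero_part) = ennreal (kernel_op \<mu> h p)" for p
  proof -
    have "(\<integral>\<^sup>+ v. ennreal (h (act v p)) * ennreal ((norm (v *v urep p))\<^sup>2) \<partial>nonzero_part) =
      (\<integral>\<^sup>+ v. ennreal (lift h (fst (pair_apply v (urep p, 0)))) \<partial>nonzero_part)"
      by (simp add: pair_apply_def lift_def act_def ennreal_mult[symmetric] h_nonneg mult.commute)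
    also have "\<dots> = ennreal (transfer (\<lambda>z. lift h (fst z)) (urep p, 0))"
      by (intro nn_integral_transfer quad_homog_lift_fst h) (simp add: lift_def h_nonneg)
    finally show ?thesis by (simp add: transfer_lift)
  qed
  have "ennreal (\<integral> p. h p \<partial>\<nu>) = (\<integral>\<^sup>+ p. ennreal (h p) \<partial>\<nu>)"
    by (intro nn_integral_eq_integral[symmetric] integrable_invariant[OF inv h]) (simp add: h_nonneg)
  also have "\<dots> = (\<integral>\<^sup>+ p. ennreal (kernel_op \<mu> h p) \<partial>\<nu>)"
    using borel_measurable_continuous_onI[OF h]
    by (subst invariant_nn_integral[OF inv]) (simp_all add: inner)
  also have "\<dots> = ennreal (\<integral> p. kernel_op \<mu> h p \<partial>\<nu>)"
    by (intro nn_integral_eq_integral integrable_invariant[OF inv] continuous_kernel_op h) (simp add: Kh_nonneg)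
  finally have "(\<integral> p. h p \<partial>\<nu>) = (\<integral> p. kernel_op \<mu> h p \<partial>\<nu>)"
    by (subst (asm) ennreal_inj) (auto intro!: Bochner_Integration.integral_nonneg simp: h_nonneg Kh_nonneg)
  then show ?thesis
    using integrable_invariant[OF inv f] integrable_invariant[OF inv continuous_kernel_op[OF f]]
    by (simp only: Kh) (simp add: h_def prob_space)
qed

lemma integral_kernel_op_pow:
  assumes inv: "invariant_prob \<mu> \<nu>" and f: "continuous_on UNIV f"
  shows "(\<integral> p. (kernel_op \<mu> ^^ n) f p \<partial>\<nu>) = (\<integral> p. f p \<partial>\<nu>)"
  by (induction n) (auto simp: integral_kernel_op[OF inv] continuous_kernel_op_pow[OF f])

definition ergodic_mean :: "nat \<Rightarrow> ('d cproj \<Rightarrow> real) \<Rightarrow> 'd cproj \<Rightarrow> real" where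
  "ergodic_mean n f p = (\<Sum>k<n. (kernel_op \<mu> ^^ k) f p) / real n"

lemma continuous_ergodic_mean: "continuous_on UNIV f \<Longrightarrow> continuous_on UNIV (ergodic_mean n f)"
  unfolding ergodic_mean_def divide_inverse by (intro continuous_intros continuous_kernel_op_pow)

text \<open>All iterates of the Markov operator share the modulus of continuity of the lift, so the
  theorem of Arzela and Ascoli applies to the ergodic means. Any limit is harmonic, hence constant.\<close>

lemma ergodic_mean_converges:
  assumes pur: "purifying \<mu>" and erg: "ergodic \<mu>" and inv: "invariant_prob \<mu> \<nu>"
    and f: "continuous_on UNIV f" and "\<delta> > 0"
  obtains n where "n > 0" "\<And>p. \<bar>ergodic_mean n f p - (\<integral> p. f p \<partial>\<nu>)\<bar> \<le> \<delta>"
proof -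
  interpret prob_space \<nu> using inv by (simp add: invariant_prob_def)
  obtain M where M: "M > 0" "\<And>p. \<bar>f p\<bar> \<le> M" using cproj_bounded[OF f] by blast
  define F where "F n x = ergodic_mean (Suc n) f (abs_cproj x)" for n x
  have bound: "\<bar>ergodic_mean (Suc n) f p\<bar> \<le> M" for n p
  proof -
    have "\<bar>\<Sum>k<Suc n. (kernel_op \<mu> ^^ k) f p\<bar> \<le> (\<Sum>k<Suc n. M)"
      by (intro order_trans[OF sum_abs] sum_mono kernel_op_pow_bound f M)
    then show ?thesis by (simp add: ergodic_mean_def field_simps del: sum.lessThan_Suc)
  qed
  have equi: "\<exists>d>0. \<forall>n y. y \<in> sphere 0 1 \<and> norm (x - y) < d \<longrightarrow> norm (F n x - F n y) < e"
    if x: "x \<in> sphere 0 1" and e: "e > 0" for x e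
  proof -
    have "e / 4 > 0" using e by simp
    then obtain C where C: "C \<ge> 0" "quad_modulus (e / 4) C (\<lambda>z :: (complex ^ 'd) \<times> (complex ^ 'd). lift f (fst z))"
      using quad_homog_modulus[OF quad_homog_lift_fst[OF f]] by blast
    have k: "\<bar>(kernel_op \<mu> ^^ k) f (abs_cproj x) - (kernel_op \<mu> ^^ k) f (abs_cproj y)\<bar> \<le> e / 2 + C * (norm (x - y))\<^sup>2"
      if "norm y = 1" for k y
    proof -
      have "quad_modulus (e / 4) C (\<lambda>z :: (complex ^ 'd) \<times> (complex ^ 'd). lift ((kernel_op \<mu> ^^ k) f) (fst z))"
        using transfer_pow_modulus[OF quad_homog_lift_fst[OF f] C(2), of k] by (simp add: transfer_pow_lift)
      then have "\<bar>lift ((kernel_op \<mu> ^^ k) f) x - lift ((kernel_op \<mu> ^^ k) f) y\<bar>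
          \<le> e / 4 * ((norm (x, 0 :: complex ^ 'd))\<^sup>2 + (norm (y, 0 :: complex ^ 'd))\<^sup>2) + C * (norm ((x, 0 :: complex ^ 'd) - (y, 0)))\<^sup>2"
        unfolding quad_modulus_def by (metis fst_conv)
      then show ?thesis using that x by (simp add: lift_unit norm_Pair)
    qed
    define d where "d = sqrt (e / (4 * (C + 1)))"
    have d: "d > 0" using e C(1) by (simp add: d_def)
    have "norm (F n x - F n y) < e" if y: "y \<in> sphere 0 1" "norm (x - y) < d" for n y
    proof -
      have "(norm (x - y))\<^sup>2 \<le> d\<^sup>2" using y(2) by (intro power_mono) auto
      also have "d\<^sup>2 = e / (4 * (C + 1))" using e C(1) by (simp add: d_def)
      finally have "C * (norm (x - y))\<^sup>2 \<le> C * (e / (4 * (C + 1)))" using C(1) by (rule mult_left_mono)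
      also have "\<dots> \<le> e / 4" using C(1) e by (simp add: field_simps)
      finally have le: "C * (norm (x - y))\<^sup>2 \<le> e / 4" .
      have "\<bar>F n x - F n y\<bar> = \<bar>\<Sum>k<Suc n. (kernel_op \<mu> ^^ k) f (abs_cproj x) - (kernel_op \<mu> ^^ k) f (abs_cproj y)\<bar> / real (Suc n)"
        by (simp add: F_def ergodic_mean_def sum_subtractf diff_divide_distrib[symmetric] abs_divide del: sum.lessThan_Suc)
      also have "\<dots> \<le> (\<Sum>k<Suc n. e / 2 + C * (norm (x - y))\<^sup>2) / real (Suc n)"
        using y(1) by (intro divide_right_mono order_trans[OF sum_abs] sum_mono k) auto
      also have "\<dots> = e / 2 + C * (norm (x - y))\<^sup>2"
        by (simp del: sum.lessThan_Suc)
      also have "\<dots> < e" using le e by linarith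
      finally show ?thesis by simp
    qed
    with d show ?thesis by blast
  qed
  obtain g k where gk: "continuous_on (sphere 0 1) g" "strict_mono (k :: nat \<Rightarrow> nat)"
    "\<And>e. 0 < e \<Longrightarrow> \<exists>N. \<forall>n x. n \<ge> N \<and> x \<in> sphere 0 1 \<longrightarrow> norm (F (k n) x - g x) < e"
    by (rule Arzela_Ascoli[of "sphere (0 :: complex ^ 'd) 1" F M, OF compact_sphere _ equi])
      (auto simp: F_def bound)
  define m where "m n = Suc (k n)" for n
  define G where "G p = g (urep p)" for p :: "'d cproj"
  have conv: "\<exists>N. \<forall>n\<ge>N. \<forall>p. \<bar>ergodic_mean (m n) f p - G p\<bar> < e" if e: "e > 0" for e
  proof -
    obtain N where N: "\<And>n x. n \<ge> N \<Longrightarrow> x \<in> sphere 0 1 \<Longrightarrow> norm (F (k n) x - g x) < e"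
      using gk(3)[OF e] by blast
    have "\<bar>ergodic_mean (m n) f p - G p\<bar> < e" if "n \<ge> N" for n p
      using N[OF that, of "urep p"] by (simp add: F_def G_def m_def)
    then show ?thesis by blast
  qed
  have G: "continuous_on UNIV G"
  proof (rule uniform_limit_theorem)
    show "uniform_limit UNIV (\<lambda>n. ergodic_mean (m n) f) G sequentially"
      unfolding uniform_limit_sequentially_iff using conv by (simp add: dist_real_def)
    show "\<forall>\<^sub>F n in sequentially. continuous_on UNIV (ergodic_mean (m n) f)"
      by (intro always_eventually allI continuous_ergodic_mean f)
  qed simp
  have m_ge: "n \<le> m n" for n
    using seq_suble[OF gk(2), of n] by (simp add: m_def)
  have harm: "kernel_op \<mu> G p = G p" for p
  proof -
    have "\<bar>kernel_op \<mu> G p - G p\<bar> \<le> e" if "e > 0" for e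
    proof -
      obtain N where N: "\<And>n p. n \<ge> N \<Longrightarrow> \<bar>ergodic_mean (m n) f p - G p\<bar> < e / 3"
        using conv[of "e / 3"] \<open>e > 0\<close> by auto
      define N' where "N' = nat \<lceil>6 * M / e\<rceil>"
      define n where "n = m (max N N')"
      have "6 * M / e \<le> real N'" unfolding N'_def by linarith
      also have "N' \<le> n" using m_ge[of "max N N'"] by (simp add: n_def)
      finally have "6 * M / e \<le> real n" by simp
      then have n: "2 * M / real n \<le> e / 3" "n > 0"
        using \<open>e > 0\<close> M(1) by (auto simp: n_def m_def field_simps)
      define A where "A = ergodic_mean n f"
      have A: "continuous_on UNIV A" unfolding A_def by (intro continuous_ergodic_mean f)
      have AG: "\<bar>A q - G q\<bar> \<le> e / 3" for q
        using N[of "max N N'" q] by (simp add: A_def n_def)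
      have "kernel_op \<mu> A p = inverse (real n) * (\<Sum>k<n. (kernel_op \<mu> ^^ Suc k) f p)"
      proof -
        have "A = (\<lambda>q. inverse (real n) * (\<Sum>k<n. (kernel_op \<mu> ^^ k) f q))"
          by (simp add: A_def ergodic_mean_def fun_eq_iff divide_inverse)
        then show ?thesis
          by (simp add: kernel_op_cmult kernel_op_sum continuous_kernel_op_pow f)
      qed
      moreover have "A p = inverse (real n) * (\<Sum>k<n. (kernel_op \<mu> ^^ k) f p)"
        by (simp add: A_def ergodic_mean_def divide_inverse)
      ultimately have "kernel_op \<mu> A p - A p = inverse (real n) * (\<Sum>k<n. (kernel_op \<mu> ^^ Suc k) f p - (kernel_op \<mu> ^^ k) f p)"
        by (simp add: sum_subtractf right_diff_distrib)
      also have "\<dots> = inverse (real n) * ((kernel_op \<mu> ^^ n) f p - f p)"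
        by (subst sum_lessThan_telescope) simp
      finally have eq: "kernel_op \<mu> A p - A p = inverse (real n) * ((kernel_op \<mu> ^^ n) f p - f p)" .
      have "\<bar>(kernel_op \<mu> ^^ n) f p - f p\<bar> \<le> 2 * M"
        using kernel_op_pow_bound[OF f M(2), of n p] M(2)[of p] by linarith
      then have "\<bar>kernel_op \<mu> A p - A p\<bar> \<le> inverse (real n) * (2 * M)"
        unfolding eq abs_mult by (intro mult_mono) auto
      also have "\<dots> = 2 * M / real n" by (rule divide_inverse_commute[symmetric])
      also have "\<dots> \<le> e / 3" by (rule n(1))
      finally have 1: "\<bar>kernel_op \<mu> A p - A p\<bar> \<le> e / 3" .
      have "continuous_on UNIV (\<lambda>q. A q - G q)" by (intro continuous_on_diff A G)
      then have "\<bar>kernel_op \<mu> (\<lambda>q. A q - G q) p\<bar> \<le> e / 3"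
        by (rule kernel_op_bound) (rule AG)
      then have "\<bar>kernel_op \<mu> A p - kernel_op \<mu> G p\<bar> \<le> e / 3"
        by (simp add: kernel_op_diff A G)
      with 1 AG[of p] show ?thesis by linarith
    qed
    then have "kernel_op \<mu> G p - G p = 0" by (rule real_eq_zero_if_small)
    then show ?thesis by simp
  qed
  define c where "c = G undefined"
  have c: "G p = c" for p
    unfolding c_def by (rule harmonic_constant[OF pur erg G harm])
  have int_mean: "(\<integral> p. ergodic_mean (m n) f p \<partial>\<nu>) = (\<integral> p. f p \<partial>\<nu>)" for n
    unfolding ergodic_mean_def
    by (simp add: integral_kernel_op_pow[OF inv f] m_def
        integrable_invariant[OF inv continuous_kernel_op_pow[OF f]] del: sum.lessThan_Suc)
  have close: "\<exists>N. \<forall>n\<ge>N. \<forall>p. \<bar>ergodic_mean (m n) f p - c\<bar> < e" if "e > 0" for e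
    using conv[OF that] by (simp add: c)
  have "\<bar>(\<integral> p. f p \<partial>\<nu>) - c\<bar> \<le> e" if e: "e > 0" for e
  proof -
    obtain n where n: "\<And>p. \<bar>ergodic_mean (m n) f p - c\<bar> < e" using close[OF e] by blast
    have int: "integrable \<nu> (\<lambda>p. ergodic_mean (m n) f p - c)"
      by (intro integrable_invariant[OF inv] continuous_intros continuous_ergodic_mean f)
    have "(\<integral> p. f p \<partial>\<nu>) - c = (\<integral> p. ergodic_mean (m n) f p - c \<partial>\<nu>)"
      using integrable_invariant[OF inv continuous_ergodic_mean[OF f, of "m n"]]
      by (simp add: int_mean prob_space)
    also have "\<bar>\<dots>\<bar> \<le> (\<integral> p. \<bar>ergodic_mean (m n) f p - c\<bar> \<partial>\<nu>)"
      by (rule integral_abs_bound)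
    also have "\<dots> \<le> (\<integral> p. e \<partial>\<nu>)"
      using int by (intro integral_mono integrable_abs) (auto intro: less_imp_le n)
    finally show ?thesis by (simp add: prob_space)
  qed
  then have "(\<integral> p. f p \<partial>\<nu>) - c = 0" by (rule real_eq_zero_if_small)
  then have fc: "(\<integral> p. f p \<partial>\<nu>) = c" by simp
  obtain n where "\<And>p. \<bar>ergodic_mean (m n) f p - c\<bar> < \<delta>" using close[OF \<open>\<delta> > 0\<close>] by blast
  then show ?thesis
    by (intro that[of "m n"]) (auto simp: fc m_def intro: less_imp_le)
qed

end

section \<open>The measure on trajectories\<close>

text \<open>Products of matrices are unfolded at the last factor only, and only by explicit request.\<close>

declare W.simps(2) [simp del]

context stochastic_matrices
begin

definition path_law :: "'d cproj \<Rightarrow> nat \<Rightarrow> (nat \<Rightarrow> complex ^ 'd ^ 'd) measure" where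
  "path_law p n = density (nz_power n) (\<lambda>\<omega>. ennreal ((norm (W n \<omega> *v urep p))\<^sup>2))"

lemma sets_path_law [measurable_cong, simp]: "sets (path_law p n) = sets (PiM {..<n} (\<lambda>_. borel))"
  by (simp add: path_law_def sets_PiM_nonzero)

lemma measurable_W_cont:
  assumes "continuous_on UNIV h" "{..<n} \<subseteq> I"
  shows "(\<lambda>\<omega>. h (W n \<omega>)) \<in> borel_measurable (PiM I (\<lambda>_. nonzero_part))"
    "(\<lambda>\<omega>. h (W n \<omega>)) \<in> borel_measurable (PiM I (\<lambda>_. borel))"
  using measurable_compose[OF _ borel_measurable_continuous_onI[OF assms(1)]]
    measurable_W[OF _ assms(2), of nonzero_part] measurable_W[OF _ assms(2), of borel] by auto

lemma measurable_path_density: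
  assumes "{..<n} \<subseteq> I"
  shows "(\<lambda>\<omega>. ennreal ((norm (W n \<omega> *v x))\<^sup>2)) \<in> borel_measurable (PiM I (\<lambda>_. nonzero_part))"
    "(\<lambda>\<omega>. ennreal ((norm (W n \<omega> *v x))\<^sup>2)) \<in> borel_measurable (PiM I (\<lambda>_. borel))"
proof -
  have "continuous_on UNIV (\<lambda>w. (norm (w *v x))\<^sup>2)"
    by (intro continuous_intros continuous_mult_vec)
  note measurable_W_cont[OF this assms]
  then show "(\<lambda>\<omega>. ennreal ((norm (W n \<omega> *v x))\<^sup>2)) \<in> borel_measurable (PiM I (\<lambda>_. nonzero_part))"
    "(\<lambda>\<omega>. ennreal ((norm (W n \<omega> *v x))\<^sup>2)) \<in> borel_measurable (PiM I (\<lambda>_. borel))"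
    by (auto intro: measurable_compose[OF _ measurable_ennreal])
qed

lemma nn_integral_path_law:
  assumes "f \<in> borel_measurable (PiM {..<n} (\<lambda>_. borel))"
  shows "(\<integral>\<^sup>+ \<omega>. f \<omega> \<partial>path_law p n) =
    (\<integral>\<^sup>+ \<omega>. ennreal ((norm (W n \<omega> *v urep p))\<^sup>2) * f \<omega> \<partial>nz_power n)"
  unfolding path_law_def
  by (rule nn_integral_density) (use assms measurable_path_density in \<open>auto simp: measurable_cong_sets[OF sets_PiM_nonzero refl]\<close>)

lemma nn_integral_last_matrix:
  assumes f: "f \<in> borel_measurable (nz_power (Suc n))"
  shows "(\<integral>\<^sup>+ \<omega>. f \<omega> \<partial>nz_power (Suc n)) =
    (\<integral>\<^sup>+ \<omega>. (\<integral>\<^sup>+ v. f (fun_upd \<omega> n v) \<partial>nonzero_part) \<partial>nz_power n)"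
  using f unfolding lessThan_Suc by (intro nz.product_nn_integral_insert) auto

lemma nn_integral_norm_nonzero: "(\<integral>\<^sup>+ v. ennreal ((norm (v *v x))\<^sup>2) \<partial>nonzero_part) = ennreal ((norm x)\<^sup>2)"
proof -
  have "(\<integral>\<^sup>+ v. ennreal ((norm (v *v x))\<^sup>2) \<partial>nonzero_part) = (\<integral>\<^sup>+ v. ennreal ((norm (v *v x))\<^sup>2) \<partial>\<mu>)"
    by (rule nn_integral_nonzero_part)
      (auto intro!: measurable_compose[OF _ measurable_ennreal] borel_measurable_continuous_onI continuous_intros continuous_mult_vec)
  also have "\<dots> = ennreal ((norm x)\<^sup>2)"
    by (subst nn_integral_eq_integral) (simp_all add: has_integral_norm)
  finally show ?thesis .
qed

text \<open>The laws of the first matrices are consistent because averaging the squared norm over the last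
  matrix removes this matrix.\<close>

lemma path_law_restrict_Suc:
  "distr (path_law p (Suc n)) (PiM {..<n} (\<lambda>_. borel)) (\<lambda>\<omega>. restrict \<omega> {..<n}) = path_law p n"
proof (rule measure_eqI)
  fix A assume "A \<in> sets (distr (path_law p (Suc n)) (PiM {..<n} (\<lambda>_. borel)) (\<lambda>\<omega>. restrict \<omega> {..<n}))"
  then have A: "A \<in> sets (PiM {..<n} (\<lambda>_. borel))" by simp
  have res: "(\<lambda>\<omega>. restrict \<omega> {..<n}) \<in> PiM {..<Suc n} (\<lambda>_. borel) \<rightarrow>\<^sub>M PiM {..<n} (\<lambda>_. borel :: (complex ^ 'd ^ 'd) measure)"
    by (intro measurable_restrict_subset) auto
  have indA: "(indicator A :: _ \<Rightarrow> ennreal) \<in> borel_measurable (PiM {..<n} (\<lambda>_. borel))"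
    using A by measurable
  have indr: "(\<lambda>\<omega>. indicator A (restrict \<omega> {..<n}) :: ennreal) \<in> borel_measurable (PiM {..<Suc n} (\<lambda>_. borel))"
    by (rule measurable_compose[OF res indA])
  have "emeasure (distr (path_law p (Suc n)) (PiM {..<n} (\<lambda>_. borel)) (\<lambda>\<omega>. restrict \<omega> {..<n})) A =
    (\<integral>\<^sup>+ \<omega>. indicator A \<omega> \<partial>distr (path_law p (Suc n)) (PiM {..<n} (\<lambda>_. borel)) (\<lambda>\<omega>. restrict \<omega> {..<n}))"
    using A by simp
  also have "\<dots> = (\<integral>\<^sup>+ \<omega>. indicator A (restrict \<omega> {..<n}) \<partial>path_law p (Suc n))"
    by (rule nn_integral_distr) (use res indA in \<open>auto simp: measurable_cong_sets[OF sets_path_law refl]\<close>)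
  also have "\<dots> = (\<integral>\<^sup>+ \<omega>. ennreal ((norm (W (Suc n) \<omega> *v urep p))\<^sup>2) * indicator A (restrict \<omega> {..<n}) \<partial>nz_power (Suc n))"
    by (rule nn_integral_path_law[OF indr])
  also have "\<dots> = (\<integral>\<^sup>+ \<omega>. (\<integral>\<^sup>+ v. ennreal ((norm (W (Suc n) (fun_upd \<omega> n v) *v urep p))\<^sup>2) *
      indicator A (restrict (fun_upd \<omega> n v) {..<n}) \<partial>nonzero_part) \<partial>nz_power n)"
    using indr measurable_path_density(1)[OF order_refl]
    by (intro nn_integral_last_matrix borel_measurable_times_ennreal) (auto simp: measurable_cong_sets[OF sets_PiM_nonzero refl])
  also have "\<dots> = (\<integral>\<^sup>+ \<omega>. ennreal ((norm (W n \<omega> *v urep p))\<^sup>2) * indicator A \<omega> \<partial>nz_power n)"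
  proof (rule nn_integral_cong)
    fix \<omega> assume "\<omega> \<in> space (nz_power n)"
    then have "\<omega> \<in> extensional {..<n}" by (auto simp: space_PiM PiE_def)
    then have eq: "restrict (fun_upd \<omega> n v) {..<n} = \<omega>" for v
      by (auto simp: restrict_def extensional_def fun_eq_iff)
    have "(\<lambda>v. ennreal ((norm (v *v (W n \<omega> *v urep p)))\<^sup>2)) \<in> borel_measurable nonzero_part"
      unfolding measurable_cong_sets[OF sets_nonzero_part refl]
      by (intro measurable_compose[OF _ measurable_ennreal] borel_measurable_continuous_onI continuous_intros continuous_mult_vec)
    then show "(\<integral>\<^sup>+ v. ennreal ((norm (W (Suc n) (fun_upd \<omega> n v) *v urep p))\<^sup>2) *
        indicator A (restrict (fun_upd \<omega> n v) {..<n}) \<partial>nonzero_part) =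
      ennreal ((norm (W n \<omega> *v urep p))\<^sup>2) * indicator A \<omega>"
      by (simp only: W_fun_upd matrix_vector_mul_assoc[symmetric] eq nn_integral_multc nn_integral_norm_nonzero)
  qed
  also have "\<dots> = (\<integral>\<^sup>+ \<omega>. indicator A \<omega> \<partial>path_law p n)"
    by (rule nn_integral_path_law[OF indA, symmetric])
  also have "\<dots> = emeasure (path_law p n) A" using A by simp
  finally show "emeasure (distr (path_law p (Suc n)) (PiM {..<n} (\<lambda>_. borel)) (\<lambda>\<omega>. restrict \<omega> {..<n})) A = emeasure (path_law p n) A" .
qed simp

lemma measurable_restrict_path:
  "J \<subseteq> {..<n} \<Longrightarrow> (\<lambda>\<omega>. restrict \<omega> J) \<in> path_law p n \<rightarrow>\<^sub>M PiM J (\<lambda>_. borel)"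
  unfolding measurable_cong_sets[OF sets_path_law refl] by (rule measurable_restrict_subset)

lemma space_path_law: "space (path_law p n) = extensional {..<n}"
  using sets_eq_imp_space_eq[OF sets_path_law, of p n] by (simp add: space_PiM PiE_def)

lemma restrict_comp: "J \<subseteq> K \<Longrightarrow> (\<lambda>\<omega>. restrict \<omega> J) \<circ> (\<lambda>\<omega>. restrict \<omega> K) = (\<lambda>\<omega>. restrict \<omega> J)"
  by (auto simp: fun_eq_iff restrict_def)

lemma path_law_restrict:
  assumes "m \<le> n"
  shows "distr (path_law p n) (PiM {..<m} (\<lambda>_. borel)) (\<lambda>\<omega>. restrict \<omega> {..<m}) = path_law p m"
  using assms
proof (induction n rule: dec_induct)
  case base
  have "distr (path_law p m) (PiM {..<m} (\<lambda>_. borel)) (\<lambda>\<omega>. restrict \<omega> {..<m}) = distr (path_law p m) (path_law p m) (\<lambda>\<omega>. \<omega>)"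
    by (rule distr_cong) (auto simp: space_path_law extensional_restrict)
  also have "\<dots> = path_law p m" by (simp add: distr_id2)
  finally show ?case .
next
  case (step n)
  have "distr (path_law p (Suc n)) (PiM {..<m} (\<lambda>_. borel)) ((\<lambda>\<omega>. restrict \<omega> {..<m}) \<circ> (\<lambda>\<omega>. restrict \<omega> {..<n}))
      = distr (distr (path_law p (Suc n)) (PiM {..<n} (\<lambda>_. borel)) (\<lambda>\<omega>. restrict \<omega> {..<n})) (PiM {..<m} (\<lambda>_. borel)) (\<lambda>\<omega>. restrict \<omega> {..<m})"
    using step.hyps by (intro distr_distr[symmetric] measurable_restrict_subset measurable_restrict_path) auto
  also have "\<dots> = path_law p m"
    by (simp only: path_law_restrict_Suc step.IH)
  moreover have "{..<m} \<subseteq> {..<n}" using step.hyps by auto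
  ultimately show ?case by (simp only: restrict_comp)
qed

lemma prob_space_path_law: "prob_space (path_law p n)"
proof (rule prob_spaceI)
  have one: "(\<lambda>_. 1 :: ennreal) \<in> borel_measurable (PiM {..<k} (\<lambda>_. borel :: (complex ^ 'd ^ 'd) measure))" for k
    by simp
  have "emeasure (path_law p n) (space (path_law p n)) = (\<integral>\<^sup>+ \<omega>. 1 \<partial>path_law p n)"
    by simp
  also have "\<dots> = (\<integral>\<^sup>+ \<omega>. ennreal ((norm (W n \<omega> *v urep p))\<^sup>2) * 1 \<partial>nz_power n)"
    by (rule nn_integral_path_law[OF one])
  also have "\<dots> = 1"
  proof (induction n)
    case 0
    then show ?case by (simp add: PiM_empty nn_integral_count_space_finite)
  next
    case (Suc n)
    have "(\<integral>\<^sup>+ \<omega>. ennreal ((norm (W (Suc n) \<omega> *v urep p))\<^sup>2) * 1 \<partial>nz_power (Suc n)) =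
      (\<integral>\<^sup>+ \<omega>. (\<integral>\<^sup>+ v. ennreal ((norm (W (Suc n) (fun_upd \<omega> n v) *v urep p))\<^sup>2) * 1 \<partial>nonzero_part) \<partial>nz_power n)"
      using measurable_path_density(1)[OF order_refl, of "Suc n"] by (intro nn_integral_last_matrix) simp
    also have "\<dots> = (\<integral>\<^sup>+ \<omega>. ennreal ((norm (W n \<omega> *v urep p))\<^sup>2) * 1 \<partial>nz_power n)"
      by (simp only: W_fun_upd matrix_vector_mul_assoc[symmetric] mult_1_right nn_integral_norm_nonzero)
    finally show ?case using Suc by simp
  qed
  finally show "emeasure (path_law p n) (space (path_law p n)) = 1" .
qed

abbreviation path_space :: "(nat \<Rightarrow> complex ^ 'd ^ 'd) measure" where
  "path_space \<equiv> PiM UNIV (\<lambda>_. borel)"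

text \<open>Kolmogorov's extension theorem. A finite set of coordinates is embedded in an initial segment,
  and by consistency the marginal does not depend on the segment.\<close>

lemma ex_path_limit:
  "\<exists>L. prob_space L \<and> sets L = sets path_space \<and>
    (\<forall>n. \<forall>A\<in>sets (PiM {..<n} (\<lambda>_. borel)). emeasure L {\<omega>. restrict \<omega> {..<n} \<in> A} = emeasure (path_law p n) A)"
proof -
  define b where "b J = Suc (Max (insert 0 J))" for J :: "nat set"
  have b: "J \<subseteq> {..<b J}" if "finite J" for J
    using that by (auto simp: b_def less_Suc_eq_le)
  define P where "P J = distr (path_law p (b J)) (PiM J (\<lambda>_. borel)) (\<lambda>\<omega>. restrict \<omega> J)" for J
  have P_eq: "P J = distr (path_law p n) (PiM J (\<lambda>_. borel)) (\<lambda>\<omega>. restrict \<omega> J)" if "finite J" "J \<subseteq> {..<n}" for J n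
  proof -
    define m where "m = max n (b J)"
    have *: "distr (path_law p m) (PiM J (\<lambda>_. borel)) (\<lambda>\<omega>. restrict \<omega> J) = distr (path_law p k) (PiM J (\<lambda>_. borel)) (\<lambda>\<omega>. restrict \<omega> J)"
      if "J \<subseteq> {..<k}" "k \<le> m" for k
    proof -
      have "distr (path_law p k) (PiM J (\<lambda>_. borel)) (\<lambda>\<omega>. restrict \<omega> J) =
        distr (path_law p m) (PiM J (\<lambda>_. borel)) ((\<lambda>\<omega>. restrict \<omega> J) \<circ> (\<lambda>\<omega>. restrict \<omega> {..<k}))"
        unfolding path_law_restrict[OF that(2), symmetric]
        using that by (intro distr_distr measurable_restrict_subset measurable_restrict_path) auto
      then show ?thesis by (simp only: restrict_comp[OF that(1)])
    qed
    show ?thesis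
      using *[of n] *[of "b J"] that b by (simp add: m_def P_def)
  qed
  have prob_P: "prob_space (P J)" if "finite J" for J
    unfolding P_def
    by (rule prob_space.prob_space_distr[OF prob_space_path_law measurable_restrict_path[OF b[OF that]]])
  interpret polish_projective "UNIV :: nat set" P
  proof (intro polish_projective.intro projective_family.intro)
    fix J H :: "nat set" assume JH: "J \<subseteq> H" "finite H"
    have "P H = distr (path_law p (b H)) (PiM H (\<lambda>_. borel)) (\<lambda>\<omega>. restrict \<omega> H)" by (simp add: P_def)
    then have "distr (P H) (PiM J (\<lambda>_. borel)) (\<lambda>\<omega>. restrict \<omega> J) =
        distr (path_law p (b H)) (PiM J (\<lambda>_. borel)) ((\<lambda>\<omega>. restrict \<omega> J) \<circ> (\<lambda>\<omega>. restrict \<omega> H))"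
      using JH b by (simp only:) (intro distr_distr measurable_restrict_subset measurable_restrict_path; simp)
    also have "\<dots> = distr (path_law p (b H)) (PiM J (\<lambda>_. borel)) (\<lambda>\<omega>. restrict \<omega> J)"
      by (simp only: restrict_comp[OF JH(1)])
    also have "\<dots> = P J"
      using JH b[of H] by (intro P_eq[symmetric]) (auto intro: finite_subset)
    finally show "P J = distr (P H) (PiM J (\<lambda>_. borel)) (\<lambda>f. restrict f J)" by (rule sym)
  qed (rule prob_P)
  show ?thesis
  proof (intro exI[of _ lim] conjI allI ballI)
    fix n and A :: "(nat \<Rightarrow> complex ^ 'd ^ 'd) set" assume A: "A \<in> sets (PiM {..<n} (\<lambda>_. borel))"
    have "prod_emb UNIV (\<lambda>_. borel) {..<n} A = {\<omega>. restrict \<omega> {..<n} \<in> A}"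
      by (auto simp: prod_emb_def)
    then have "emeasure lim {\<omega>. restrict \<omega> {..<n} \<in> A} = emeasure (P {..<n}) A"
      using emeasure_lim_emb[of "{..<n}" A] A by simp
    also have "P {..<n} = path_law p n"
      using P_eq[of "{..<n}" n] path_law_restrict[of n n] by simp
    finally show "emeasure lim {\<omega>. restrict \<omega> {..<n} \<in> A} = emeasure (path_law p n) A" .
  qed (simp_all add: P.prob_space_axioms)
qed

definition path_limit :: "'d cproj \<Rightarrow> (nat \<Rightarrow> complex ^ 'd ^ 'd) measure" where
  "path_limit p = (SOME L. prob_space L \<and> sets L = sets path_space \<and>
    (\<forall>n. \<forall>A\<in>sets (PiM {..<n} (\<lambda>_. borel)). emeasure L {\<omega>. restrict \<omega> {..<n} \<in> A} = emeasure (path_law p n) A))"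

lemma path_limit:
  shows prob_space_path_limit: "prob_space (path_limit p)"
    and sets_path_limit [measurable_cong, simp]: "sets (path_limit p) = sets path_space"
    and emeasure_path_limit: "A \<in> sets (PiM {..<n} (\<lambda>_. borel)) \<Longrightarrow>
      emeasure (path_limit p) {\<omega>. restrict \<omega> {..<n} \<in> A} = emeasure (path_law p n) A"
  using someI_ex[OF ex_path_limit[of p]] unfolding path_limit_def by blast+

lemma space_path_limit [simp]: "space (path_limit p) = UNIV"
  using sets_eq_imp_space_eq[OF sets_path_limit] by (simp add: space_PiM)

lemma path_limit_unique:
  assumes L: "finite_measure L" "sets L = sets path_space"
    and eq: "\<And>n A. A \<in> sets (PiM {..<n} (\<lambda>_. borel)) \<Longrightarrow>
      emeasure L {\<omega>. restrict \<omega> {..<n} \<in> A} = emeasure (path_law p n) A"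
  shows "L = path_limit p"
proof (rule measure_eqI_PiM_infinite[OF L(2) sets_path_limit _ L(1)])
  fix A :: "nat \<Rightarrow> (complex ^ 'd ^ 'd) set" and J :: "nat set"
  assume J: "finite J" "\<And>i. i \<in> J \<Longrightarrow> A i \<in> sets borel"
  define n where "n = Suc (Max (insert 0 J))"
  have sub: "J \<subseteq> {..<n}" using J(1) by (auto simp: n_def less_Suc_eq_le)
  define B where "B = prod_emb {..<n} (\<lambda>_. borel) J (Pi\<^sub>E J A)"
  have B: "B \<in> sets (PiM {..<n} (\<lambda>_. borel))"
    unfolding B_def using J sub by (intro sets_PiM_I) auto
  have "prod_emb UNIV (\<lambda>_. borel) J (Pi\<^sub>E J A) = {\<omega>. restrict \<omega> {..<n} \<in> B}"
    using sub by (auto simp: B_def prod_emb_def Int_absorb1)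
  then show "emeasure L (prod_emb UNIV (\<lambda>_. borel) J (Pi\<^sub>E J A)) = emeasure (path_limit p) (prod_emb UNIV (\<lambda>_. borel) J (Pi\<^sub>E J A))"
    using eq[OF B] emeasure_path_limit[OF B] by simp
qed

text \<open>For a point mass the integral that prescribes the values of the path measure is a law of the
  first matrices. The point of this computation is the measurability in the initial point, which
  holds although the representatives are chosen arbitrarily.\<close>

lemma path_measure_rhs:
  assumes S: "S \<in> sets borel" and A: "A \<in> sets (PiM {..<n} (\<lambda>_. borel))"
  shows "(\<integral>\<^sup>+ q. indicator S q * (\<integral>\<^sup>+ \<omega>. indicator A \<omega> * ennreal ((norm (W n \<omega> *v urep q))\<^sup>2) \<partial>tensor_power \<mu> n) \<partial>return borel p) =
    indicator S p * emeasure (path_law p n) A"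
proof -
  have indA: "(indicator A :: _ \<Rightarrow> ennreal) \<in> borel_measurable (PiM {..<n} (\<lambda>_. borel))"
    using A by measurable
  have inner: "(\<integral>\<^sup>+ \<omega>. indicator A \<omega> * ennreal ((norm (W n \<omega> *v urep q))\<^sup>2) \<partial>tensor_power \<mu> n) =
    (\<integral>\<^sup>+ \<omega>. ennreal ((norm (W n \<omega> *v urep q))\<^sup>2) * indicator A \<omega> \<partial>nz_power n)" for q
  proof -
    have "(\<integral>\<^sup>+ \<omega>. indicator A \<omega> * ennreal ((norm (W n \<omega> *v urep q))\<^sup>2) \<partial>tensor_power \<mu> n) =
      (\<integral>\<^sup>+ \<omega>. indicator A \<omega> * ennreal ((norm (W n \<omega> *v urep q))\<^sup>2) \<partial>nz_power n)"
    proof (rule nn_integral_tensor_power)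
      show "indicator A \<omega> * ennreal ((norm (W n \<omega> *v urep q))\<^sup>2) = 0" if "i < n" "\<omega> i = 0" for i \<omega>
        using W_eq_zero[of i n \<omega>, OF that] by (simp add: zero_mult_vec)
    qed (rule borel_measurable_times_ennreal[OF indA measurable_path_density(2)[OF order_refl]])
    then show ?thesis by (simp add: mult.commute)
  qed
  have "(\<lambda>q. \<integral>\<^sup>+ \<omega>. ennreal ((norm (W n \<omega> *v urep q))\<^sup>2) * indicator A \<omega> \<partial>nz_power n) \<in> borel_measurable borel"
  proof -
    let ?M = "borel \<Otimes>\<^sub>M nz_power n"
    have "(\<lambda>z. W n (snd z)) \<in> ?M \<rightarrow>\<^sub>M borel"
      by (rule measurable_compose[OF measurable_snd measurable_W_nonzero]) simp
    moreover have "(\<lambda>z. line_proj (fst z)) \<in> ?M \<rightarrow>\<^sub>M borel"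
      by (rule measurable_compose[OF measurable_fst measurable_line_proj])
    ultimately have "(\<lambda>z. W n (snd z) ** line_proj (fst z) ** cadjoint (W n (snd z))) \<in> ?M \<rightarrow>\<^sub>M borel"
      by (rule measurable_conj)
    then have 1: "(\<lambda>z. ennreal ((norm (W n (snd z) *v urep (fst z)))\<^sup>2)) \<in> borel_measurable ?M"
      unfolding norm_mult_urep by measurable
    have 2: "(\<lambda>z. indicator A (snd z) :: ennreal) \<in> borel_measurable ?M"
      using measurable_compose[OF measurable_snd, of "indicator A :: _ \<Rightarrow> ennreal"] indA
      by (auto simp: measurable_cong_sets[OF sets_PiM_nonzero refl])
    have "(\<lambda>z. ennreal ((norm (W n (snd z) *v urep (fst z)))\<^sup>2) * indicator A (snd z)) \<in> borel_measurable ?M"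
      by (rule borel_measurable_times_ennreal[OF 1 2])
    from sigma_finite_measure.borel_measurable_nn_integral_fst[OF nz.sigma_finite this]
    show ?thesis by simp
  qed
  then have "(\<integral>\<^sup>+ q. indicator S q * (\<integral>\<^sup>+ \<omega>. indicator A \<omega> * ennreal ((norm (W n \<omega> *v urep q))\<^sup>2) \<partial>tensor_power \<mu> n) \<partial>return borel p) =
    indicator S p * (\<integral>\<^sup>+ \<omega>. ennreal ((norm (W n \<omega> *v urep p))\<^sup>2) * indicator A \<omega> \<partial>nz_power n)"
    unfolding inner using S by (intro nn_integral_return borel_measurable_times_ennreal) auto
  also have "\<dots> = indicator S p * emeasure (path_law p n) A"
    using nn_integral_path_law[OF indA, of p] A by simp
  finally show ?thesis .
qed

lemma cylinder_sets:
  assumes "A \<in> sets (PiM {..<n} (\<lambda>_. borel))"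
  shows "{\<omega>. restrict \<omega> {..<n} \<in> A} \<in> sets path_space"
proof -
  have "(\<lambda>\<omega>. restrict \<omega> {..<n}) \<in> path_space \<rightarrow>\<^sub>M PiM {..<n} (\<lambda>_. borel)"
    by (intro measurable_restrict_subset) auto
  from measurable_sets[OF this assms] show ?thesis by (simp add: vimage_def space_PiM)
qed

lemma is_path_measure_distr:
  "is_path_measure \<mu> (return borel p) (distr (path_limit p) (borel \<Otimes>\<^sub>M path_space) (\<lambda>\<omega>. (p, \<omega>)))"
  unfolding is_path_measure_def
proof (intro conjI allI ballI)
  have m: "(\<lambda>\<omega>. (p, \<omega>)) \<in> path_limit p \<rightarrow>\<^sub>M borel \<Otimes>\<^sub>M path_space" by measurable
  show "prob_space (distr (path_limit p) (borel \<Otimes>\<^sub>M path_space) (\<lambda>\<omega>. (p, \<omega>)))"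
    by (rule prob_space.prob_space_distr[OF prob_space_path_limit m])
  fix n S and A :: "(nat \<Rightarrow> complex ^ 'd ^ 'd) set"
  assume S: "S \<in> sets (borel :: 'd cproj measure)" and A: "A \<in> sets (PiM {..<n} (\<lambda>_. borel))"
  let ?C = "{\<omega>. restrict \<omega> {..<n} \<in> A}"
  have "emeasure (distr (path_limit p) (borel \<Otimes>\<^sub>M path_space) (\<lambda>\<omega>. (p, \<omega>))) (S \<times> ?C) =
    emeasure (path_limit p) ((\<lambda>\<omega>. (p, \<omega>)) -` (S \<times> ?C) \<inter> space (path_limit p))"
    using S cylinder_sets[OF A] by (intro emeasure_distr m) auto
  also have "(\<lambda>\<omega>. (p, \<omega>)) -` (S \<times> ?C) \<inter> space (path_limit p) = (if p \<in> S then ?C else {})"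
    by auto
  also have "emeasure (path_limit p) \<dots> = indicator S p * emeasure (path_law p n) A"
    by (simp add: emeasure_path_limit[OF A])
  finally show "emeasure (distr (path_limit p) (borel \<Otimes>\<^sub>M path_space) (\<lambda>\<omega>. (p, \<omega>))) (S \<times> ?C) =
    (\<integral>\<^sup>+ q. indicator S q * (\<integral>\<^sup>+ \<omega>. indicator A \<omega> * ennreal ((norm (W n \<omega> *v urep q))\<^sup>2) \<partial>tensor_power \<mu> n) \<partial>return borel p)"
    by (simp only: path_measure_rhs[OF S A])
qed simp

text \<open>The first coordinate is almost surely \<open>p\<close> and the law of the second one is determined by its
  cylinders, which fixes the values on all rectangles.\<close>

lemma path_measure_unique:
  assumes P: "is_path_measure \<mu> (return borel p) P"
  shows "P = distr (path_limit p) (borel \<Otimes>\<^sub>M path_space) (\<lambda>\<omega>. (p, \<omega>))"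
proof -
  interpret P: prob_space P using P by (simp add: is_path_measure_def)
  have sets_P [measurable_cong]: "sets P = sets (borel \<Otimes>\<^sub>M path_space)" using P by (simp add: is_path_measure_def)
  have space_P: "space P = UNIV"
    using sets_eq_imp_space_eq[OF sets_P] by (simp add: space_pair_measure space_PiM)
  have cyl: "emeasure P (S \<times> {\<omega>. restrict \<omega> {..<n} \<in> A}) = indicator S p * emeasure (path_law p n) A"
    if "S \<in> sets borel" "A \<in> sets (PiM {..<n} (\<lambda>_. borel))" for S n A
    using P path_measure_rhs[OF that] that unfolding is_path_measure_def by simp
  have m: "snd \<in> P \<rightarrow>\<^sub>M path_space" by measurable
  have "distr P path_space snd = path_limit p"
  proof (rule path_limit_unique)
    show "finite_measure (distr P path_space snd)" by (rule P.finite_measure_distr[OF m])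
    fix n and A :: "(nat \<Rightarrow> complex ^ 'd ^ 'd) set" assume A: "A \<in> sets (PiM {..<n} (\<lambda>_. borel))"
    have "snd -` {\<omega>. restrict \<omega> {..<n} \<in> A} \<inter> space P = UNIV \<times> {\<omega>. restrict \<omega> {..<n} \<in> A}"
      by (auto simp: space_P)
    then show "emeasure (distr P path_space snd) {\<omega>. restrict \<omega> {..<n} \<in> A} = emeasure (path_law p n) A"
      using cyl[OF _ A, of UNIV] by (simp add: emeasure_distr[OF m cylinder_sets[OF A]])
  qed simp
  then have snd: "emeasure P (UNIV \<times> B) = emeasure (path_limit p) B" if "B \<in> sets path_space" for B
  proof -
    have "emeasure (distr P path_space snd) B = emeasure P (snd -` B \<inter> space P)"
      using that by (intro emeasure_distr m)
    moreover have "snd -` B \<inter> space P = UNIV \<times> B" by (auto simp: space_P)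
    ultimately show ?thesis using \<open>distr P path_space snd = path_limit p\<close> by simp
  qed
  have fst: "emeasure P (S \<times> UNIV) = indicator S p" if "S \<in> sets borel" for S
  proof -
    let ?E = "space (PiM {..<0} (\<lambda>_. borel)) :: (nat \<Rightarrow> complex ^ 'd ^ 'd) set"
    have "{\<omega>. restrict \<omega> {..<0} \<in> ?E} = UNIV"
      by (auto simp: space_PiM restrict_def)
    moreover have "emeasure (path_law p 0) ?E = 1"
      using prob_space.emeasure_space_1[OF prob_space_path_law[of p 0]]
        sets_eq_imp_space_eq[OF sets_path_law[of p 0]] by simp
    ultimately show ?thesis
      using cyl[OF that sets.top, of 0] by simp
  qed
  have top_path: "(UNIV :: (nat \<Rightarrow> complex ^ 'd ^ 'd) set) \<in> sets path_space"
    using sets.top[of path_space] by (simp add: space_PiM)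
  have rect: "emeasure P (S \<times> B) = indicator S p * emeasure (path_limit p) B"
    if S: "S \<in> sets borel" and B: "B \<in> sets path_space" for S B
  proof (cases "p \<in> S")
    case True
    have "emeasure P ((- S) \<times> UNIV) = 0" using fst[of "- S"] S True by auto
    then have "emeasure P ((- S) \<times> B) = 0"
      by (rule emeasure_eq_0[rotated]) (use S top_path in \<open>auto simp: sets_P\<close>)
    moreover have "emeasure P (S \<times> B \<union> (- S) \<times> B) = emeasure P (S \<times> B) + emeasure P ((- S) \<times> B)"
      using S B by (intro plus_emeasure[symmetric]) (auto simp: sets_P)
    moreover have "S \<times> B \<union> (- S) \<times> B = UNIV \<times> B" by auto
    ultimately show ?thesis using snd[OF B] True by simp
  next
    case False
    then have "emeasure P (S \<times> UNIV) = 0" using fst[OF S] by simp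
    then have "emeasure P (S \<times> B) = 0"
      by (rule emeasure_eq_0[rotated]) (use S top_path in \<open>auto simp: sets_P\<close>)
    then show ?thesis using False by simp
  qed
  let ?G = "{S \<times> B | S B. S \<in> sets (borel :: 'd cproj measure) \<and> B \<in> sets path_space}"
  let ?P' = "distr (path_limit p) (borel \<Otimes>\<^sub>M path_space) (\<lambda>\<omega>. (p, \<omega>))"
  have m': "(\<lambda>\<omega>. (p, \<omega>)) \<in> path_limit p \<rightarrow>\<^sub>M borel \<Otimes>\<^sub>M path_space" by measurable
  show ?thesis
  proof (rule measure_eqI_generator_eq[OF Int_stable_pair_measure_generator, where \<Omega> = UNIV and A = "\<lambda>_. UNIV"])
    show "?G \<subseteq> Pow UNIV" by simp
    show "sets P = sigma_sets UNIV ?G" "sets ?P' = sigma_sets UNIV ?G"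
      by (simp_all add: sets_P sets_pair_measure space_PiM)
    show "range (\<lambda>_ :: nat. UNIV) \<subseteq> ?G"
      using top_path by (auto intro!: exI[of _ UNIV])
    show "emeasure P UNIV \<noteq> \<infinity>" using P.emeasure_space_1 by (simp add: space_P)
    fix X assume "X \<in> ?G"
    then obtain S B where X: "X = S \<times> B" "S \<in> sets (borel :: 'd cproj measure)" "B \<in> sets path_space" by blast
    have "emeasure ?P' X = emeasure (path_limit p) ((\<lambda>\<omega>. (p, \<omega>)) -` X \<inter> space (path_limit p))"
      using X by (intro emeasure_distr m') auto
    also have "(\<lambda>\<omega>. (p, \<omega>)) -` X \<inter> space (path_limit p) = (if p \<in> S then B else {})" using X by auto
    finally show "emeasure P X = emeasure ?P' X" using X rect by simp
  qed simp
qed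

lemma path_measure_at_eq:
  "path_measure_at \<mu> p = distr (path_limit p) (borel \<Otimes>\<^sub>M path_space) (\<lambda>\<omega>. (p, \<omega>))"
  unfolding path_measure_at_def path_measure_def
  using is_path_measure_distr path_measure_unique by (intro the_equality) auto

lemma prob_space_path_measure_at: "prob_space (path_measure_at \<mu> p)"
  using is_path_measure_distr[of p] by (simp add: path_measure_at_eq is_path_measure_def)

lemma sets_path_measure_at [measurable_cong]: "sets (path_measure_at \<mu> p) = sets (borel \<Otimes>\<^sub>M path_space)"
  by (simp add: path_measure_at_eq)

lemma measurable_chain: "chain n \<in> borel \<Otimes>\<^sub>M path_space \<rightarrow>\<^sub>M borel"
  unfolding chain_def
  by (intro measurable_act measurable_compose[OF measurable_snd measurable_W] measurable_fst) auto

lemma measurable_birkhoff_sum: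
  assumes "continuous_on UNIV g"
  shows "birkhoff_sum g n \<in> borel_measurable (path_measure_at \<mu> p)"
  unfolding measurable_cong_sets[OF sets_path_measure_at refl] birkhoff_sum_def
  by (intro borel_measurable_sum measurable_compose[OF measurable_chain borel_measurable_continuous_onI[OF assms]])

lemma nn_integral_path_measure_at:
  assumes f: "f \<in> borel_measurable (borel \<Otimes>\<^sub>M path_space)"
    and f': "f' \<in> borel_measurable (PiM {..<n} (\<lambda>_. borel))"
    and eq: "\<And>\<omega>. f (p, \<omega>) = f' (restrict \<omega> {..<n})"
  shows "(\<integral>\<^sup>+ \<xi>. f \<xi> \<partial>path_measure_at \<mu> p) =
    (\<integral>\<^sup>+ \<omega>. ennreal ((norm (W n \<omega> *v urep p))\<^sup>2) * f' \<omega> \<partial>nz_power n)"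
proof -
  have res: "(\<lambda>\<omega>. restrict \<omega> {..<n}) \<in> path_limit p \<rightarrow>\<^sub>M PiM {..<n} (\<lambda>_. borel)"
    unfolding measurable_cong_sets[OF sets_path_limit refl] by (intro measurable_restrict_subset) auto
  have law: "distr (path_limit p) (PiM {..<n} (\<lambda>_. borel)) (\<lambda>\<omega>. restrict \<omega> {..<n}) = path_law p n"
  proof (rule measure_eqI)
    fix A assume "A \<in> sets (distr (path_limit p) (PiM {..<n} (\<lambda>_. borel)) (\<lambda>\<omega>. restrict \<omega> {..<n}))"
    then have A: "A \<in> sets (PiM {..<n} (\<lambda>_. borel))" by simp
    show "emeasure (distr (path_limit p) (PiM {..<n} (\<lambda>_. borel)) (\<lambda>\<omega>. restrict \<omega> {..<n})) A = emeasure (path_law p n) A"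
      using emeasure_path_limit[OF A] by (simp add: emeasure_distr[OF res A] vimage_def)
  qed simp
  have "(\<integral>\<^sup>+ \<xi>. f \<xi> \<partial>path_measure_at \<mu> p) = (\<integral>\<^sup>+ \<omega>. f (p, \<omega>) \<partial>path_limit p)"
    unfolding path_measure_at_eq using f by (intro nn_integral_distr) measurable
  also have "\<dots> = (\<integral>\<^sup>+ \<omega>. f' (restrict \<omega> {..<n}) \<partial>path_limit p)" by (simp add: eq)
  also have "\<dots> = (\<integral>\<^sup>+ \<omega>. f' \<omega> \<partial>path_law p n)"
    unfolding law[symmetric] using f' by (intro nn_integral_distr[symmetric] res) simp
  also have "\<dots> = (\<integral>\<^sup>+ \<omega>. ennreal ((norm (W n \<omega> *v urep p))\<^sup>2) * f' \<omega> \<partial>nz_power n)"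
    by (rule nn_integral_path_law[OF f'])
  finally show ?thesis .
qed

section \<open>Exponential moments as iterates of a tilted operator\<close>

text \<open>Conditioning on the first \<open>n\<close> matrices and integrating the last one shows that exponential moments
  of Birkhoff sums are iterates of the Markov operator with the weight \<open>exp h\<close>. The Markov property
  of the chain enters in this form only.\<close>

definition tilted_op :: "('d cproj \<Rightarrow> real) \<Rightarrow> ('d cproj \<Rightarrow> real) \<Rightarrow> 'd cproj \<Rightarrow> real" where
  "tilted_op h f p = exp (h p) * kernel_op \<mu> f p"

lemma continuous_tilted_op:
  "continuous_on UNIV h \<Longrightarrow> continuous_on UNIV f \<Longrightarrow> continuous_on UNIV (tilted_op h f)"
  unfolding tilted_op_def by (intro continuous_intros continuous_kernel_op)

lemma kernel_op_nonneg: "(\<And>q. f q \<ge> 0) \<Longrightarrow> kernel_op \<mu> f p \<ge> 0"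
  unfolding kernel_op_def by (intro Bochner_Integration.integral_nonneg) simp

lemma measurable_lift_W:
  fixes x :: "complex ^ 'd"
  assumes "continuous_on UNIV f" "{..<n} \<subseteq> I"
  shows "(\<lambda>\<omega>. lift f (W n \<omega> *v x)) \<in> borel_measurable (PiM I (\<lambda>_. borel))"
  by (rule measurable_W_cont(2)[where h = "\<lambda>w. lift f (w *v x)", OF _ assms(2)])
    (rule continuous_on_compose2[OF quad_homog_cont[OF quad_homog_lift[OF assms(1)]] continuous_mult_vec], simp)

lemma measurable_act_W:
  assumes "{..<n} \<subseteq> I"
  shows "(\<lambda>\<omega>. act (W n \<omega>) p) \<in> PiM I (\<lambda>_. borel) \<rightarrow>\<^sub>M borel"
  by (intro measurable_act measurable_W assms) auto

lemma tilted_moment: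
  assumes h: "continuous_on UNIV h" and f: "continuous_on UNIV f" and nonneg: "\<And>q. f q \<ge> 0"
  shows "(\<integral>\<^sup>+ \<omega>. ennreal (exp (\<Sum>k<n. h (act (W k \<omega>) p)) * lift f (W n \<omega> *v urep p)) \<partial>nz_power n) =
    ennreal ((tilted_op h ^^ n) f p)"
  using f nonneg
proof (induction n arbitrary: f)
  case 0
  then show ?case by (simp add: PiM_empty nn_integral_count_space_finite)
next
  case (Suc n)
  have meas: "(\<lambda>\<omega>. ennreal (exp (\<Sum>k<Suc n. h (act (W k \<omega>) p)) * lift f (W (Suc n) \<omega> *v urep p)))
      \<in> borel_measurable (nz_power (Suc n))"
    unfolding measurable_cong_sets[OF sets_PiM_nonzero refl]
    by (intro measurable_compose[OF _ measurable_ennreal] borel_measurable_times measurable_lift_W Suc.prems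
        measurable_compose[OF _ borel_measurable_exp] borel_measurable_sum
        measurable_compose[OF measurable_act_W borel_measurable_continuous_onI[OF h]]) auto
  have W_upd: "W k (fun_upd \<omega> n v) = W k \<omega>" if "k \<le> n" for k \<omega> and v :: "complex ^ 'd ^ 'd"
    using that by (intro W_cong) auto
  have nonneg': "lift f x \<ge> 0" for x using Suc.prems by (simp add: lift_def)
  have last: "(\<integral>\<^sup>+ v. ennreal (lift f (v *v x)) \<partial>nonzero_part) = ennreal (lift (kernel_op \<mu> f) x)" for x
    using nn_integral_transfer[OF quad_homog_lift_fst[OF Suc.prems(1)], of "(x, 0)"] nonneg'
    by (simp add: transfer_lift pair_apply_def)
  have "(\<integral>\<^sup>+ \<omega>. ennreal (exp (\<Sum>k<Suc n. h (act (W k \<omega>) p)) * lift f (W (Suc n) \<omega> *v urep p)) \<partial>nz_power (Suc n)) =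
    (\<integral>\<^sup>+ \<omega>. (\<integral>\<^sup>+ v. ennreal (exp (\<Sum>k<Suc n. h (act (W k (fun_upd \<omega> n v)) p)) *
      lift f (W (Suc n) (fun_upd \<omega> n v) *v urep p)) \<partial>nonzero_part) \<partial>nz_power n)"
    by (rule nn_integral_last_matrix[OF meas])
  also have "\<dots> = (\<integral>\<^sup>+ \<omega>. ennreal (exp (\<Sum>k<n. h (act (W k \<omega>) p)) * lift (tilted_op h f) (W n \<omega> *v urep p)) \<partial>nz_power n)"
  proof (rule nn_integral_cong)
    fix \<omega> :: "nat \<Rightarrow> complex ^ 'd ^ 'd"
    let ?x = "W n \<omega> *v urep p"
    have m: "(\<lambda>v. ennreal (lift f (v *v ?x))) \<in> borel_measurable nonzero_part"
      unfolding measurable_cong_sets[OF sets_nonzero_part refl]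
      by (intro measurable_compose[OF _ measurable_ennreal] borel_measurable_continuous_onI
          continuous_on_compose2[OF quad_homog_cont[OF quad_homog_lift[OF Suc.prems(1)]] continuous_mult_vec]) auto
    have "(\<integral>\<^sup>+ v. ennreal (exp (\<Sum>k<Suc n. h (act (W k (fun_upd \<omega> n v)) p)) *
      lift f (W (Suc n) (fun_upd \<omega> n v) *v urep p)) \<partial>nonzero_part) =
      (\<integral>\<^sup>+ v. ennreal (exp (\<Sum>k<Suc n. h (act (W k \<omega>) p))) * ennreal (lift f (v *v ?x)) \<partial>nonzero_part)"
    proof -
      have "(\<Sum>k<Suc n. h (act (W k (fun_upd \<omega> n v)) p)) = (\<Sum>k<Suc n. h (act (W k \<omega>) p))" for v
        by (intro sum.cong refl) (simp add: W_upd)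
      then show ?thesis
        by (simp only: W_fun_upd matrix_vector_mul_assoc[symmetric] ennreal_mult[OF exp_ge_zero nonneg'])
    qed
    also have "\<dots> = ennreal (exp (\<Sum>k<Suc n. h (act (W k \<omega>) p))) * ennreal (lift (kernel_op \<mu> f) ?x)"
      by (subst nn_integral_cmult[OF m]) (simp only: last)
    also have "\<dots> = ennreal (exp (\<Sum>k<Suc n. h (act (W k \<omega>) p)) * lift (kernel_op \<mu> f) ?x)"
      using kernel_op_nonneg[of f] Suc.prems(2) by (intro ennreal_mult[symmetric]) (auto simp: lift_def)
    also have "exp (\<Sum>k<Suc n. h (act (W k \<omega>) p)) * lift (kernel_op \<mu> f) ?x =
        exp (\<Sum>k<n. h (act (W k \<omega>) p)) * lift (tilted_op h f) ?x"
      by (simp add: exp_add lift_def tilted_op_def act_def mult_ac)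
    finally show "(\<integral>\<^sup>+ v. ennreal (exp (\<Sum>k<Suc n. h (act (W k (fun_upd \<omega> n v)) p)) *
      lift f (W (Suc n) (fun_upd \<omega> n v) *v urep p)) \<partial>nonzero_part) =
      ennreal (exp (\<Sum>k<n. h (act (W k \<omega>) p)) * lift (tilted_op h f) ?x)" .
  qed
  also have "\<dots> = ennreal ((tilted_op h ^^ n) (tilted_op h f) p)"
    using Suc.prems kernel_op_nonneg[of f]
    by (intro Suc.IH continuous_tilted_op h) (auto simp: tilted_op_def)
  finally show ?case by (simp only: funpow_Suc_right o_def)
qed

lemma tilted_pow_nonneg: "(\<And>q. f q \<ge> 0) \<Longrightarrow> (tilted_op h ^^ n) f p \<ge> 0"
  by (induction n arbitrary: p) (auto simp: tilted_op_def intro!: mult_nonneg_nonneg kernel_op_nonneg)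

lemma exp_moment:
  assumes g: "continuous_on UNIV g"
  shows "integrable (path_measure_at \<mu> p) (\<lambda>\<xi>. exp (c * birkhoff_sum g n \<xi>))"
    "(\<integral> \<xi>. exp (c * birkhoff_sum g n \<xi>) \<partial>path_measure_at \<mu> p) = (tilted_op (\<lambda>q. c * g q) ^^ n) (\<lambda>_. 1) p"
proof -
  define h where "h q = c * g q" for q
  have h: "continuous_on UNIV h" unfolding h_def by (intro continuous_intros g)
  have meas: "(\<lambda>\<xi>. exp (c * birkhoff_sum g n \<xi>)) \<in> borel_measurable (path_measure_at \<mu> p)"
    using measurable_birkhoff_sum[OF g, of n p] by measurable
  have "(\<integral>\<^sup>+ \<xi>. ennreal (exp (c * birkhoff_sum g n \<xi>)) \<partial>path_measure_at \<mu> p) =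
    (\<integral>\<^sup>+ \<omega>. ennreal ((norm (W n \<omega> *v urep p))\<^sup>2) * ennreal (exp (\<Sum>k<n. h (act (W k \<omega>) p))) \<partial>nz_power n)"
  proof (rule nn_integral_path_measure_at)
    show "(\<lambda>\<xi>. ennreal (exp (c * birkhoff_sum g n \<xi>))) \<in> borel_measurable (borel \<Otimes>\<^sub>M path_space)"
      using meas unfolding measurable_cong_sets[OF sets_path_measure_at refl] by measurable
    show "(\<lambda>\<omega>. ennreal (exp (\<Sum>k<n. h (act (W k \<omega>) p)))) \<in> borel_measurable (PiM {..<n} (\<lambda>_. borel))"
      by (intro measurable_compose[OF _ measurable_ennreal] measurable_compose[OF _ borel_measurable_exp]
          borel_measurable_sum measurable_compose[OF measurable_act_W borel_measurable_continuous_onI[OF h]]) auto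
    fix \<omega> :: "nat \<Rightarrow> complex ^ 'd ^ 'd"
    have "W k (restrict \<omega> {..<n}) = W k \<omega>" if "k < n" for k
      using that by (intro W_cong) auto
    then have "(\<Sum>k<n. h (act (W k (restrict \<omega> {..<n})) p)) = (\<Sum>k<n. h (act (W k \<omega>) p))"
      by (intro sum.cong refl) (simp only: lessThan_iff)
    then show "ennreal (exp (c * birkhoff_sum g n (p, \<omega>))) =
        ennreal (exp (\<Sum>k<n. h (act (W k (restrict \<omega> {..<n})) p)))"
      by (simp only: birkhoff_sum_def chain_def h_def sum_distrib_left fst_conv snd_conv)
  qed
  also have "\<dots> = (\<integral>\<^sup>+ \<omega>. ennreal (exp (\<Sum>k<n. h (act (W k \<omega>) p)) * lift (\<lambda>_. 1) (W n \<omega> *v urep p)) \<partial>nz_power n)"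
    by (simp add: lift_def ennreal_mult mult.commute)
  also have "\<dots> = ennreal ((tilted_op h ^^ n) (\<lambda>_. 1) p)"
    by (rule tilted_moment[OF h]) auto
  finally have eq: "(\<integral>\<^sup>+ \<xi>. ennreal (exp (c * birkhoff_sum g n \<xi>)) \<partial>path_measure_at \<mu> p) = ennreal ((tilted_op h ^^ n) (\<lambda>_. 1) p)" .
  show "integrable (path_measure_at \<mu> p) (\<lambda>\<xi>. exp (c * birkhoff_sum g n \<xi>))"
    by (rule integrableI_nonneg[OF meas]) (simp_all add: eq)
  show "(\<integral> \<xi>. exp (c * birkhoff_sum g n \<xi>) \<partial>path_measure_at \<mu> p) = (tilted_op (\<lambda>q. c * g q) ^^ n) (\<lambda>_. 1) p"
    using eq tilted_pow_nonneg[where f = "\<lambda>_. 1" and h = h and n = n and p = p]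
    by (subst integral_eq_nn_integral[OF meas]) (auto simp: h_def[abs_def])
qed

end

section \<open>Asymptotics of the logarithmic moment generating function\<close>

lemma exp_second_order:
  fixes u :: real
  assumes "\<bar>u\<bar> \<le> 1"
  shows "\<bar>exp u - (1 + u + u\<^sup>2 / 2)\<bar> \<le> 2 * \<bar>u\<bar> ^ 3"
proof -
  have "\<bar>exp u - (\<Sum>k\<le>2. u ^ k / fact k)\<bar> \<le> exp \<bar>u\<bar> * \<bar>u\<bar> ^ Suc 2 / fact 2"
    using Taylor_exp_field[of u 2] by simp
  also have "(\<Sum>k\<le>2. u ^ k / fact k) = 1 + u + u\<^sup>2 / 2"
    by (simp add: numeral_2_eq_2)
  also have "exp \<bar>u\<bar> * \<bar>u\<bar> ^ Suc 2 / fact 2 \<le> 3 * \<bar>u\<bar> ^ Suc 2 / fact 2"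
  proof (intro divide_right_mono mult_right_mono)
    have "exp \<bar>u\<bar> \<le> exp 1" using assms by simp
    also have "\<dots> \<le> 3" by (rule exp_le)
    finally show "exp \<bar>u\<bar> \<le> 3" .
  qed auto
  also have "3 * \<bar>u\<bar> ^ Suc 2 / fact 2 \<le> 2 * \<bar>u\<bar> ^ 3"
  proof -
    have "Suc 2 = 3" "fact 2 = (2 :: real)" "\<bar>u\<bar> ^ 3 \<ge> 0" by simp_all
    then show ?thesis by simp
  qed
  finally show ?thesis by simp
qed

context stochastic_matrices
begin

text \<open>The exact Poisson equation for a continuous function need not be solvable, but the average of
  the partial sums of its iterates solves it up to an ergodic mean.\<close>

lemma approximate_poisson:
  assumes pur: "purifying \<mu>" and erg: "ergodic \<mu>" and inv: "invariant_prob \<mu> \<nu>"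
    and f: "continuous_on UNIV f" and "\<delta> > 0"
  obtains \<eta> where "continuous_on UNIV \<eta>" "\<And>p. \<bar>\<eta> p - kernel_op \<mu> \<eta> p - (f p - (\<integral> p. f p \<partial>\<nu>))\<bar> \<le> \<delta>"
proof -
  obtain m where m: "m > 0" "\<And>p. \<bar>ergodic_mean m f p - (\<integral> p. f p \<partial>\<nu>)\<bar> \<le> \<delta>"
    using ergodic_mean_converges[OF assms] by blast
  define B where "B j p = (\<Sum>k<j. (kernel_op \<mu> ^^ k) f p)" for j p
  have contB: "continuous_on UNIV (B j)" for j
    unfolding B_def by (intro continuous_on_sum continuous_kernel_op_pow f)
  define \<eta> where "\<eta> p = inverse (real m) * (\<Sum>j<m. B j p)" for p
  have cont: "continuous_on UNIV \<eta>"
    unfolding \<eta>_def by (intro continuous_on_mult continuous_on_const continuous_on_sum contB)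
  have PB: "kernel_op \<mu> (B j) p = B j p - f p + (kernel_op \<mu> ^^ j) f p" for j p
  proof -
    have "kernel_op \<mu> (B j) p = (\<Sum>k<j. (kernel_op \<mu> ^^ Suc k) f p)"
      unfolding B_def by (subst kernel_op_sum) (simp_all add: continuous_kernel_op_pow f)
    also have "\<dots> = B j p + (\<Sum>k<j. (kernel_op \<mu> ^^ Suc k) f p - (kernel_op \<mu> ^^ k) f p)"
      by (simp add: B_def sum_subtractf)
    also have "\<dots> = B j p - f p + (kernel_op \<mu> ^^ j) f p"
      by (subst sum_lessThan_telescope) simp
    finally show ?thesis .
  qed
  have "kernel_op \<mu> \<eta> p = inverse (real m) * (\<Sum>j<m. kernel_op \<mu> (B j) p)" for p
    unfolding \<eta>_def using contB by (simp add: kernel_op_cmult kernel_op_sum)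
  then have "\<eta> p - kernel_op \<mu> \<eta> p = f p - ergodic_mean m f p" for p
    using m(1) by (simp add: \<eta>_def PB sum.distrib sum_subtractf ergodic_mean_def field_simps)
  then have "\<eta> p - kernel_op \<mu> \<eta> p - (f p - (\<integral> p. f p \<partial>\<nu>)) = - (ergodic_mean m f p - (\<integral> p. f p \<partial>\<nu>))" for p
    by simp
  then show ?thesis
    using cont m(2) by (intro that[of \<eta>]) (simp_all only: abs_minus_cancel)
qed

text \<open>The variance of \<open>f\<close> at the next position of the chain. By invariance its mean is the
  asymptotic variance.\<close>

definition cond_var :: "('d cproj \<Rightarrow> real) \<Rightarrow> 'd cproj \<Rightarrow> real" where
  "cond_var f p = kernel_op \<mu> (\<lambda>q. (f q)\<^sup>2) p - (kernel_op \<mu> f p)\<^sup>2"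

lemma continuous_cond_var: "continuous_on UNIV f \<Longrightarrow> continuous_on UNIV (cond_var f)"
  unfolding cond_var_def by (intro continuous_intros continuous_kernel_op)

lemma cond_var_eq:
  assumes f: "continuous_on UNIV f"
  shows "kernel_op \<mu> (\<lambda>q. (f q - kernel_op \<mu> f p)\<^sup>2) p = cond_var f p"
proof -
  define m where "m = kernel_op \<mu> f p"
  have "kernel_op \<mu> (\<lambda>q. (f q - m)\<^sup>2) p = kernel_op \<mu> (\<lambda>q. (f q)\<^sup>2 + ((- 2 * m) * f q + m\<^sup>2)) p"
    by (rule arg_cong[where f = "\<lambda>h. kernel_op \<mu> h p"]) (simp add: fun_eq_iff power2_diff)
  also have "\<dots> = kernel_op \<mu> (\<lambda>q. (f q)\<^sup>2) p + (kernel_op \<mu> (\<lambda>q. (- 2 * m) * f q) p + m\<^sup>2)"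
    by (subst kernel_op_add, intro continuous_intros f, intro continuous_intros f,
        subst kernel_op_add, intro continuous_intros f, intro continuous_intros, simp only: kernel_op_const)
  also have "kernel_op \<mu> (\<lambda>q. (- 2 * m) * f q) p = (- 2 * m) * m"
    by (simp only: kernel_op_cmult m_def)
  finally show ?thesis by (simp add: cond_var_def m_def power2_eq_square)
qed

lemma cond_var_nonneg: "continuous_on UNIV f \<Longrightarrow> cond_var f p \<ge> 0"
  using cond_var_eq[of f p] kernel_op_nonneg[of "\<lambda>q. (f q - kernel_op \<mu> f p)\<^sup>2" p] by simp

lemma asymp_var_eq:
  assumes inv: "invariant_prob \<mu> \<nu>" and f: "continuous_on UNIV f"
  shows "asymp_var \<mu> \<nu> f = (\<integral> p. cond_var f p \<partial>\<nu>)"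
proof -
  have c: "continuous_on UNIV (\<lambda>q. (f q)\<^sup>2)" "continuous_on UNIV (\<lambda>q. (kernel_op \<mu> f q)\<^sup>2)"
    by (intro continuous_intros continuous_kernel_op f)+
  show ?thesis
    unfolding asymp_var_def cond_var_def
    using integrable_invariant[OF inv c(1)] integrable_invariant[OF inv c(2)]
      integrable_invariant[OF inv continuous_kernel_op[OF c(1)]] integral_kernel_op[OF inv c(1)]
    by simp
qed

lemma asymp_var_nonneg:
  assumes inv: "invariant_prob \<mu> \<nu>" and f: "continuous_on UNIV f"
  shows "asymp_var \<mu> \<nu> f \<ge> 0"
  unfolding asymp_var_eq[OF assms] using cond_var_nonneg[OF f] by (intro Bochner_Integration.integral_nonneg) simp

text \<open>Second order expansion of the mean of \<open>exp (c * f + c\<^sup>2 * \<eta>)\<close>, both functions being centred at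
  their conditional means. The terms linear in \<open>f\<close> and \<open>\<eta>\<close> disappear, and \<open>\<eta>\<close> only contributes
  at third order.\<close>

lemma kernel_op_exp_expansion:
  assumes f: "continuous_on UNIV f" and \<eta>: "continuous_on UNIV \<eta>"
  obtains R c0 where "R \<ge> 0" "c0 > 0"
    "\<And>c p. \<bar>c\<bar> \<le> c0 \<Longrightarrow> kernel_op \<mu> (\<lambda>q. exp (c * (f q - kernel_op \<mu> f p) + c\<^sup>2 * (\<eta> q - kernel_op \<mu> \<eta> p))) p > 0 \<and>
      \<bar>ln (kernel_op \<mu> (\<lambda>q. exp (c * (f q - kernel_op \<mu> f p) + c\<^sup>2 * (\<eta> q - kernel_op \<mu> \<eta> p))) p)
        - c\<^sup>2 / 2 * cond_var f p\<bar> \<le> R * \<bar>c\<bar> ^ 3"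
proof -
  obtain M1 where M1: "M1 > 0" "\<And>p. \<bar>f p\<bar> \<le> M1" using cproj_bounded[OF f] by blast
  obtain M2 where M2: "M2 > 0" "\<And>p. \<bar>\<eta> p\<bar> \<le> M2" using cproj_bounded[OF \<eta>] by blast
  define K where "K = 2 * M1 + 2 * M2 + 1"
  have K: "K \<ge> 1" using M1 M2 by (simp add: K_def)
  define R1 where "R1 = K\<^sup>2 + 2 * K ^ 3"
  define R2 where "R2 = K\<^sup>2 + R1"
  define c0 where "c0 = inverse (2 * R2)"
  have R1: "R1 \<ge> K\<^sup>2" "R1 \<ge> 0" using K by (auto simp: R1_def)
  have K2: "K\<^sup>2 \<ge> K" using K by (simp add: power2_eq_square)
  have R2: "R2 \<ge> K" "R2 \<ge> 1" using K K2 R1 by (auto simp: R2_def)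
  have c0: "c0 > 0" "c0 \<le> 1 / 2" "K * c0 \<le> 1" "R2 * c0 \<le> 1 / 2"
    using R2 K by (auto simp: c0_def field_simps)
  show ?thesis
  proof (rule that[of "R1 + 2 * R2\<^sup>2" c0])
    fix c :: real and p assume c: "\<bar>c\<bar> \<le> c0"
    have c1: "\<bar>c\<bar> \<le> 1" using c c0 by simp
    have csq: "c\<^sup>2 = \<bar>c\<bar> * \<bar>c\<bar>" by (simp add: power2_eq_square)
    have c2: "c\<^sup>2 \<le> \<bar>c\<bar>" unfolding csq using c1 mult_left_le[of "\<bar>c\<bar>" "\<bar>c\<bar>"] by simp
    have c3: "\<bar>c\<bar> ^ 3 = \<bar>c\<bar> * c\<^sup>2" by (simp add: csq eval_nat_numeral)
    define m where "m = kernel_op \<mu> f p"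
    define e where "e = kernel_op \<mu> \<eta> p"
    define a where "a q = f q - m" for q
    define b where "b q = \<eta> q - e" for q
    define u where "u q = c * a q + c\<^sup>2 * b q" for q
    have a: "\<bar>a q\<bar> \<le> 2 * M1" for q
      using M1(2)[of q] kernel_op_bound[OF f M1(2), of p] by (simp add: a_def m_def)
    have b: "\<bar>b q\<bar> \<le> 2 * M2" for q
      using M2(2)[of q] kernel_op_bound[OF \<eta> M2(2), of p] by (simp add: b_def e_def)
    have ca: "continuous_on UNIV a" unfolding a_def by (intro continuous_intros f)
    have cb: "continuous_on UNIV b" unfolding b_def by (intro continuous_intros \<eta>)
    have cu: "continuous_on UNIV u" unfolding u_def by (intro continuous_intros ca cb)
    have bK: "\<bar>c\<^sup>2 * b q\<bar> \<le> c\<^sup>2 * K" for q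
      unfolding abs_mult using b[of q] M1 by (intro mult_mono) (auto simp: K_def)
    have aK: "\<bar>c * a q\<bar> \<le> \<bar>c\<bar> * K" for q
      unfolding abs_mult using a[of q] M2 by (intro mult_left_mono) (auto simp: K_def)
    have uK: "\<bar>u q\<bar> \<le> \<bar>c\<bar> * K" for q
    proof -
      have "\<bar>u q\<bar> \<le> \<bar>c\<bar> * \<bar>a q\<bar> + c\<^sup>2 * \<bar>b q\<bar>"
        unfolding u_def by (rule order_trans[OF abs_triangle_ineq]) (simp add: abs_mult)
      also have "\<dots> \<le> \<bar>c\<bar> * (2 * M1) + \<bar>c\<bar> * (2 * M2)"
        using a b c2 by (intro add_mono mult_mono) auto
      also have "\<dots> \<le> \<bar>c\<bar> * K" by (simp add: K_def algebra_simps)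
      finally show ?thesis .
    qed
    have u1: "\<bar>u q\<bar> \<le> 1" for q
    proof -
      have "\<bar>c\<bar> * K \<le> c0 * K" using c K by (intro mult_right_mono) auto
      then show ?thesis using uK[of q] c0 by (simp add: mult.commute)
    qed
    have approx: "\<bar>exp (u q) - (1 + (u q + c\<^sup>2 / 2 * (a q)\<^sup>2))\<bar> \<le> R1 * \<bar>c\<bar> ^ 3" for q
    proof -
      have "\<bar>u q\<bar> ^ 3 \<le> (\<bar>c\<bar> * K) ^ 3" by (intro power_mono uK) auto
      then have 1: "\<bar>exp (u q) - (1 + u q + (u q)\<^sup>2 / 2)\<bar> \<le> 2 * K ^ 3 * \<bar>c\<bar> ^ 3"
        using exp_second_order[OF u1[of q]] by (simp add: power_mult_distrib mult_ac)
      have "(u q)\<^sup>2 - (c * a q)\<^sup>2 = (c\<^sup>2 * b q) * (u q + c * a q)"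
        by (simp add: u_def power2_eq_square algebra_simps)
      then have "\<bar>(u q)\<^sup>2 - (c * a q)\<^sup>2\<bar> = \<bar>c\<^sup>2 * b q\<bar> * \<bar>u q + c * a q\<bar>"
        by (simp only: abs_mult)
      also have "\<dots> \<le> (c\<^sup>2 * K) * (2 * (\<bar>c\<bar> * K))"
        using uK[of q] aK[of q] K by (intro mult_mono bK) auto
      also have "\<dots> = 2 * (K\<^sup>2 * \<bar>c\<bar> ^ 3)" by (simp add: c3 power2_eq_square[of K])
      finally have 2: "\<bar>(u q)\<^sup>2 - (c * a q)\<^sup>2\<bar> \<le> 2 * (K\<^sup>2 * \<bar>c\<bar> ^ 3)" .
      have 3: "c\<^sup>2 / 2 * (a q)\<^sup>2 = (c * a q)\<^sup>2 / 2" by (simp add: power_mult_distrib)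
      have 4: "R1 * \<bar>c\<bar> ^ 3 = K\<^sup>2 * \<bar>c\<bar> ^ 3 + 2 * K ^ 3 * \<bar>c\<bar> ^ 3" by (simp add: R1_def algebra_simps)
      show ?thesis using 1 2 unfolding 3 4 by (simp add: abs_le_iff)
    qed
    define E where "E = kernel_op \<mu> (\<lambda>q. exp (u q)) p"
    have cexp: "continuous_on UNIV (\<lambda>q. exp (u q))" by (intro continuous_intros cu)
    have cpoly: "continuous_on UNIV (\<lambda>q. 1 + (u q + c\<^sup>2 / 2 * (a q)\<^sup>2))"
      by (intro continuous_intros cu ca)
    have Ka: "kernel_op \<mu> a p = 0" "kernel_op \<mu> b p = 0"
      unfolding a_def b_def by (simp_all add: kernel_op_diff f \<eta> kernel_op_const m_def e_def)
    have Ku: "kernel_op \<mu> u p = 0"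
      unfolding u_def by (subst kernel_op_add) (auto intro!: continuous_intros ca cb simp: kernel_op_cmult Ka)
    have "kernel_op \<mu> (\<lambda>q. 1 + (u q + c\<^sup>2 / 2 * (a q)\<^sup>2)) p =
        1 + (kernel_op \<mu> u p + c\<^sup>2 / 2 * kernel_op \<mu> (\<lambda>q. (a q)\<^sup>2) p)"
      by (subst kernel_op_add, intro continuous_intros, intro continuous_intros cu ca,
          subst kernel_op_add, rule cu, intro continuous_intros ca, simp only: kernel_op_const kernel_op_cmult)
    also have "kernel_op \<mu> (\<lambda>q. (a q)\<^sup>2) p = cond_var f p"
      using cond_var_eq[OF f, of p] by (simp add: a_def m_def)
    finally have poly: "kernel_op \<mu> (\<lambda>q. 1 + (u q + c\<^sup>2 / 2 * (a q)\<^sup>2)) p = 1 + c\<^sup>2 / 2 * cond_var f p"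
      by (simp add: Ku)
    have "\<bar>kernel_op \<mu> (\<lambda>q. exp (u q) - (1 + (u q + c\<^sup>2 / 2 * (a q)\<^sup>2))) p\<bar> \<le> R1 * \<bar>c\<bar> ^ 3"
      by (intro kernel_op_bound approx continuous_on_diff cexp cpoly)
    then have E1: "\<bar>E - 1 - c\<^sup>2 / 2 * cond_var f p\<bar> \<le> R1 * \<bar>c\<bar> ^ 3"
      unfolding kernel_op_diff[OF cexp cpoly] poly E_def by (simp only: diff_diff_add)
    have "cond_var f p \<le> K\<^sup>2"
    proof -
      have "(a q)\<^sup>2 \<le> K\<^sup>2" for q
        using a[of q] M2 K by (intro abs_le_square_iff[THEN iffD1]) (auto simp: K_def)
      then have "kernel_op \<mu> (\<lambda>q. (a q)\<^sup>2) p \<le> kernel_op \<mu> (\<lambda>_. K\<^sup>2) p"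
        by (intro kernel_op_mono continuous_intros ca)
      then show ?thesis using cond_var_eq[OF f, of p] by (simp add: kernel_op_const a_def m_def)
    qed
    then have cv: "c\<^sup>2 / 2 * cond_var f p \<le> c\<^sup>2 * K\<^sup>2" "c\<^sup>2 / 2 * cond_var f p \<ge> 0"
      using cond_var_nonneg[OF f, of p] mult_mono[of "c\<^sup>2 / 2" "c\<^sup>2" "cond_var f p" "K\<^sup>2"] by auto
    have "R1 * \<bar>c\<bar> ^ 3 \<le> R1 * c\<^sup>2"
      using R1 c1 unfolding c3 by (intro mult_left_mono mult_left_le_one_le) auto
    then have "\<bar>E - 1\<bar> \<le> c\<^sup>2 * K\<^sup>2 + R1 * c\<^sup>2"
      using E1 cv unfolding abs_le_iff by linarith
    then have E2: "\<bar>E - 1\<bar> \<le> R2 * c\<^sup>2" by (simp add: R2_def algebra_simps)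
    have "R2 * c\<^sup>2 \<le> R2 * c0" using R2 c c2 by (intro mult_left_mono) auto
    then have E3: "\<bar>E - 1\<bar> \<le> 1 / 2" using E2 c0(4) by linarith
    then have pos: "E > 0" unfolding abs_le_iff by linarith
    have "\<bar>ln (1 + (E - 1)) - (E - 1)\<bar> \<le> 2 * (E - 1)\<^sup>2"
      using abs_ln_one_plus_x_minus_x_bound[OF E3] .
    also have "(E - 1)\<^sup>2 \<le> (R2 * c\<^sup>2)\<^sup>2"
      using E2 R2 by (intro abs_le_square_iff[THEN iffD1]) auto
    also have "(R2 * c\<^sup>2)\<^sup>2 = R2\<^sup>2 * (\<bar>c\<bar> ^ 3 * \<bar>c\<bar>)"
      by (simp add: c3 csq power2_eq_square)
    also have "R2\<^sup>2 * (\<bar>c\<bar> ^ 3 * \<bar>c\<bar>) \<le> R2\<^sup>2 * \<bar>c\<bar> ^ 3"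
      using c1 by (intro mult_left_mono mult_left_le) auto
    finally have "\<bar>ln E - (E - 1)\<bar> \<le> 2 * (R2\<^sup>2 * \<bar>c\<bar> ^ 3)" by simp
    then have "\<bar>ln E - c\<^sup>2 / 2 * cond_var f p\<bar> \<le> R1 * \<bar>c\<bar> ^ 3 + 2 * (R2\<^sup>2 * \<bar>c\<bar> ^ 3)"
      using E1 unfolding abs_le_iff by linarith
    then have "\<bar>ln E - c\<^sup>2 / 2 * cond_var f p\<bar> \<le> (R1 + 2 * R2\<^sup>2) * \<bar>c\<bar> ^ 3"
      by (simp add: algebra_simps)
    with pos show "kernel_op \<mu> (\<lambda>q. exp (c * (f q - kernel_op \<mu> f p) + c\<^sup>2 * (\<eta> q - kernel_op \<mu> \<eta> p))) p > 0 \<and>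
      \<bar>ln (kernel_op \<mu> (\<lambda>q. exp (c * (f q - kernel_op \<mu> f p) + c\<^sup>2 * (\<eta> q - kernel_op \<mu> \<eta> p))) p)
        - c\<^sup>2 / 2 * cond_var f p\<bar> \<le> (R1 + 2 * R2\<^sup>2) * \<bar>c\<bar> ^ 3"
      by (simp add: E_def u_def a_def b_def m_def e_def)
  qed (use R1 c0 in auto)
qed

lemma tilted_op_mono:
  assumes "continuous_on UNIV f" "continuous_on UNIV f'" "\<And>q. f q \<le> f' q"
  shows "tilted_op h f p \<le> tilted_op h f' p"
  unfolding tilted_op_def by (intro mult_left_mono kernel_op_mono assms) simp

lemma continuous_tilted_pow:
  "continuous_on UNIV h \<Longrightarrow> continuous_on UNIV f \<Longrightarrow> continuous_on UNIV ((tilted_op h ^^ n) f)"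
  by (induction n) (auto intro: continuous_tilted_op)

lemma tilted_op_cmult: "tilted_op h (\<lambda>q. r * f q) p = r * tilted_op h f p"
  by (simp add: tilted_op_def kernel_op_cmult)

text \<open>A positive function that the operator multiplies by at most \<open>r\<close> bounds the growth of all
  iterates, whatever the starting function; likewise from below.\<close>

lemma tilted_pow_le:
  assumes h: "continuous_on UNIV h" and f: "continuous_on UNIV f" and \<psi>: "continuous_on UNIV \<psi>"
    and "r \<ge> 0" and step: "\<And>q. tilted_op h \<psi> q \<le> r * \<psi> q" and start: "\<And>q. f q \<le> s * \<psi> q" and "s \<ge> 0"
  shows "(tilted_op h ^^ n) f p \<le> s * r ^ n * \<psi> p"
proof (induction n arbitrary: p)
  case (Suc n)
  have "(tilted_op h ^^ Suc n) f p \<le> tilted_op h (\<lambda>q. s * r ^ n * \<psi> q) p"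
    unfolding funpow.simps o_def
    by (intro tilted_op_mono continuous_tilted_pow h f continuous_intros \<psi> Suc)
  also have "\<dots> = s * r ^ n * tilted_op h \<psi> p" by (rule tilted_op_cmult)
  also have "\<dots> \<le> s * r ^ n * (r * \<psi> p)"
    using assms by (intro mult_left_mono step) auto
  finally show ?case by (simp add: mult_ac)
qed (simp add: start)

lemma tilted_pow_ge:
  assumes h: "continuous_on UNIV h" and f: "continuous_on UNIV f" and \<psi>: "continuous_on UNIV \<psi>"
    and "r \<ge> 0" and step: "\<And>q. r * \<psi> q \<le> tilted_op h \<psi> q" and start: "\<And>q. s * \<psi> q \<le> f q" and "s \<ge> 0"
  shows "s * r ^ n * \<psi> p \<le> (tilted_op h ^^ n) f p"
proof (induction n arbitrary: p)
  case (Suc n)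
  have "s * r ^ n * (r * \<psi> p) \<le> s * r ^ n * tilted_op h \<psi> p"
    using assms by (intro mult_left_mono step) auto
  also have "\<dots> = tilted_op h (\<lambda>q. s * r ^ n * \<psi> q) p" by (rule tilted_op_cmult[symmetric])
  also have "\<dots> \<le> (tilted_op h ^^ Suc n) f p"
    unfolding funpow.simps o_def
    by (intro tilted_op_mono continuous_tilted_pow h f continuous_intros \<psi> Suc)
  finally show ?case by (simp add: mult_ac)
qed (simp add: start)

text \<open>The function \<open>exp (c * gt + c\<^sup>2 * \<eta>)\<close> is an approximate eigenfunction of the tilted operator:
  the Poisson equation of \<open>g\<close> removes the first order in \<open>c\<close>, and the approximate Poisson equation
  of the conditional variance replaces this variance by its mean.\<close>

lemma log_moment_bound:
  assumes pur: "purifying \<mu>" and erg: "ergodic \<mu>" and inv: "invariant_prob \<mu> \<nu>"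
    and g: "continuous_on UNIV g" and gt: "continuous_on UNIV gt"
    and poisson: "\<And>p. gt p - kernel_op \<mu> gt p = g p" and "\<delta> > 0"
  obtains K c0 where "K \<ge> 0" "c0 > 0"
    "\<And>c n p. \<bar>c\<bar> \<le> c0 \<Longrightarrow>
      \<bar>ln (\<integral> \<xi>. exp (c * birkhoff_sum g n \<xi>) \<partial>path_measure_at \<mu> p) - real n * (c\<^sup>2 / 2 * asymp_var \<mu> \<nu> gt)\<bar>
        \<le> K * \<bar>c\<bar> + \<delta> * (real n * c\<^sup>2)"
proof -
  define \<sigma>2 where "\<sigma>2 = asymp_var \<mu> \<nu> gt"
  have \<sigma>2: "\<sigma>2 = (\<integral> p. cond_var gt p \<partial>\<nu>)" unfolding \<sigma>2_def by (rule asymp_var_eq[OF inv gt])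
  define f where "f p = cond_var gt p / 2" for p
  have f: "continuous_on UNIV f"
    unfolding f_def by (intro continuous_intros continuous_cond_var gt) simp
  have "\<delta> / 2 > 0" using \<open>\<delta> > 0\<close> by simp
  then obtain \<eta> where \<eta>: "continuous_on UNIV \<eta>"
    "\<And>p. \<bar>\<eta> p - kernel_op \<mu> \<eta> p - (f p - (\<integral> p. f p \<partial>\<nu>))\<bar> \<le> \<delta> / 2"
    using approximate_poisson[OF pur erg inv f] by blast
  have intf: "(\<integral> p. f p \<partial>\<nu>) = \<sigma>2 / 2" by (simp add: f_def \<sigma>2)
  obtain R c1 where R: "R \<ge> 0" "c1 > 0"
    "\<And>c p. \<bar>c\<bar> \<le> c1 \<Longrightarrow> kernel_op \<mu> (\<lambda>q. exp (c * (gt q - kernel_op \<mu> gt p) + c\<^sup>2 * (\<eta> q - kernel_op \<mu> \<eta> p))) p > 0 \<and>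
      \<bar>ln (kernel_op \<mu> (\<lambda>q. exp (c * (gt q - kernel_op \<mu> gt p) + c\<^sup>2 * (\<eta> q - kernel_op \<mu> \<eta> p))) p)
        - c\<^sup>2 / 2 * cond_var gt p\<bar> \<le> R * \<bar>c\<bar> ^ 3"
    using kernel_op_exp_expansion[OF gt \<eta>(1)] by blast
  obtain M1 where M1: "M1 > 0" "\<And>p. \<bar>gt p\<bar> \<le> M1" using cproj_bounded[OF gt] by blast
  obtain M2 where M2: "M2 > 0" "\<And>p. \<bar>\<eta> p\<bar> \<le> M2" using cproj_bounded[OF \<eta>(1)] by blast
  define c0 where "c0 = min 1 (min c1 (\<delta> / (2 * (R + 1))))"
  have c0: "c0 > 0" using R \<open>\<delta> > 0\<close> by (simp add: c0_def)
  define K where "K = M1 + M2"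
  show ?thesis
  proof (rule that[of "2 * K" c0])
    fix c :: real and n p assume c: "\<bar>c\<bar> \<le> c0"
    then have c_le: "\<bar>c\<bar> \<le> 1" "\<bar>c\<bar> \<le> c1" "\<bar>c\<bar> \<le> \<delta> / (2 * (R + 1))" by (simp_all add: c0_def)
    have csq: "c\<^sup>2 = \<bar>c\<bar> * \<bar>c\<bar>" by (simp add: power2_eq_square)
    have c2: "c\<^sup>2 \<le> \<bar>c\<bar>" unfolding csq using c_le(1) mult_left_le[of "\<bar>c\<bar>" "\<bar>c\<bar>"] by simp
    define \<phi> where "\<phi> q = c * gt q + c\<^sup>2 * \<eta> q" for q
    define \<psi> where "\<psi> q = exp (\<phi> q)" for q
    define h where "h q = c * g q" for q
    have h: "continuous_on UNIV h" unfolding h_def by (intro continuous_intros g)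
    have c\<psi>: "continuous_on UNIV \<psi>" unfolding \<psi>_def \<phi>_def by (intro continuous_intros gt \<eta>(1))
    have \<phi>K: "\<bar>\<phi> q\<bar> \<le> K * \<bar>c\<bar>" for q
    proof -
      have "\<bar>\<phi> q\<bar> \<le> \<bar>c\<bar> * \<bar>gt q\<bar> + c\<^sup>2 * \<bar>\<eta> q\<bar>"
        unfolding \<phi>_def by (rule order_trans[OF abs_triangle_ineq]) (simp add: abs_mult)
      also have "\<dots> \<le> \<bar>c\<bar> * M1 + \<bar>c\<bar> * M2"
        using M1 M2 c2 by (intro add_mono mult_mono) auto
      finally show ?thesis by (simp add: K_def algebra_simps)
    qed
    have step: "\<exists>r. tilted_op h \<psi> q = exp r * \<psi> q \<and> \<bar>r - c\<^sup>2 / 2 * \<sigma>2\<bar> \<le> \<delta> * c\<^sup>2" for q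
    proof -
      define m where "m = kernel_op \<mu> gt q"
      define e where "e = kernel_op \<mu> \<eta> q"
      define E where "E = kernel_op \<mu> (\<lambda>q'. exp (c * (gt q' - m) + c\<^sup>2 * (\<eta> q' - e))) q"
      have E: "E > 0" "\<bar>ln E - c\<^sup>2 / 2 * cond_var gt q\<bar> \<le> R * \<bar>c\<bar> ^ 3"
        using R(3)[OF c_le(2), of q] by (auto simp: E_def m_def e_def)
      have "\<psi> = (\<lambda>q'. exp (c * m + c\<^sup>2 * e) * exp (c * (gt q' - m) + c\<^sup>2 * (\<eta> q' - e)))"
        by (simp add: \<psi>_def \<phi>_def fun_eq_iff exp_add[symmetric] algebra_simps)
      then have "tilted_op h \<psi> q = exp (h q) * (exp (c * m + c\<^sup>2 * e) * E)"
        by (simp add: tilted_op_def kernel_op_cmult E_def)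
      also have "\<dots> = exp (h q + (c * m + c\<^sup>2 * e) + ln E)"
        using E(1) by (simp add: exp_add)
      also have "h q + (c * m + c\<^sup>2 * e) + ln E = (c\<^sup>2 * (e - \<eta> q) + ln E) + \<phi> q"
        using poisson[of q] by (simp add: h_def \<phi>_def m_def flip: poisson) (simp add: algebra_simps)
      also have "exp \<dots> = exp (c\<^sup>2 * (e - \<eta> q) + ln E) * \<psi> q"
        by (simp only: exp_add \<psi>_def)
      finally have eq: "tilted_op h \<psi> q = exp (c\<^sup>2 * (e - \<eta> q) + ln E) * \<psi> q" .
      have "\<bar>(e - \<eta> q) + (cond_var gt q / 2 - \<sigma>2 / 2)\<bar> \<le> \<delta> / 2"
        using \<eta>(2)[of q, unfolded intf] unfolding f_def e_def abs_le_iff by linarith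
      then have calc: "c\<^sup>2 * \<bar>(e - \<eta> q) + (cond_var gt q / 2 - \<sigma>2 / 2)\<bar> \<le> c\<^sup>2 * (\<delta> / 2)"
        by (rule mult_left_mono) simp
      have 1: "\<bar>c\<^sup>2 * (e - \<eta> q) + (c\<^sup>2 / 2 * cond_var gt q - c\<^sup>2 / 2 * \<sigma>2)\<bar> \<le> c\<^sup>2 * (\<delta> / 2)"
      proof -
        have "c\<^sup>2 * (e - \<eta> q) + (c\<^sup>2 / 2 * cond_var gt q - c\<^sup>2 / 2 * \<sigma>2) =
            c\<^sup>2 * ((e - \<eta> q) + (cond_var gt q / 2 - \<sigma>2 / 2))"
          by (simp add: algebra_simps)
        then show ?thesis using calc by (simp only: abs_mult abs_power2)
      qed
      have "R * \<bar>c\<bar> \<le> R * (\<delta> / (2 * (R + 1)))"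
        using c_le(3) R(1) by (rule mult_left_mono)
      also have "\<dots> \<le> \<delta> / 2" using R(1) \<open>\<delta> > 0\<close> by (simp add: field_simps)
      finally have "(R * \<bar>c\<bar>) * c\<^sup>2 \<le> \<delta> / 2 * c\<^sup>2" by (rule mult_right_mono) simp
      then have 2: "R * \<bar>c\<bar> ^ 3 \<le> c\<^sup>2 * (\<delta> / 2)" by (simp add: csq eval_nat_numeral mult_ac)
      have 3: "\<delta> * c\<^sup>2 = c\<^sup>2 * (\<delta> / 2) + c\<^sup>2 * (\<delta> / 2)" by simp
      have "\<bar>c\<^sup>2 * (e - \<eta> q) + ln E - c\<^sup>2 / 2 * \<sigma>2\<bar> \<le> \<delta> * c\<^sup>2"
        using E(2) 1 2 unfolding 3 abs_le_iff by linarith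
      with eq show ?thesis by blast
    qed
    define r1 where "r1 = c\<^sup>2 / 2 * \<sigma>2 - \<delta> * c\<^sup>2"
    define r2 where "r2 = c\<^sup>2 / 2 * \<sigma>2 + \<delta> * c\<^sup>2"
    have up: "tilted_op h \<psi> q \<le> exp r2 * \<psi> q" and low: "exp r1 * \<psi> q \<le> tilted_op h \<psi> q" for q
      using step[of q] by (auto simp: r1_def r2_def \<psi>_def abs_le_iff)
    have \<psi>_up: "\<psi> q \<le> exp (K * \<bar>c\<bar>)" and \<psi>_low: "exp (- (K * \<bar>c\<bar>)) \<le> \<psi> q" for q
      using \<phi>K[of q] by (auto simp: \<psi>_def abs_le_iff)
    define Z where "Z = (tilted_op h ^^ n) (\<lambda>_. 1) p"
    have Z: "(\<integral> \<xi>. exp (c * birkhoff_sum g n \<xi>) \<partial>path_measure_at \<mu> p) = Z"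
      using exp_moment(2)[OF g, of p c n] by (simp add: Z_def h_def[abs_def])
    have "1 \<le> exp (K * \<bar>c\<bar>) * \<psi> q" for q
      using mult_left_mono[OF \<psi>_low[of q], of "exp (K * \<bar>c\<bar>)"] by (simp add: exp_add[symmetric])
    then have "Z \<le> exp (K * \<bar>c\<bar>) * exp r2 ^ n * \<psi> p"
      unfolding Z_def by (intro tilted_pow_le h c\<psi> up) auto
    also have "\<dots> \<le> exp (K * \<bar>c\<bar>) * exp r2 ^ n * exp (K * \<bar>c\<bar>)"
      by (intro mult_left_mono \<psi>_up) simp
    also have "\<dots> = exp (2 * K * \<bar>c\<bar> + real n * r2)"
      by (simp add: exp_add exp_of_nat_mult mult_exp_exp)
    finally have Z_up: "Z \<le> exp (2 * K * \<bar>c\<bar> + real n * r2)" .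
    have "exp (- (K * \<bar>c\<bar>)) * \<psi> q \<le> 1" for q
      using mult_left_mono[OF \<psi>_up[of q], of "exp (- (K * \<bar>c\<bar>))"] by (simp add: exp_add[symmetric])
    then have "exp (- (K * \<bar>c\<bar>)) * exp r1 ^ n * \<psi> p \<le> Z"
      unfolding Z_def by (intro tilted_pow_ge h c\<psi> low) auto
    moreover have "exp (- (K * \<bar>c\<bar>)) * exp r1 ^ n * exp (- (K * \<bar>c\<bar>)) \<le> exp (- (K * \<bar>c\<bar>)) * exp r1 ^ n * \<psi> p"
      by (intro mult_left_mono \<psi>_low) simp
    moreover have "exp (- (K * \<bar>c\<bar>)) * exp r1 ^ n * exp (- (K * \<bar>c\<bar>)) = exp (- (2 * K * \<bar>c\<bar>) + real n * r1)"
      by (simp add: exp_of_nat_mult[symmetric] mult_exp_exp)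
    ultimately have Z_low: "exp (- (2 * K * \<bar>c\<bar>) + real n * r1) \<le> Z" by linarith
    have "Z > 0" using Z_low exp_gt_zero by (rule less_le_trans[rotated])
    then have "ln Z \<le> 2 * K * \<bar>c\<bar> + real n * r2" "- (2 * K * \<bar>c\<bar>) + real n * r1 \<le> ln Z"
      using Z_up Z_low ln_le_cancel_iff[of Z "exp (2 * K * \<bar>c\<bar> + real n * r2)"] ln_ge_iff[of Z] by auto
    then show "\<bar>ln (\<integral> \<xi>. exp (c * birkhoff_sum g n \<xi>) \<partial>path_measure_at \<mu> p) - real n * (c\<^sup>2 / 2 * asymp_var \<mu> \<nu> gt)\<bar>
        \<le> 2 * K * \<bar>c\<bar> + \<delta> * (real n * c\<^sup>2)"
      unfolding Z by (simp add: r1_def r2_def \<sigma>2_def[symmetric] abs_le_iff algebra_simps)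
  qed (use c0 M1 M2 in \<open>auto simp: K_def\<close>)
qed

end

section \<open>From exponential moments to moderate deviations\<close>

lemma rate_fun_eq:
  assumes "\<gamma>2 \<ge> 0"
  shows "rate_fun \<gamma>2 y = (if \<gamma>2 > 0 then ereal (y\<^sup>2 / (2 * \<gamma>2)) else if y = 0 then 0 else \<infinity>)"
proof (cases "\<gamma>2 > 0")
  case True
  have "y * v - \<gamma>2 * v\<^sup>2 / 2 \<le> y\<^sup>2 / (2 * \<gamma>2)" for v
  proof -
    have "0 \<le> (y - \<gamma>2 * v)\<^sup>2 / (2 * \<gamma>2)" using True by simp
    also have "\<dots> = y\<^sup>2 / (2 * \<gamma>2) - (y * v - \<gamma>2 * v\<^sup>2 / 2)"
      using True by (simp add: power2_eq_square field_simps)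
    finally show ?thesis by simp
  qed
  moreover have "y * (y / \<gamma>2) - \<gamma>2 * (y / \<gamma>2)\<^sup>2 / 2 = y\<^sup>2 / (2 * \<gamma>2)"
    using True by (simp add: power2_eq_square field_simps)
  ultimately have "rate_fun \<gamma>2 y = ereal (y\<^sup>2 / (2 * \<gamma>2))"
    unfolding rate_fun_def by (intro antisym SUP_least) (auto intro: SUP_upper2[of "y / \<gamma>2"])
  then show ?thesis using True by simp
next
  case False
  then have 0: "\<gamma>2 = 0" using assms by simp
  show ?thesis
  proof (cases "y = 0")
    case True
    then show ?thesis by (simp add: rate_fun_def 0 zero_ereal_def)
  next
    case False
    have "rate_fun \<gamma>2 y = \<infinity>"
      unfolding rate_fun_def
    proof (rule SUP_PInfty)
      fix n :: nat
      show "\<exists>v\<in>UNIV. ereal (real n) \<le> ereal (y * v - \<gamma>2 * v\<^sup>2 / 2)"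
        using False by (intro bexI[of _ "real n / y"]) (simp_all add: 0)
    qed
    then show ?thesis using False 0 by simp
  qed
qed

lemma rate_fun_lower: "ereal (y * v - \<gamma>2 * v\<^sup>2 / 2) \<le> rate_fun \<gamma>2 y"
  unfolding rate_fun_def by (rule SUP_upper) simp

lemma less_rate_funD: "ereal M < rate_fun \<gamma>2 y \<Longrightarrow> \<exists>v. M < y * v - \<gamma>2 * v\<^sup>2 / 2"
  unfolding rate_fun_def less_SUP_iff by auto

lemma elog_le: "x \<le> exp b \<Longrightarrow> elog x \<le> ereal b"
  using ln_le_cancel_iff[of x "exp b"] by (auto simp: elog_def)

lemma elog_ge: "exp b \<le> x \<Longrightarrow> ereal b \<le> elog x"
proof -
  assume b: "exp b \<le> x"
  have x: "x > 0" using b exp_gt_zero[of b] by linarith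
  then show ?thesis using b ln_ge_iff[OF x, of b] by (simp add: elog_def)
qed

text \<open>A Gaertner-Ellis theorem with a quadratic limit on the line, uniform in a family of probability
  measures. Here \<open>s\<close> is the speed; only exponential moments enter, so the random variables may live
  on different spaces.\<close>

locale uniform_log_moments =
  fixes P :: "'i \<Rightarrow> 'a measure" and Y :: "nat \<Rightarrow> 'i \<Rightarrow> 'a \<Rightarrow> real" and s :: "nat \<Rightarrow> real" and \<gamma>2 :: real
  assumes prob: "\<And>i. prob_space (P i)"
    and meas: "\<And>n i. Y n i \<in> borel_measurable (P i)"
    and int: "\<And>n i z. integrable (P i) (\<lambda>x. exp (z * Y n i x))"
    and s_top: "filterlim s at_top sequentially"
    and \<gamma>2_nonneg: "\<gamma>2 \<ge> 0"
    and lim: "\<And>z \<epsilon>. \<epsilon> > 0 \<Longrightarrow> \<forall>\<^sub>F n in sequentially. \<forall>i.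
      \<bar>ln (\<integral> x. exp (s n * z * Y n i x) \<partial>P i) / s n - z\<^sup>2 * \<gamma>2 / 2\<bar> \<le> \<epsilon>"
begin

lemma s_large: "\<forall>\<^sub>F n in sequentially. s n > M"
  using s_top by (rule filterlim_at_top_dense[THEN iffD1, rule_format])

lemma moment_pos: "(\<integral> x. exp (z * Y n i x) \<partial>P i) > 0"
proof -
  interpret prob_space "P i" by (rule prob)
  have "(\<integral> x. exp (z * Y n i x) \<partial>P i) \<noteq> 0"
    using integral_nonneg_eq_0_iff_AE[OF int[of i z n]] AE_False by auto
  moreover have "(\<integral> x. exp (z * Y n i x) \<partial>P i) \<ge> 0"
    by (intro Bochner_Integration.integral_nonneg) simp
  ultimately show ?thesis by linarith
qed

lemma moment_bounds:
  assumes "\<epsilon> > 0"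
  shows "\<forall>\<^sub>F n in sequentially. \<forall>i.
    (\<integral> x. exp (s n * z * Y n i x) \<partial>P i) \<le> exp (s n * (z\<^sup>2 * \<gamma>2 / 2 + \<epsilon>)) \<and>
    exp (s n * (z\<^sup>2 * \<gamma>2 / 2 - \<epsilon>)) \<le> (\<integral> x. exp (s n * z * Y n i x) \<partial>P i)"
  using lim[OF assms, of z] s_large[of 0]
proof eventually_elim
  case (elim n)
  show ?case
  proof
    fix i
    define Z where "Z = (\<integral> x. exp (s n * z * Y n i x) \<partial>P i)"
    have "Z > 0" unfolding Z_def by (rule moment_pos)
    have "\<bar>ln Z / s n - z\<^sup>2 * \<gamma>2 / 2\<bar> \<le> \<epsilon>" using elim(1) by (simp add: Z_def)
    then have "ln Z / s n \<le> z\<^sup>2 * \<gamma>2 / 2 + \<epsilon>" "z\<^sup>2 * \<gamma>2 / 2 - \<epsilon> \<le> ln Z / s n"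
      unfolding abs_le_iff by linarith+
    then have "ln Z \<le> s n * (z\<^sup>2 * \<gamma>2 / 2 + \<epsilon>)" "s n * (z\<^sup>2 * \<gamma>2 / 2 - \<epsilon>) \<le> ln Z"
      using elim(2) by (simp_all add: pos_divide_le_eq pos_le_divide_eq mult.commute)
    then have "exp (ln Z) \<le> exp (s n * (z\<^sup>2 * \<gamma>2 / 2 + \<epsilon>))" "exp (s n * (z\<^sup>2 * \<gamma>2 / 2 - \<epsilon>)) \<le> exp (ln Z)"
      by simp_all
    then show "Z \<le> exp (s n * (z\<^sup>2 * \<gamma>2 / 2 + \<epsilon>)) \<and> exp (s n * (z\<^sup>2 * \<gamma>2 / 2 - \<epsilon>)) \<le> Z"
      using \<open>Z > 0\<close> by simp
  qed
qed

lemma event_sets: "B \<in> sets borel \<Longrightarrow> {x \<in> space (P i). Y n i x \<in> B} \<in> sets (P i)"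
  using measurable_sets[OF meas, of B n i] by (simp add: vimage_def Int_def conj_commute)

lemma chernoff:
  assumes "M < v * r - \<gamma>2 * v\<^sup>2 / 2"
  shows "\<forall>\<^sub>F n in sequentially. \<forall>i. measure (P i) {x \<in> space (P i). v * r \<le> v * Y n i x} \<le> exp (- (s n * M))"
proof -
  define \<epsilon> where "\<epsilon> = v * r - \<gamma>2 * v\<^sup>2 / 2 - M"
  have \<epsilon>: "\<epsilon> > 0" using assms by (simp add: \<epsilon>_def)
  show ?thesis
    using moment_bounds[OF \<epsilon>, of v] s_large[of 0]
  proof eventually_elim
    case (elim n)
    show ?case
    proof
      fix i
      interpret prob_space "P i" by (rule prob)
      have [measurable]: "Y n i \<in> borel_measurable (P i)" by (rule meas)
      let ?A = "{x \<in> space (P i). v * r \<le> v * Y n i x}"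
      have A: "?A \<in> sets (P i)" by measurable
      have "measure (P i) ?A * exp (s n * (v * r)) = (\<integral> x. exp (s n * (v * r)) * indicator ?A x \<partial>P i)"
        using A by (simp add: mult.commute)
      also have "\<dots> \<le> (\<integral> x. exp (s n * v * Y n i x) \<partial>P i)"
      proof (rule integral_mono)
        show "integrable (P i) (\<lambda>x. exp (s n * (v * r)) * indicator ?A x)"
          using A by (intro integrable_mult_right integrable_real_indicator) (simp_all add: emeasure_eq_measure)
        show "exp (s n * (v * r)) * indicator ?A x \<le> exp (s n * v * Y n i x)" for x
          using elim(2) by (auto simp: indicator_def mult.assoc)
      qed (rule int)
      also have "\<dots> \<le> exp (s n * (v\<^sup>2 * \<gamma>2 / 2 + \<epsilon>))" using elim(1) by blast
      also have "s n * (v\<^sup>2 * \<gamma>2 / 2 + \<epsilon>) = - (s n * M) + s n * (v * r)"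
        by (simp add: \<epsilon>_def algebra_simps)
      finally have "measure (P i) ?A * exp (s n * (v * r)) \<le> exp (- (s n * M)) * exp (s n * (v * r))"
        by (simp only: exp_add)
      then show "measure (P i) ?A \<le> exp (- (s n * M))"
        by (rule mult_right_le_imp_le) simp
    qed
  qed
qed

text \<open>On each half-line the set lies beyond its point closest to zero. There the rate exceeds \<open>M\<close>, so
  some parameter makes Chernoff's bound good enough, and this parameter has the sign of the point.\<close>

lemma half_line_bound:
  assumes "M \<ge> 0" and M: "ereal M < (INF y\<in>closure B. rate_fun \<gamma>2 y)" and \<tau>: "\<tau> * \<tau> = (1 :: real)"
  shows "\<forall>\<^sub>F n in sequentially. \<forall>i. measure (P i) {x \<in> space (P i). Y n i x \<in> B \<and> 0 \<le> \<tau> * Y n i x} \<le> exp (- (s n * M))"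
proof -
  define D where "D = {t. 0 \<le> t \<and> \<tau> * t \<in> closure B}"
  have inD: "\<tau> * y \<in> D" if "y \<in> B" "0 \<le> \<tau> * y" for y
  proof -
    have "\<tau> * (\<tau> * y) = y" using \<tau> by (metis mult.assoc mult_1)
    moreover have "y \<in> closure B" using that(1) closure_subset by blast
    ultimately show ?thesis using that(2) unfolding D_def by (simp only: mem_Collect_eq simp_thms)
  qed
  show ?thesis
  proof (cases "D = {}")
    case True
    then have "{x \<in> space (P i). Y n i x \<in> B \<and> 0 \<le> \<tau> * Y n i x} = {}" for n i
      using inD by auto
    then show ?thesis by (intro always_eventually allI) (simp only: measure_empty exp_ge_zero)
  next
    case False
    have "D = {0..} \<inter> (\<lambda>t. \<tau> * t) -` closure B" by (auto simp: D_def)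
    moreover have "closed ((\<lambda>t. \<tau> * t) -` closure B)"
      by (intro continuous_closed_vimage) (auto intro!: continuous_intros)
    ultimately have "closed D" by (simp add: closed_Int)
    have bdd: "bdd_below D" by (auto simp: D_def intro: bdd_belowI[of _ 0])
    define r where "r = Inf D"
    have "r \<in> D" unfolding r_def by (rule closed_contains_Inf[OF False bdd \<open>closed D\<close>])
    then have r: "0 \<le> r" "\<tau> * r \<in> closure B" by (auto simp: D_def)
    have "ereal M < rate_fun \<gamma>2 (\<tau> * r)" using M r(2) by (meson INF_lower less_le_trans)
    then obtain v where v: "M < (\<tau> * r) * v - \<gamma>2 * v\<^sup>2 / 2" using less_rate_funD by blast
    have "0 \<le> \<gamma>2 * v\<^sup>2 / 2" using \<gamma>2_nonneg by simp
    then have "0 < (\<tau> * r) * v" using v \<open>M \<ge> 0\<close> by linarith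
    then have "0 < r * (\<tau> * v)" by (simp add: mult_ac)
    then have \<tau>v: "\<tau> * v > 0" using r(1) by (simp add: zero_less_mult_iff)
    have le: "v * (\<tau> * r) \<le> v * y" if "y \<in> B" "0 \<le> \<tau> * y" for y
    proof -
      have "r \<le> \<tau> * y" unfolding r_def by (intro cInf_lower inD that bdd)
      then have "(\<tau> * v) * r \<le> (\<tau> * v) * (\<tau> * y)" using \<tau>v by (intro mult_left_mono) auto
      also have "(\<tau> * v) * (\<tau> * y) = (\<tau> * \<tau>) * (v * y)" by (simp only: mult_ac)
      finally show ?thesis using \<tau> by (simp add: mult_ac)
    qed
    have "M < v * (\<tau> * r) - \<gamma>2 * v\<^sup>2 / 2" using v by (simp add: mult.commute)
    from chernoff[OF this] show ?thesis
    proof eventually_elim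
      case (elim n)
      show ?case
      proof
        fix i
        interpret prob_space "P i" by (rule prob)
        have [measurable]: "Y n i \<in> borel_measurable (P i)" by (rule meas)
        have "measure (P i) {x \<in> space (P i). Y n i x \<in> B \<and> 0 \<le> \<tau> * Y n i x} \<le> measure (P i) {x \<in> space (P i). v * (\<tau> * r) \<le> v * Y n i x}"
        proof (rule finite_measure_mono)
          show "{x \<in> space (P i). v * (\<tau> * r) \<le> v * Y n i x} \<in> sets (P i)" by measurable
        qed (auto intro: le)
        also have "\<dots> \<le> exp (- (s n * M))" using elim by blast
        finally show "measure (P i) {x \<in> space (P i). Y n i x \<in> B \<and> 0 \<le> \<tau> * Y n i x} \<le> exp (- (s n * M))" .
      qed
    qed
  qed
qed

lemma ereal_inverse_mult_mono:
  "s n > 0 \<Longrightarrow> x \<le> ereal b \<Longrightarrow> ereal (1 / s n) * x \<le> ereal (b / s n)"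
  using ereal_mult_left_mono[of x "ereal b" "ereal (1 / s n)"] by (simp add: less_imp_le)

lemma ereal_inverse_mult_mono':
  "s n > 0 \<Longrightarrow> ereal b \<le> x \<Longrightarrow> ereal (b / s n) \<le> ereal (1 / s n) * x"
  using ereal_mult_left_mono[of "ereal b" x "ereal (1 / s n)"] by (simp add: less_imp_le)

lemma upper_bound:
  assumes B: "B \<in> sets borel"
  shows "limsup (\<lambda>n. ereal (1 / s n) * elog (SUP i. measure (P i) {x \<in> space (P i). Y n i x \<in> B}))
    \<le> - (INF y\<in>closure B. rate_fun \<gamma>2 y)"
proof -
  let ?L = "\<lambda>n. ereal (1 / s n) * elog (SUP i. measure (P i) {x \<in> space (P i). Y n i x \<in> B})"
  have key: "limsup ?L \<le> ereal (- M)" if M: "ereal M < (INF y\<in>closure B. rate_fun \<gamma>2 y)" for M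
  proof (cases "M \<ge> 0")
    case False
    have "\<forall>\<^sub>F n in sequentially. ?L n \<le> ereal (- M)"
      using s_large[of 0]
    proof eventually_elim
      case (elim n)
      have "(SUP i. measure (P i) {x \<in> space (P i). Y n i x \<in> B}) \<le> exp 0"
        by (intro cSUP_least) (auto intro: prob_space.prob_le_1[OF prob])
      then have "?L n \<le> ereal (0 / s n)"
        by (intro ereal_inverse_mult_mono elim elog_le)
      also have "\<dots> \<le> ereal (- M)" using False by simp
      finally show ?case .
    qed
    then show ?thesis by (rule Limsup_bounded)
  next
    case True
    have "\<forall>\<^sub>F n in sequentially. ?L n \<le> ereal (- M + \<epsilon>)" if "\<epsilon> > 0" for \<epsilon>
      using half_line_bound[OF True M, of 1, simplified] half_line_bound[OF True M, of "- 1", simplified]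
        s_large[of 0] s_large[of "ln 2 / \<epsilon>"]
    proof eventually_elim
      case (elim n)
      have le: "measure (P i) {x \<in> space (P i). Y n i x \<in> B} \<le> exp (ln 2 - s n * M)" for i
      proof -
        interpret prob_space "P i" by (rule prob)
        have [measurable]: "Y n i \<in> borel_measurable (P i)" by (rule meas)
        note B [measurable]
        let ?A = "{x \<in> space (P i). Y n i x \<in> B \<and> 0 \<le> Y n i x}"
        let ?A' = "{x \<in> space (P i). Y n i x \<in> B \<and> Y n i x \<le> 0}"
        have A: "?A \<in> sets (P i)" "?A' \<in> sets (P i)" by measurable
        have "measure (P i) {x \<in> space (P i). Y n i x \<in> B} \<le> measure (P i) (?A \<union> ?A')"
          using A by (intro finite_measure_mono) auto
        also have "\<dots> \<le> measure (P i) ?A + measure (P i) ?A'"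
          using A by (rule measure_Un_le)
        also have "\<dots> \<le> exp (- (s n * M)) + exp (- (s n * M))"
          using elim(1,2) by (intro add_mono) auto
        also have "\<dots> = exp (ln 2 - s n * M)" by (simp add: exp_diff exp_minus field_simps)
        finally show ?thesis .
      qed
      have "(SUP i. measure (P i) {x \<in> space (P i). Y n i x \<in> B}) \<le> exp (ln 2 - s n * M)"
        by (intro cSUP_least le) simp
      then have "?L n \<le> ereal ((ln 2 - s n * M) / s n)"
        by (intro ereal_inverse_mult_mono elim elog_le)
      also have "(ln 2 - s n * M) / s n \<le> - M + \<epsilon>"
        using elim(3,4) \<open>\<epsilon> > 0\<close> by (simp add: field_simps)
      finally show ?case by simp
    qed
    then have "limsup ?L \<le> ereal (- M) + ereal \<epsilon>" if "\<epsilon> > 0" for \<epsilon>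
      using that by (auto intro: Limsup_bounded)
    then show ?thesis by (rule ereal_le_epsilon2)
  qed
  show ?thesis
  proof (rule ccontr)
    assume "\<not> ?thesis"
    then obtain x where x: "- (INF y\<in>closure B. rate_fun \<gamma>2 y) < ereal x" "ereal x < limsup ?L"
      using ereal_dense2[of "- (INF y\<in>closure B. rate_fun \<gamma>2 y)" "limsup ?L"] by (auto simp: not_le)
    then have "ereal (- x) < (INF y\<in>closure B. rate_fun \<gamma>2 y)"
      by (simp add: ereal_uminus_less_reorder)
    from key[OF this] x(2) show False by simp
  qed
qed

text \<open>Exponential tilting: under the weight \<open>exp (s n * v * Y)\<close> the variable concentrates at
  \<open>\<gamma>2 * v\<close>, since its deviations from this point are controlled by the moments at \<open>v + t\<close> and
  \<open>v - t\<close> for a small \<open>t\<close>.\<close>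

lemma lower_estimate:
  assumes "\<epsilon> > 0" and v: "y = \<gamma>2 * v"
  defines "\<kappa> \<equiv> \<epsilon>\<^sup>2 / (8 * (\<gamma>2 + 1))"
  shows "\<forall>\<^sub>F n in sequentially. \<forall>i.
    exp (s n * (- (\<gamma>2 * v\<^sup>2 / 2) - \<kappa> - \<bar>v\<bar> * \<epsilon>) - ln 2) \<le> measure (P i) {x \<in> space (P i). \<bar>Y n i x - y\<bar> < \<epsilon>}"
proof -
  \<comment> \<open>The gain \<open>t * \<epsilon>\<close> is at least twice the cost \<open>\<gamma>2 * t\<^sup>2 / 2\<close>; adding one covers \<open>\<gamma>2 = 0\<close>.\<close>
  define t where "t = \<epsilon> / (\<gamma>2 + 1)"
  have g1: "\<gamma>2 + 1 > 0" using \<gamma>2_nonneg by simp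
  have t: "t > 0" using g1 \<open>\<epsilon> > 0\<close> by (simp add: t_def)
  have \<kappa>: "\<kappa> > 0" using g1 \<open>\<epsilon> > 0\<close> by (simp add: \<kappa>_def)
  have t8: "t * \<epsilon> = 8 * \<kappa>" using g1 by (simp add: t_def \<kappa>_def power2_eq_square field_simps)
  have "\<gamma>2 * t \<le> \<epsilon>" using g1 \<gamma>2_nonneg \<open>\<epsilon> > 0\<close> by (simp add: t_def field_simps)
  then have "t * (\<gamma>2 * t) \<le> t * \<epsilon>" using t by (intro mult_left_mono) auto
  then have tt: "\<gamma>2 * t\<^sup>2 / 2 \<le> 4 * \<kappa>" using t8 by (simp add: power2_eq_square mult_ac)
  define A where "A = \<gamma>2 * v\<^sup>2 / 2"
  show ?thesis
    using moment_bounds[OF \<kappa>, of v] moment_bounds[OF \<kappa>, of "v + t"] moment_bounds[OF \<kappa>, of "v - t"]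
      s_large[of 0] s_large[of "ln 4 / (2 * \<kappa>)"]
  proof eventually_elim
    case (elim n)
    show ?case
    proof
      fix i
      interpret prob_space "P i" by (rule prob)
      have [measurable]: "Y n i \<in> borel_measurable (P i)" by (rule meas)
      let ?G = "{x \<in> space (P i). \<bar>Y n i x - y\<bar> < \<epsilon>}"
      have G: "?G \<in> sets (P i)" by measurable
      define E where "E z = (\<integral> x. exp (s n * z * Y n i x) \<partial>P i)" for z
      define f where "f x = exp (s n * (v * y + \<bar>v\<bar> * \<epsilon>)) * indicator ?G x
        + exp (- (s n * t * (y + \<epsilon>))) * exp (s n * (v + t) * Y n i x)
        + exp (s n * t * (y - \<epsilon>)) * exp (s n * (v - t) * Y n i x)" for x
      have le: "exp (s n * v * Y n i x) \<le> f x" if "x \<in> space (P i)" for x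
      proof -
        have 2: "exp (- (s n * t * (y + \<epsilon>))) * exp (s n * (v + t) * Y n i x) = exp (s n * v * Y n i x + s n * t * (Y n i x - (y + \<epsilon>)))"
          "exp (s n * t * (y - \<epsilon>)) * exp (s n * (v - t) * Y n i x) = exp (s n * v * Y n i x + s n * t * (y - \<epsilon> - Y n i x))"
          by (simp_all add: exp_add[symmetric] algebra_simps)
        have st: "s n * t \<ge> 0" using elim(4) t by simp
        consider "\<bar>Y n i x - y\<bar> < \<epsilon>" | "Y n i x \<ge> y + \<epsilon>" | "Y n i x \<le> y - \<epsilon>"
          by linarith
        then show ?thesis
        proof cases
          case 1
          have "v * (Y n i x - y) \<le> \<bar>v\<bar> * \<bar>Y n i x - y\<bar>" by (metis abs_ge_self abs_mult)
          also have "\<dots> \<le> \<bar>v\<bar> * \<epsilon>" using 1 by (intro mult_left_mono) auto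
          finally have "v * Y n i x \<le> v * y + \<bar>v\<bar> * \<epsilon>" by (simp add: algebra_simps)
          then have "s n * (v * Y n i x) \<le> s n * (v * y + \<bar>v\<bar> * \<epsilon>)" using elim(4) by (intro mult_left_mono) auto
          then have "exp (s n * v * Y n i x) \<le> exp (s n * (v * y + \<bar>v\<bar> * \<epsilon>)) * indicator ?G x"
            using 1 that by (simp add: mult.assoc)
          then show ?thesis unfolding f_def by (intro add_increasing2) auto
        next
          case 2
          then have "0 \<le> s n * t * (Y n i x - (y + \<epsilon>))" by (intro mult_nonneg_nonneg[OF st]) simp
          then have "exp (s n * v * Y n i x) \<le> exp (- (s n * t * (y + \<epsilon>))) * exp (s n * (v + t) * Y n i x)"
            unfolding \<open>exp (- (s n * t * (y + \<epsilon>))) * exp (s n * (v + t) * Y n i x) = _\<close> by simp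
          then show ?thesis unfolding f_def by (intro add_increasing2 add_increasing) auto
        next
          case 3
          then have "0 \<le> s n * t * (y - \<epsilon> - Y n i x)" by (intro mult_nonneg_nonneg[OF st]) simp
          then have "exp (s n * v * Y n i x) \<le> exp (s n * t * (y - \<epsilon>)) * exp (s n * (v - t) * Y n i x)"
            unfolding \<open>exp (s n * t * (y - \<epsilon>)) * exp (s n * (v - t) * Y n i x) = _\<close> by simp
          then show ?thesis unfolding f_def by (intro add_increasing) auto
        qed
      qed
      have intG: "integrable (P i) (\<lambda>x. exp (s n * (v * y + \<bar>v\<bar> * \<epsilon>)) * indicator ?G x)"
        using G by (intro integrable_mult_right integrable_real_indicator) (simp_all add: emeasure_eq_measure)
      have intf: "integrable (P i) f"
        unfolding f_def by (intro Bochner_Integration.integrable_add integrable_mult_right intG int)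
      have "E v \<le> (\<integral> x. f x \<partial>P i)"
        unfolding E_def by (intro integral_mono int intf le)
      also have "\<dots> = exp (s n * (v * y + \<bar>v\<bar> * \<epsilon>)) * measure (P i) ?G
          + exp (- (s n * t * (y + \<epsilon>))) * E (v + t) + exp (s n * t * (y - \<epsilon>)) * E (v - t)"
      proof -
        have *: "integrable (P i) (\<lambda>x. exp (- (s n * t * (y + \<epsilon>))) * exp (s n * (v + t) * Y n i x))"
          "integrable (P i) (\<lambda>x. exp (s n * t * (y - \<epsilon>)) * exp (s n * (v - t) * Y n i x))"
          by (intro integrable_mult_right int)+
        show ?thesis
          unfolding f_def E_def
          using G
          by (subst Bochner_Integration.integral_add[OF Bochner_Integration.integrable_add[OF intG *(1)] *(2)],
              subst Bochner_Integration.integral_add[OF intG *(1)]) (simp add: Int_absorb2 sets.sets_into_space)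
      qed
      also have "exp (- (s n * t * (y + \<epsilon>))) * E (v + t) \<le> exp (s n * (A - 3 * \<kappa>))"
      proof -
        have "exp (- (s n * t * (y + \<epsilon>))) * E (v + t) \<le> exp (- (s n * t * (y + \<epsilon>))) * exp (s n * ((v + t)\<^sup>2 * \<gamma>2 / 2 + \<kappa>))"
          using elim(2) by (intro mult_left_mono) (auto simp: E_def)
        also have "\<dots> = exp (s n * (A + \<gamma>2 * t\<^sup>2 / 2 - t * \<epsilon> + \<kappa>))"
          by (simp add: exp_add[symmetric] v A_def power2_eq_square field_simps)
        also have "\<dots> \<le> exp (s n * (A - 3 * \<kappa>))"
          using tt t8 elim(4) by (simp add: mult_left_mono)
        finally show ?thesis .
      qed
      also have "exp (s n * t * (y - \<epsilon>)) * E (v - t) \<le> exp (s n * (A - 3 * \<kappa>))"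
      proof -
        have "exp (s n * t * (y - \<epsilon>)) * E (v - t) \<le> exp (s n * t * (y - \<epsilon>)) * exp (s n * ((v - t)\<^sup>2 * \<gamma>2 / 2 + \<kappa>))"
          using elim(3) by (intro mult_left_mono) (auto simp: E_def)
        also have "\<dots> = exp (s n * (A + \<gamma>2 * t\<^sup>2 / 2 - t * \<epsilon> + \<kappa>))"
          by (simp add: exp_add[symmetric] v A_def power2_eq_square field_simps)
        also have "\<dots> \<le> exp (s n * (A - 3 * \<kappa>))"
          using tt t8 elim(4) by (simp add: mult_left_mono)
        finally show ?thesis .
      qed
      finally have up: "E v \<le> exp (s n * (v * y + \<bar>v\<bar> * \<epsilon>)) * measure (P i) ?G + 2 * exp (s n * (A - 3 * \<kappa>))"
        by simp
      have low: "exp (s n * (A - \<kappa>)) \<le> E v"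
        using elim(1) by (auto simp: E_def A_def mult.commute)
      have "2 * exp (s n * (A - 3 * \<kappa>)) \<le> exp (s n * (A - \<kappa>)) / 2"
      proof -
        have "ln 4 \<le> s n * (2 * \<kappa>)" using elim(5) \<kappa> by (simp add: field_simps)
        then have "exp (ln 4) \<le> exp (s n * (2 * \<kappa>))" by (simp only: exp_le_cancel_iff)
        then have "4 * exp (s n * (A - 3 * \<kappa>)) \<le> exp (s n * (2 * \<kappa>)) * exp (s n * (A - 3 * \<kappa>))"
          by (intro mult_right_mono) auto
        also have "\<dots> = exp (s n * (A - \<kappa>))" by (simp add: exp_add[symmetric] algebra_simps)
        finally show ?thesis by simp
      qed
      then have "exp (s n * (A - \<kappa>)) / 2 \<le> exp (s n * (v * y + \<bar>v\<bar> * \<epsilon>)) * measure (P i) ?G"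
        using up low by linarith
      then have "exp (- (s n * (v * y + \<bar>v\<bar> * \<epsilon>))) * (exp (s n * (A - \<kappa>)) / 2) \<le>
          exp (- (s n * (v * y + \<bar>v\<bar> * \<epsilon>))) * (exp (s n * (v * y + \<bar>v\<bar> * \<epsilon>)) * measure (P i) ?G)"
        by (rule mult_left_mono) simp
      also have "\<dots> = measure (P i) ?G"
        by (simp only: mult.assoc[symmetric] exp_add[symmetric]) simp
      finally have "exp (- (s n * (v * y + \<bar>v\<bar> * \<epsilon>))) * (exp (s n * (A - \<kappa>)) / 2) \<le> measure (P i) ?G" .
      moreover have "exp (- (s n * (v * y + \<bar>v\<bar> * \<epsilon>))) * (exp (s n * (A - \<kappa>)) / 2) =
          exp (s n * (- (\<gamma>2 * v\<^sup>2 / 2) - \<kappa> - \<bar>v\<bar> * \<epsilon>) - ln 2)"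
      proof -
        have "s n * (- (\<gamma>2 * v\<^sup>2 / 2) - \<kappa> - \<bar>v\<bar> * \<epsilon>) = - (s n * (v * y + \<bar>v\<bar> * \<epsilon>)) + s n * (A - \<kappa>)"
          by (simp add: v A_def power2_eq_square algebra_simps)
        then show ?thesis by (simp only: exp_diff exp_add) simp
      qed
      ultimately show "exp (s n * (- (\<gamma>2 * v\<^sup>2 / 2) - \<kappa> - \<bar>v\<bar> * \<epsilon>) - ln 2) \<le> measure (P i) ?G"
        by simp
    qed
  qed
qed

lemma lower_bound:
  assumes B: "B \<in> sets borel"
  shows "liminf (\<lambda>n. ereal (1 / s n) * elog (INF i. measure (P i) {x \<in> space (P i). Y n i x \<in> B}))
    \<ge> - (INF y\<in>interior B. rate_fun \<gamma>2 y)"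
proof -
  let ?L = "\<lambda>n. ereal (1 / s n) * elog (INF i. measure (P i) {x \<in> space (P i). Y n i x \<in> B})"
  have "- liminf ?L \<le> rate_fun \<gamma>2 y" if y: "y \<in> interior B" for y
  proof (cases "rate_fun \<gamma>2 y = \<infinity>")
    case False
    have "\<exists>v. y = \<gamma>2 * v"
      using False rate_fun_eq[OF \<gamma>2_nonneg, of y] by (cases "\<gamma>2 > 0") (auto intro: exI[of _ "y / \<gamma>2"] split: if_splits)
    then obtain v where v: "y = \<gamma>2 * v" by blast
    have "ereal (- (\<gamma>2 * v\<^sup>2 / 2)) \<le> liminf ?L + ereal e" if "e > 0" for e
    proof -
      obtain d where d: "d > 0" "ball y d \<subseteq> B"
        using y by (auto simp: mem_interior)
      define \<epsilon> where "\<epsilon> = min d (min 1 (e / (2 * (\<bar>v\<bar> + 1))))"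
      have \<epsilon>: "\<epsilon> > 0" "\<epsilon> \<le> d" "\<epsilon> \<le> 1" "\<epsilon> \<le> e / (2 * (\<bar>v\<bar> + 1))"
        using d(1) \<open>e > 0\<close> by (auto simp: \<epsilon>_def)
      define \<kappa> where "\<kappa> = \<epsilon>\<^sup>2 / (8 * (\<gamma>2 + 1))"
      have "\<kappa> \<le> \<epsilon>"
      proof -
        have "\<epsilon>\<^sup>2 \<le> \<epsilon> * 1" unfolding power2_eq_square using \<epsilon> by (intro mult_left_mono) auto
        also have "\<dots> \<le> \<epsilon> * (8 * (\<gamma>2 + 1))" using \<epsilon> \<gamma>2_nonneg by (intro mult_left_mono) auto
        finally show ?thesis using \<gamma>2_nonneg by (simp add: \<kappa>_def pos_divide_le_eq)
      qed
      then have "\<kappa> + \<bar>v\<bar> * \<epsilon> \<le> (\<bar>v\<bar> + 1) * \<epsilon>" by (simp add: algebra_simps)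
      also have "\<dots> \<le> (\<bar>v\<bar> + 1) * (e / (2 * (\<bar>v\<bar> + 1)))" using \<epsilon>(4) by (intro mult_left_mono) auto
      also have "\<dots> = e / 2"
        by (simp add: field_simps add_eq_0_iff_both_eq_0)
      finally have small: "\<kappa> + \<bar>v\<bar> * \<epsilon> \<le> e / 2" .
      have "\<forall>\<^sub>F n in sequentially. ereal (- (\<gamma>2 * v\<^sup>2 / 2) - e) \<le> ?L n"
        using lower_estimate[OF \<epsilon>(1) v] s_large[of 0] s_large[of "2 * ln 2 / e"]
      proof eventually_elim
        case (elim n)
        define b where "b = s n * (- (\<gamma>2 * v\<^sup>2 / 2) - \<kappa> - \<bar>v\<bar> * \<epsilon>) - ln 2"
        have "exp b \<le> measure (P i) {x \<in> space (P i). Y n i x \<in> B}" for i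
        proof -
          interpret prob_space "P i" by (rule prob)
          have "exp b \<le> measure (P i) {x \<in> space (P i). \<bar>Y n i x - y\<bar> < \<epsilon>}"
            using elim(1) by (simp add: b_def \<kappa>_def)
          also have "\<dots> \<le> measure (P i) {x \<in> space (P i). Y n i x \<in> B}"
            using \<epsilon>(2) d(2) by (intro finite_measure_mono event_sets B) (auto simp: dist_real_def subset_eq abs_minus_commute)
          finally show ?thesis .
        qed
        then have "exp b \<le> (INF i. measure (P i) {x \<in> space (P i). Y n i x \<in> B})"
          by (intro cINF_greatest) auto
        then have "ereal (b / s n) \<le> ?L n"
          by (intro ereal_inverse_mult_mono' elim elog_ge)
        moreover have "- (\<gamma>2 * v\<^sup>2 / 2) - e \<le> b / s n"
        proof -
          have "ln 2 \<le> s n * (e / 2)" using elim(3) \<open>e > 0\<close> by (simp add: field_simps)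
          moreover have "s n * (\<kappa> + \<bar>v\<bar> * \<epsilon>) \<le> s n * (e / 2)"
            using small elim(2) by (intro mult_left_mono) auto
          ultimately have "s n * (- (\<gamma>2 * v\<^sup>2 / 2) - e) \<le> b"
            by (simp add: b_def algebra_simps)
          then show ?thesis using elim(2) by (simp add: pos_le_divide_eq mult.commute)
        qed
        ultimately show ?case by (meson ereal_less_eq(3) order_trans)
      qed
      then have "ereal (- (\<gamma>2 * v\<^sup>2 / 2) - e) \<le> liminf ?L" by (rule Liminf_bounded)
      then have "ereal (- (\<gamma>2 * v\<^sup>2 / 2) - e) + ereal e \<le> liminf ?L + ereal e" by (rule add_right_mono)
      then show ?thesis by simp
    qed
    then have "ereal (- (\<gamma>2 * v\<^sup>2 / 2)) \<le> liminf ?L" by (rule ereal_le_epsilon2)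
    then have "- liminf ?L \<le> ereal (\<gamma>2 * v\<^sup>2 / 2)"
      by (simp add: ereal_uminus_le_reorder)
    also have "\<dots> \<le> rate_fun \<gamma>2 y"
      using rate_fun_lower[of y v \<gamma>2] by (simp add: v power2_eq_square algebra_simps)
    finally show ?thesis .
  qed simp
  then have "- liminf ?L \<le> (INF y\<in>interior B. rate_fun \<gamma>2 y)" by (rule INF_greatest)
  then show ?thesis by (simp add: ereal_uminus_le_reorder)
qed

end

theorem theorem7p1:
  fixes \<mu> :: "(complex ^ 'd ^ 'd) measure"
    and \<nu>inv :: "'d cproj measure"
    and g gt :: "'d :: finite cproj \<Rightarrow> real"
    and a :: "real \<Rightarrow> real"
  assumes sets_mu: "sets \<mu> = sets borel"
    and second_moment: "(\<integral>\<^sup>+ v. ennreal ((op_norm v)\<^sup>2) \<partial>\<mu>) < \<infinity>"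
    and stochastic: "(\<integral> v. cadjoint v ** v \<partial>\<mu>) = mat 1"
    and pur: "purifying \<mu>"
    and erg: "ergodic \<mu>"
    and inv: "invariant_prob \<mu> \<nu>inv"
    and holder: "holder_continuous g"
    and centered: "(\<integral> p. g p \<partial>\<nu>inv) = 0"
    and gt_cont: "continuous_on UNIV gt"
    and poisson: "\<And>p. gt p - kernel_op \<mu> gt p = g p"
    and a_nonneg: "\<And>t. t > 0 \<Longrightarrow> a t \<ge> 0"
    and a_small: "filterlim (\<lambda>t. t / a t) at_top at_top"
    and a_large: "filterlim (\<lambda>t. a t / sqrt t) at_top at_top"
  shows
    "(\<forall>z::real.
        (\<lambda>n. SUP p. ereal \<bar>real n / (a (real n))\<^sup>2 *
             ln (\<integral> \<xi>. exp (a (real n) / real n * z * birkhoff_sum g n \<xi>) \<partial>path_measure_at \<mu> p)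
             - z\<^sup>2 * asymp_var \<mu> \<nu>inv gt / 2\<bar>) \<longlonglongrightarrow> 0)
     \<and> (\<forall>B \<in> sets (borel :: real measure).
        limsup (\<lambda>n. ereal (real n / (a (real n))\<^sup>2) *
            elog (SUP p. measure (path_measure_at \<mu> p)
              {\<xi> \<in> space (path_measure_at \<mu> p). 1 / a (real n) * birkhoff_sum g n \<xi> \<in> B}))
          \<le> - (INF y\<in>closure B. rate_fun (asymp_var \<mu> \<nu>inv gt) y)
        \<and> liminf (\<lambda>n. ereal (real n / (a (real n))\<^sup>2) *
            elog (INF p. measure (path_measure_at \<mu> p)
              {\<xi> \<in> space (path_measure_at \<mu> p). 1 / a (real n) * birkhoff_sum g n \<xi> \<in> B}))
          \<ge> - (INF y\<in>interior B. rate_fun (asymp_var \<mu> \<nu>inv gt) y))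
     \<and> (\<forall>y::real. rate_fun (asymp_var \<mu> \<nu>inv gt) y =
          (if asymp_var \<mu> \<nu>inv gt > 0 then ereal (y\<^sup>2 / (2 * asymp_var \<mu> \<nu>inv gt))
           else if y = 0 then 0 else \<infinity>))"
proof -
  interpret stochastic_matrices \<mu>
    by (rule stochastic_matrices.intro[OF sets_mu stochastic])
  define \<sigma>2 where "\<sigma>2 = asymp_var \<mu> \<nu>inv gt"
  have \<sigma>2_nonneg: "\<sigma>2 \<ge> 0"
    unfolding \<sigma>2_def by (rule asymp_var_nonneg[OF inv gt_cont])
  have "g = (\<lambda>p. gt p - kernel_op \<mu> gt p)" by (simp add: poisson fun_eq_iff)
  then have g: "continuous_on UNIV g"
    by (simp only:) (intro continuous_on_diff gt_cont continuous_kernel_op)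
  define s where "s n = (a (real n))\<^sup>2 / real n" for n
  have ratio: "\<forall>\<^sub>F n in sequentially. M < a (real n) / sqrt (real n)" for M
    using filterlim_compose[OF a_large filterlim_real_sequentially] by (simp add: filterlim_at_top_dense)
  have inv_ratio: "\<forall>\<^sub>F n in sequentially. M < real n / a (real n)" for M
    using filterlim_compose[OF a_small filterlim_real_sequentially] by (simp add: filterlim_at_top_dense)
  have a_pos: "\<forall>\<^sub>F n in sequentially. 0 < a (real n)"
    using ratio[of 0] eventually_gt_at_top[of 0]
    by eventually_elim (simp add: zero_less_divide_iff)
  have a_top: "\<forall>\<^sub>F n in sequentially. M < a (real n)" for M
    using ratio[of "\<bar>M\<bar>"] eventually_gt_at_top[of 0]
  proof eventually_elim
    case (elim n)
    then have "\<bar>M\<bar> * sqrt (real n) < a (real n)" by (simp add: pos_less_divide_eq)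
    moreover have "\<bar>M\<bar> * 1 \<le> \<bar>M\<bar> * sqrt (real n)" using elim by (intro mult_left_mono) auto
    ultimately show ?case by linarith
  qed
  have s_top: "filterlim s at_top sequentially"
    unfolding filterlim_at_top_dense
  proof
    fix M
    show "\<forall>\<^sub>F n in sequentially. M < s n"
      using ratio[of "max M 1"] eventually_gt_at_top[of 0]
    proof eventually_elim
      case (elim n)
      define q where "q = a (real n) / sqrt (real n)"
      have "M < q" "1 < q" using elim(1) by (simp_all only: q_def max_less_iff_conj)
      then have "M < q * q" using mult_strict_left_mono[of 1 q q] by linarith
      also have "q * q = s n" using elim(2) by (simp add: q_def s_def power2_eq_square)
      finally show ?case .
    qed
  qed
  have inv_s: "1 / s n = real n / (a (real n))\<^sup>2" for n by (simp add: s_def)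
  \<comment> \<open>The remainder in the bound of the logarithm is of order \<open>a n / n\<close>, while the scale is \<open>(a n)\<^sup>2 / n\<close>.\<close>
  have log_moments: "\<forall>\<^sub>F n in sequentially. \<forall>p.
      \<bar>real n / (a (real n))\<^sup>2 * ln (\<integral> \<xi>. exp (a (real n) / real n * z * birkhoff_sum g n \<xi>) \<partial>path_measure_at \<mu> p)
        - z\<^sup>2 * \<sigma>2 / 2\<bar> \<le> \<epsilon>" if "\<epsilon> > 0" for z \<epsilon>
  proof -
    define \<delta> where "\<delta> = \<epsilon> / (2 * (z\<^sup>2 + 1))"
    have z1: "z\<^sup>2 + 1 > 0" by (smt (verit) zero_le_power2)
    then have \<delta>: "\<delta> > 0" using that by (simp add: \<delta>_def)
    obtain K c0 where K: "K \<ge> 0" "c0 > 0"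
      "\<And>c n p. \<bar>c\<bar> \<le> c0 \<Longrightarrow>
        \<bar>ln (\<integral> \<xi>. exp (c * birkhoff_sum g n \<xi>) \<partial>path_measure_at \<mu> p) - real n * (c\<^sup>2 / 2 * \<sigma>2)\<bar>
          \<le> K * \<bar>c\<bar> + \<delta> * (real n * c\<^sup>2)"
      using log_moment_bound[OF pur erg inv g gt_cont poisson \<delta>] unfolding \<sigma>2_def by blast
    show ?thesis
      using inv_ratio[of "\<bar>z\<bar> / c0"] a_top[of "2 * (K * \<bar>z\<bar>) / \<epsilon>"] a_pos eventually_gt_at_top[of 0]
    proof eventually_elim
      case (elim n)
      show ?case
      proof
        fix p
        define A where "A = a (real n)"
        have A: "A > 0" using elim(3) by (simp add: A_def)
        have n: "real n > 0" using elim(4) by simp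
        define c where "c = A / real n * z"
        define k where "k = real n / A\<^sup>2"
        have k: "k \<ge> 0" by (simp add: k_def)
        define Z where "Z = (\<integral> \<xi>. exp (c * birkhoff_sum g n \<xi>) \<partial>path_measure_at \<mu> p)"
        have "\<bar>z\<bar> / c0 < real n / A" using elim(1) by (simp add: A_def)
        then have "\<bar>z\<bar> * A < real n * c0" using A K(2) by (simp add: field_simps)
        then have "\<bar>c\<bar> \<le> c0" using A n by (simp add: c_def abs_mult field_simps)
        from K(3)[OF this, where n = n and p = p]
        have "\<bar>ln Z - real n * (c\<^sup>2 / 2 * \<sigma>2)\<bar> \<le> K * \<bar>c\<bar> + \<delta> * (real n * c\<^sup>2)" by (simp add: Z_def)
        then have "k * \<bar>ln Z - real n * (c\<^sup>2 / 2 * \<sigma>2)\<bar> \<le> k * (K * \<bar>c\<bar> + \<delta> * (real n * c\<^sup>2))"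
          using k by (rule mult_left_mono)
        moreover have "k * \<bar>ln Z - real n * (c\<^sup>2 / 2 * \<sigma>2)\<bar> = \<bar>k * ln Z - z\<^sup>2 * \<sigma>2 / 2\<bar>"
        proof -
          have "k * \<bar>ln Z - real n * (c\<^sup>2 / 2 * \<sigma>2)\<bar> = \<bar>k * (ln Z - real n * (c\<^sup>2 / 2 * \<sigma>2))\<bar>"
            using k by (simp only: abs_mult abs_of_nonneg)
          also have "k * (ln Z - real n * (c\<^sup>2 / 2 * \<sigma>2)) = k * ln Z - z\<^sup>2 * \<sigma>2 / 2"
            using A n by (simp add: k_def c_def power2_eq_square field_simps)
          finally show ?thesis .
        qed
        moreover have "k * (K * \<bar>c\<bar> + \<delta> * (real n * c\<^sup>2)) = K * \<bar>z\<bar> / A + \<delta> * z\<^sup>2"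
          using A n by (simp add: k_def c_def abs_mult power2_eq_square field_simps)
        moreover have "K * \<bar>z\<bar> / A \<le> \<epsilon> / 2"
          using elim(2) A that by (simp add: A_def field_simps)
        moreover have "\<delta> * z\<^sup>2 \<le> \<epsilon> / 2"
        proof -
          have "\<delta> * z\<^sup>2 \<le> \<delta> * (z\<^sup>2 + 1)" using \<delta> by (intro mult_left_mono) auto
          also have "\<dots> = \<epsilon> / 2" using z1 by (simp add: \<delta>_def field_simps)
          finally show ?thesis .
        qed
        ultimately have "\<bar>k * ln Z - z\<^sup>2 * \<sigma>2 / 2\<bar> \<le> \<epsilon>" by linarith
        then show "\<bar>real n / (a (real n))\<^sup>2 * ln (\<integral> \<xi>. exp (a (real n) / real n * z * birkhoff_sum g n \<xi>) \<partial>path_measure_at \<mu> p)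
            - z\<^sup>2 * \<sigma>2 / 2\<bar> \<le> \<epsilon>"
          by (simp only: k_def c_def Z_def A_def)
      qed
    qed
  qed
  interpret uniform_log_moments "path_measure_at \<mu>" "\<lambda>n p \<xi>. 1 / a (real n) * birkhoff_sum g n \<xi>" s \<sigma>2
  proof (rule uniform_log_moments.intro)
    fix n p z
    show "prob_space (path_measure_at \<mu> p)" by (rule prob_space_path_measure_at)
    show "(\<lambda>\<xi>. 1 / a (real n) * birkhoff_sum g n \<xi>) \<in> borel_measurable (path_measure_at \<mu> p)"
      using measurable_birkhoff_sum[OF g] by (intro borel_measurable_times borel_measurable_const)
    show "integrable (path_measure_at \<mu> p) (\<lambda>\<xi>. exp (z * (1 / a (real n) * birkhoff_sum g n \<xi>)))"
      using exp_moment(1)[OF g, of p "z * (1 / a (real n))" n] by (simp only: mult.assoc)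
  next
    fix z \<epsilon> :: real assume "\<epsilon> > 0"
    from log_moments[OF this, of z] a_pos
    show "\<forall>\<^sub>F n in sequentially. \<forall>p.
      \<bar>ln (\<integral> \<xi>. exp (s n * z * (1 / a (real n) * birkhoff_sum g n \<xi>)) \<partial>path_measure_at \<mu> p) / s n - z\<^sup>2 * \<sigma>2 / 2\<bar> \<le> \<epsilon>"
    proof eventually_elim
      case (elim n)
      have "s n * z * (1 / a (real n) * S) = a (real n) / real n * z * S" for S
        using elim(2) by (simp add: s_def power2_eq_square)
      moreover have "x / s n = real n / (a (real n))\<^sup>2 * x" for x
        by (simp add: s_def)
      ultimately show ?case using elim(1) by simp
    qed
  qed (use s_top \<sigma>2_nonneg in auto)
  have "(\<lambda>n. SUP p. ereal \<bar>real n / (a (real n))\<^sup>2 *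
      ln (\<integral> \<xi>. exp (a (real n) / real n * z * birkhoff_sum g n \<xi>) \<partial>path_measure_at \<mu> p) - z\<^sup>2 * \<sigma>2 / 2\<bar>) \<longlonglongrightarrow> 0" for z
  proof (rule order_tendstoI)
    fix l :: ereal assume "l < 0"
    have "0 \<le> (SUP p. ereal \<bar>f p\<bar>)" for f :: "'d cproj \<Rightarrow> real"
      by (rule SUP_upper2[of undefined]) auto
    then show "\<forall>\<^sub>F n in sequentially. l < (SUP p. ereal \<bar>real n / (a (real n))\<^sup>2 *
      ln (\<integral> \<xi>. exp (a (real n) / real n * z * birkhoff_sum g n \<xi>) \<partial>path_measure_at \<mu> p) - z\<^sup>2 * \<sigma>2 / 2\<bar>)"
      using \<open>l < 0\<close> by (intro always_eventually allI) (rule less_le_trans)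
  next
    fix l :: ereal assume "0 < l"
    then obtain \<epsilon> where \<epsilon>: "0 < ereal \<epsilon>" "ereal \<epsilon> < l" using ereal_dense2 by blast
    then have "\<epsilon> > 0" by simp
    from log_moments[OF this, of z]
    show "\<forall>\<^sub>F n in sequentially. (SUP p. ereal \<bar>real n / (a (real n))\<^sup>2 *
      ln (\<integral> \<xi>. exp (a (real n) / real n * z * birkhoff_sum g n \<xi>) \<partial>path_measure_at \<mu> p) - z\<^sup>2 * \<sigma>2 / 2\<bar>) < l"
    proof eventually_elim
      case (elim n)
      then show ?case by (intro le_less_trans[OF SUP_least \<epsilon>(2)]) simp
    qed
  qed
  then show ?thesis
    using upper_bound lower_bound rate_fun_eq[OF \<sigma>2_nonneg]
    unfolding inv_s \<sigma>2_def by blast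
qed

end
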